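(* Let $\Omega \subset \mathbb{R}^2$ be (the interior of) an equilateral triangle or an isosceles right triangle, and let $N$ be the local Weyl counting function of $\Omega$ with Dirichlet boundary conditions. If $x, y \in \Omega$ are two points for which \[ N(x,\lambda) = N(y,\lambda) \qquad \text{for each } \lambda \geq 0, \] then there is an isometry $\phi : \Omega \to \Omega$ for which $\phi(x) = y$.
   Context: For a bounded open set $\Omega \subset \mathbb{R}^2$ with piecewise-smooth boundary, let $\{e_j : j \in \mathbb{N}\}$ be an orthonormal basis of $L^2(\Omega)$ consisting of Dirichlet Laplace eigenfunctions: $\Delta e_j = -\lambda_j^2 e_j$ in $\Omega$, $e_j = 0$ on $\partial\Omega$, with $0 < \lambda_1 \le \lambda_2 \le \cdots \to \infty$. The local Weyl counting function is \[ N(x,\lambda) = \sum_{\lambda_j \le \lambda} |e_j(x)|^2, \qquad x \in \Omega, \] which does not depend on the choice of eigenbasis. An isometry of $\Omega$ is a bijection $\phi:\Omega\to\Omega$ with $|\phi(x)-\phi(y)| = |x-y|$ for all $x,y \in \Omega$. *)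

theory Defs
  imports "HOL-Analysis.Analysis"
begin

text \<open>In both definitions \<open>a \<noteq> b\<close> together with the metric conditions rules out degenerate
  triangles.\<close>

definition is_open_equilateral_triangle :: "(real^2) set \<Rightarrow> bool" where
  "is_open_equilateral_triangle \<Omega> \<longleftrightarrow>
     (\<exists>a b c. a \<noteq> b \<and> dist a b = dist b c \<and> dist b c = dist c a \<and>
              \<Omega> = interior (convex hull {a, b, c}))"

definition is_open_isosceles_right_triangle :: "(real^2) set \<Rightarrow> bool" where
  "is_open_isosceles_right_triangle \<Omega> \<longleftrightarrow>
     (\<exists>a b c. a \<noteq> b \<and> dist a b = dist a c \<and> (b - a) \<bullet> (c - a) = 0 \<and>
              \<Omega> = interior (convex hull {a, b, c}))"

definition partial_deriv :: "2 \<Rightarrow> (real^2 \<Rightarrow> complex) \<Rightarrow> real^2 \<Rightarrow> complex" where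
  "partial_deriv i f x = vector_derivative (\<lambda>t. f (x + t *\<^sub>R axis i 1)) (at 0)"

definition laplacian :: "(real^2 \<Rightarrow> complex) \<Rightarrow> real^2 \<Rightarrow> complex" where
  "laplacian f x = (\<Sum>i\<in>UNIV. partial_deriv i (partial_deriv i f) x)"

text \<open>Twice continuously differentiable on an open set \<open>S\<close>.\<close>

definition C2_on :: "(real^2) set \<Rightarrow> (real^2 \<Rightarrow> complex) \<Rightarrow> bool" where
  "C2_on S f \<longleftrightarrow>
     f differentiable_on S \<and>
     (\<forall>i. partial_deriv i f differentiable_on S) \<and>
     (\<forall>i j. continuous_on S (partial_deriv i (partial_deriv j f)))"

text \<open>Complex-valued \<open>L\<^sup>2(\<Omega>)\<close> with respect to Lebesgue measure; a real eigenbasis is a special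
  case.  Elements are functions rather than classes, so that eigenfunctions can be evaluated
  at points.\<close>

definition L2_on :: "(real^2) set \<Rightarrow> (real^2 \<Rightarrow> complex) set" where
  "L2_on \<Omega> = {f. f \<in> borel_measurable (lebesgue_on \<Omega>) \<and>
                 integrable (lebesgue_on \<Omega>) (\<lambda>x. (norm (f x))\<^sup>2)}"

definition L2_inner :: "(real^2) set \<Rightarrow> (real^2 \<Rightarrow> complex) \<Rightarrow> (real^2 \<Rightarrow> complex) \<Rightarrow> complex" where
  "L2_inner \<Omega> f g = (LINT x|lebesgue_on \<Omega>. (f x * cnj (g x)))"

definition orthonormal_basis_L2 :: "(real^2) set \<Rightarrow> (nat \<Rightarrow> real^2 \<Rightarrow> complex) \<Rightarrow> bool" where
  "orthonormal_basis_L2 \<Omega> e \<longleftrightarrow>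
     (\<forall>j. e j \<in> L2_on \<Omega>) \<and>
     (\<forall>j k. L2_inner \<Omega> (e j) (e k) = (if j = k then 1 else 0)) \<and>
     (\<forall>f\<in>L2_on \<Omega>.
        (\<lambda>n. LINT x|lebesgue_on \<Omega>. ((norm (f x - (\<Sum>j<n. L2_inner \<Omega> f (e j) * e j x)))\<^sup>2))
          \<longlonglongrightarrow> 0)"

text \<open>Classical Dirichlet eigenfunction with eigenvalue \<open>\<mu>\<^sup>2\<close>; only its values on
  \<open>closure \<Omega>\<close> matter.\<close>

definition dirichlet_eigenfunction :: "(real^2) set \<Rightarrow> real \<Rightarrow> (real^2 \<Rightarrow> complex) \<Rightarrow> bool" where
  "dirichlet_eigenfunction \<Omega> \<mu> f \<longleftrightarrow>
     (\<exists>x\<in>\<Omega>. f x \<noteq> 0) \<and>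
     C2_on \<Omega> f \<and> continuous_on (closure \<Omega>) f \<and>
     (\<forall>x\<in>\<Omega>. laplacian f x = - (\<mu>\<^sup>2) *\<^sub>R f x) \<and>
     (\<forall>x\<in>frontier \<Omega>. f x = 0)"

text \<open>Indices start at \<open>0\<close>, so \<open>e j\<close> and \<open>lam j\<close> stand for \<open>e\<^sub>j\<^sub>+\<^sub>1\<close> and \<open>\<lambda>\<^sub>j\<^sub>+\<^sub>1\<close>.\<close>

definition dirichlet_eigenbasis ::
    "(real^2) set \<Rightarrow> (nat \<Rightarrow> real) \<Rightarrow> (nat \<Rightarrow> real^2 \<Rightarrow> complex) \<Rightarrow> bool" where
  "dirichlet_eigenbasis \<Omega> lam e \<longleftrightarrow>
     orthonormal_basis_L2 \<Omega> e \<and>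
     (\<forall>j. dirichlet_eigenfunction \<Omega> (lam j) (e j)) \<and>
     0 < lam 0 \<and> mono lam \<and> filterlim lam at_top sequentially"

text \<open>The index set is finite because \<open>lam\<close> tends to infinity.\<close>

definition local_weyl_counting ::
    "(nat \<Rightarrow> real) \<Rightarrow> (nat \<Rightarrow> real^2 \<Rightarrow> complex) \<Rightarrow> real^2 \<Rightarrow> real \<Rightarrow> real" where
  "local_weyl_counting lam e x \<mu> = (\<Sum>j | lam j \<le> \<mu>. (norm (e j x))\<^sup>2)"

definition is_isometry_of :: "(real^2) set \<Rightarrow> (real^2 \<Rightarrow> real^2) \<Rightarrow> bool" where
  "is_isometry_of \<Omega> \<phi> \<longleftrightarrow>
     bij_betw \<phi> \<Omega> \<Omega> \<and> (\<forall>x\<in>\<Omega>. \<forall>y\<in>\<Omega>. dist (\<phi> x) (\<phi> y) = dist x y)"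

end

(* The Dirichlet eigenfunctions of both triangles are alternating sums of plane waves. If v_1, ..., v_r
   is an orthogonal basis of the eigenspace of mu, the jump of N(x, .) at sqrt mu is
   sum_i |v_i(x)|^2 / |v_i|^2, so a few low eigenvalues determine the values |v_i(x)| at x.
   Divided by the first eigenfunction, every eigenfunction is a symmetric polynomial in
   (cos u, cos v) for the right triangle and in three unit complex numbers with product 1 for the
   equilateral one. The values found determine these symmetric functions, hence the point, up to
   the symmetries of the triangle.

   That an abstract eigenbasis spans the same eigenspaces as the explicit functions follows from
   Green's identity (orthogonality for different eigenvalues) and the Stone-Weierstrass theorem
   (completeness of the explicit family). *)

theory Submission
  imports Defs
begin

section \<open>Fubini and Green along coordinate axes\<close>

text \<open>The eigenfunctions vanish on the boundary and are not closed under products, so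
  Stone-Weierstrass cannot be applied to them directly. It is applied to the functions that multiply
  their span into itself. These contain the symmetric functions of the coordinates by product-to-sum
  formulas, and they separate the points of the closed triangle because it is a fundamental domain
  for the reflections in its sides.

  The spectrum is never enumerated and no L2 norm is computed: for each eigenvalue used, it suffices
  to list the lattice points giving it, and the unknown norms are positive weights that cancel. For
  the right triangle these are the four lowest eigenvalues, all simple. For the equilateral triangle
  they are the lowest one and a double one; the latter is spanned by a function and its conjugate,
  of equal modulus, so the jump still isolates this modulus. The symmetries of the triangle act on
  the symmetric functions by a sign in the first case, by conjugation and cube roots of unity in the
  second, which is exactly what the moduli leave undetermined.\<close>

lemma lborel_eq_distr_axes:
  fixes i j :: 2
  assumes "i \<noteq> j"
  shows "(lborel :: (real^2) measure) =
    distr (lborel \<Otimes>\<^sub>M lborel) borel (\<lambda>(s, t). s *\<^sub>R axis i 1 + t *\<^sub>R axis j 1)"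
proof (rule lborel_eqI)
  have U: "(UNIV :: 2 set) = {i, j}"
    using assms exhaust_2[of i] exhaust_2[of j] by (auto simp: UNIV_2)
  fix l u :: "real^2"
  assume "\<And>b. b \<in> Basis \<Longrightarrow> l \<bullet> b \<le> u \<bullet> b"
  then have le: "l $ k \<le> u $ k" for k
    by (metis axis_in_Basis_iff cart_eq_inner_axis insertI1 Basis_real_def)
  have meas: "(\<lambda>(s, t). s *\<^sub>R axis i 1 + t *\<^sub>R axis j 1 :: real^2)
      \<in> lborel \<Otimes>\<^sub>M lborel \<rightarrow>\<^sub>M borel"
    unfolding lborel_prod measurable_lborel2
    by (intro borel_measurable_continuous_onI) (auto simp: case_prod_unfold intro!: continuous_intros)
  have comp: "(s *\<^sub>R axis i 1 + t *\<^sub>R axis j 1 :: real^2) $ i = s"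
    "(s *\<^sub>R axis i 1 + t *\<^sub>R axis j 1 :: real^2) $ j = t" for s t
    using assms by (auto simp: axis_def)
  have vim: "(\<lambda>(s, t). s *\<^sub>R axis i 1 + t *\<^sub>R axis j 1) -` box l u =
      {l $ i<..<u $ i} \<times> {l $ j<..<u $ j}"
  proof -
    have "x \<in> box l u \<longleftrightarrow> l $ i < x $ i \<and> x $ i < u $ i \<and> l $ j < x $ j \<and> x $ j < u $ j" for x
    proof -
      have "(\<forall>k. P k) \<longleftrightarrow> P i \<and> P j" for P :: "2 \<Rightarrow> bool"
        using U by (metis (full_types) UNIV_I insertE singletonD)
      then show ?thesis by (simp add: mem_box_cart conj_assoc)
    qed
    then show ?thesis by (simp only: set_eq_iff vimage_eq case_prod_beta comp mem_Times_iff greaterThanLessThan_iff conj_assoc simp_thms)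
  qed
  have "emeasure (distr (lborel \<Otimes>\<^sub>M lborel) borel
      (\<lambda>(s, t). s *\<^sub>R axis i 1 + t *\<^sub>R axis j 1)) (box l u) =
      emeasure (lborel \<Otimes>\<^sub>M lborel) ({l $ i<..<u $ i} \<times> {l $ j<..<u $ j})"
    by (subst emeasure_distr[OF meas]) (simp_all add: vim space_pair_measure)
  also have "\<dots> = ennreal ((u $ i - l $ i) * (u $ j - l $ j))"
    using le by (subst lborel.emeasure_pair_measure_Times) (auto simp: ennreal_mult)
  also have "(u $ i - l $ i) * (u $ j - l $ j) = (\<Prod>k\<in>UNIV. (u - l) $ k)"
    using assms by (simp add: U)
  also have "\<dots> = (\<Prod>b\<in>Basis. (u - l) \<bullet> b)"
  proof -
    have "Basis = (\<lambda>k. axis k 1 :: real^2) ` UNIV"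
      by (auto simp: Basis_vec_def)
    moreover have "inj (\<lambda>k. axis k 1 :: real^2)"
      by (simp add: axis_eq_axis inj_on_def)
    ultimately have "(\<Prod>b\<in>Basis. (u - l) \<bullet> b) = (\<Prod>k\<in>UNIV. (u - l) \<bullet> axis k 1)"
      using prod.reindex[of "\<lambda>k. axis k 1 :: real^2" UNIV "\<lambda>b. (u - l) \<bullet> b"] by (simp add: o_def)
    then show ?thesis by (simp add: inner_axis)
  qed
  finally show "emeasure (distr (lborel \<Otimes>\<^sub>M lborel) borel
      (\<lambda>(s, t). s *\<^sub>R axis i 1 + t *\<^sub>R axis j 1)) (box l u) = (\<Prod>b\<in>Basis. (u - l) \<bullet> b)" .
qed simp

text \<open>The axes \<open>i\<close> and \<open>j\<close> stay arbitrary, so that Green's identity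
  can integrate first along either direction.\<close>

lemma integral_lborel_axes:
  fixes h :: "real^2 \<Rightarrow> 'a :: {banach, second_countable_topology}" and i j :: 2
  assumes "i \<noteq> j" and h: "integrable lborel h"
  shows "integrable lborel (\<lambda>t. LINT s|lborel. h (s *\<^sub>R axis i 1 + t *\<^sub>R axis j 1))"
    and "(LINT x|lborel. h x) = (LINT t|lborel. LINT s|lborel. h (s *\<^sub>R axis i 1 + t *\<^sub>R axis j 1))"
proof -
  let ?g = "\<lambda>(s, t). s *\<^sub>R axis i 1 + t *\<^sub>R axis j 1 :: real^2"
  have meas: "?g \<in> lborel \<Otimes>\<^sub>M lborel \<rightarrow>\<^sub>M borel"
    unfolding lborel_prod measurable_lborel2
    by (intro borel_measurable_continuous_onI) (auto simp: case_prod_unfold intro!: continuous_intros)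
  have hb: "h \<in> borel_measurable borel"
    using h by (auto dest: borel_measurable_integrable)
  have eq: "lborel = distr (lborel \<Otimes>\<^sub>M lborel) borel ?g"
    by (rule lborel_eq_distr_axes) fact
  have I: "integrable (lborel \<Otimes>\<^sub>M lborel) (\<lambda>z. h (?g z))"
    using h by (subst (asm) eq, subst (asm) integrable_distr_eq[OF meas hb])
  then have I': "integrable (lborel \<Otimes>\<^sub>M lborel) (\<lambda>(s, t). h (s *\<^sub>R axis i 1 + t *\<^sub>R axis j 1))"
    by (simp add: case_prod_unfold)
  show "integrable lborel (\<lambda>t. LINT s|lborel. h (s *\<^sub>R axis i 1 + t *\<^sub>R axis j 1))"
    using lborel_pair.integrable_snd[OF I'] .
  have "(LINT x|lborel. h x) = (LINT z|(lborel \<Otimes>\<^sub>M lborel). h (?g z))"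
    by (subst eq, subst integral_distr[OF meas hb]) simp
  also have "\<dots> = (LINT t|lborel. LINT s|lborel. h (s *\<^sub>R axis i 1 + t *\<^sub>R axis j 1))"
    using lborel_pair.integral_snd[OF I'] by (simp add: case_prod_unfold)
  finally show "(LINT x|lborel. h x) = (LINT t|lborel. LINT s|lborel. h (s *\<^sub>R axis i 1 + t *\<^sub>R axis j 1))" .
qed

text \<open>Derivatives are carried as explicit functions instead of \<open>partial_deriv\<close>
  terms. The property then passes through sums, conjugates and dilations by the derivative rules,
  one axis at a time.\<close>

definition axis_deriv :: "2 \<Rightarrow> (real^2) set \<Rightarrow> (real^2 \<Rightarrow> complex) \<Rightarrow> (real^2 \<Rightarrow> complex) \<Rightarrow> bool" where
  "axis_deriv i S f f' \<longleftrightarrow> continuous_on S f \<and> continuous_on S f' \<and>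
     (\<forall>x\<in>S. ((\<lambda>s. f (x + s *\<^sub>R axis i 1)) has_vector_derivative f' x) (at 0))"

text \<open>\<open>\<kappa>\<close> is the eigenvalue itself, so an eigenfunction of frequency
  \<open>\<mu>\<close> satisfies this with \<open>\<mu>\<^sup>2\<close>; boundary conditions are
  kept apart. The set \<open>S\<close> varies: it is the plane for the explicit functions and a
  dilated copy of \<open>\<Omega>\<close> in the limiting argument.\<close>

definition helmholtz_on :: "(real^2) set \<Rightarrow> real \<Rightarrow> (real^2 \<Rightarrow> complex) \<Rightarrow> bool" where
  "helmholtz_on S \<kappa> f \<longleftrightarrow> (\<exists>(f1 :: 2 \<Rightarrow> real^2 \<Rightarrow> complex) (f2 :: 2 \<Rightarrow> real^2 \<Rightarrow> complex).
     (\<forall>i. axis_deriv i S f (f1 i) \<and> axis_deriv i S (f1 i) (f2 i)) \<and>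
     (\<forall>x\<in>S. sum (\<lambda>i. f2 i x) UNIV = - of_real \<kappa> * f x))"

lemma axis_deriv_line:
  assumes "axis_deriv i S f f'" and "x + s *\<^sub>R axis i 1 \<in> S"
  shows "((\<lambda>s. f (x + s *\<^sub>R axis i 1)) has_vector_derivative f' (x + s *\<^sub>R axis i 1)) (at s within T)"
proof -
  have "((\<lambda>r. f ((x + s *\<^sub>R axis i 1) + r *\<^sub>R axis i 1)) has_vector_derivative
      f' (x + s *\<^sub>R axis i 1)) (at 0)"
    using assms unfolding axis_deriv_def by blast
  moreover have "((\<lambda>r. r - s) has_vector_derivative 1) (at s)"
    by (auto intro!: derivative_eq_intros)
  ultimately have "((\<lambda>r. f ((x + s *\<^sub>R axis i 1) + r *\<^sub>R axis i 1)) \<circ> (\<lambda>r. r - s) has_vector_derivative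
      1 *\<^sub>R f' (x + s *\<^sub>R axis i 1)) (at s)"
    using vector_diff_chain_at[where f = "\<lambda>r. r - s" and x = s and f' = 1 
     and g = "(\<lambda>r. f ((x + s *\<^sub>R axis i 1) + r *\<^sub>R axis i 1))" and g' = "f' (x + s *\<^sub>R axis i 1)"] by simp
  moreover have "(\<lambda>r. f ((x + s *\<^sub>R axis i 1) + r *\<^sub>R axis i 1)) \<circ> (\<lambda>r. r - s) = (\<lambda>s. f (x + s *\<^sub>R axis i 1))"
    by (simp add: o_def algebra_simps)
  ultimately show ?thesis
    by (auto intro: has_vector_derivative_at_within)
qed
text \<open>\<open>f * g' - g * f'\<close> is a primitive of the integrand. The left side uses the
  open interval because slices of an open set are open; the endpoints form a null set.\<close>

lemma integral_lagrange_identity: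
  fixes f g :: "real \<Rightarrow> complex"
  assumes "A \<le> B"
    and f: "\<And>s. s \<in> {A..B} \<Longrightarrow> (f has_vector_derivative f' s) (at s within {A..B})"
           "\<And>s. s \<in> {A..B} \<Longrightarrow> (f' has_vector_derivative f'' s) (at s within {A..B})"
           "continuous_on {A..B} f''"
    and g: "\<And>s. s \<in> {A..B} \<Longrightarrow> (g has_vector_derivative g' s) (at s within {A..B})"
           "\<And>s. s \<in> {A..B} \<Longrightarrow> (g' has_vector_derivative g'' s) (at s within {A..B})"
           "continuous_on {A..B} g''"
  shows "(LINT s|lborel. indicator {A<..<B} s *\<^sub>R (f s * g'' s - g s * f'' s)) =
    (f B * g' B - g B * f' B) - (f A * g' A - g A * f' A)"
proof -
  have cont: "continuous_on {A..B} f" "continuous_on {A..B} g"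
    using f(1) g(1) by (meson continuous_on_vector_derivative)+
  have "(LINT s|lborel. indicator {A<..<B} s *\<^sub>R (f s * g'' s - g s * f'' s)) =
      (LINT s|lborel. indicator {A..B} s *\<^sub>R (f s * g'' s - g s * f'' s))"
  proof (rule integral_cong_AE)
    have "AE s in lborel. s \<noteq> A" "AE s in lborel. s \<noteq> B"
      by (rule AE_lborel_singleton)+
    then show "AE s in lborel. indicator {A<..<B} s *\<^sub>R (f s * g'' s - g s * f'' s) =
        indicator {A..B} s *\<^sub>R (f s * g'' s - g s * f'' s)"
      by eventually_elim (auto simp: indicator_def)
    have c: "continuous_on {A..B} (\<lambda>s. f s * g'' s - g s * f'' s)"
      using cont f(3) g(3) by (intro continuous_intros)
    show "(\<lambda>s. indicator {A..B} s *\<^sub>R (f s * g'' s - g s * f'' s)) \<in> borel_measurable lborel"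
      using borel_measurable_continuous_on_indicator[OF _ c] by simp
    show "(\<lambda>s. indicator {A<..<B} s *\<^sub>R (f s * g'' s - g s * f'' s)) \<in> borel_measurable lborel"
      using borel_measurable_continuous_on_indicator[OF _ continuous_on_subset[OF c, of "{A<..<B}"]]
      by (simp add: greaterThanLessThan_subseteq_atLeastAtMost_iff)
  qed
  also have "\<dots> = (f B * g' B - g B * f' B) - (f A * g' A - g A * f' A)"
  proof (rule integral_FTC_Icc[OF \<open>A \<le> B\<close>])
    show "continuous_on {A..B} (\<lambda>s. f s * g'' s - g s * f'' s)"
      using cont f(3) g(3) by (intro continuous_intros)
    fix s assume "A \<le> s" "s \<le> B"
    then show "((\<lambda>s. f s * g' s - g s * f' s) has_vector_derivative (f s * g'' s - g s * f'' s))
        (at s within {A..B})"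
      by (auto intro!: derivative_eq_intros f g simp: algebra_simps)
  qed
  finally show ?thesis .
qed

text \<open>Convexity makes a slice a single interval, so that each line contributes just two
  boundary values to Green's identity.\<close>

lemma open_convex_bounded_slice:
  fixes \<Omega> :: "'a :: real_normed_vector set"
  assumes "open \<Omega>" "convex \<Omega>" "bounded \<Omega>" and v: "v \<noteq> 0" and ne: "{s. x + s *\<^sub>R v \<in> \<Omega>} \<noteq> {}"
  obtains A B where "A < B" "{s. x + s *\<^sub>R v \<in> \<Omega>} = {A<..<B}"
    "x + A *\<^sub>R v \<in> frontier \<Omega>" "x + B *\<^sub>R v \<in> frontier \<Omega>"
proof -
  let ?S = "{s. x + s *\<^sub>R v \<in> \<Omega>}"
  have S: "?S = (\<lambda>s. x + s *\<^sub>R v) -` \<Omega>" by auto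
  have op: "open ?S"
    unfolding S by (intro open_vimage assms continuous_intros)
  have cv: "convex ?S"
  proof (rule convexI)
    fix s t u w :: real
    assume *: "s \<in> ?S" "t \<in> ?S" "0 \<le> u" "0 \<le> w" "u + w = 1"
    then have "u *\<^sub>R (x + s *\<^sub>R v) + w *\<^sub>R (x + t *\<^sub>R v) \<in> \<Omega>"
      using convexD[OF \<open>convex \<Omega>\<close>] by auto
    moreover have "u *\<^sub>R (x + s *\<^sub>R v) + w *\<^sub>R (x + t *\<^sub>R v) = (u + w) *\<^sub>R x + (u *\<^sub>R s + w *\<^sub>R t) *\<^sub>R v"
      by (simp add: algebra_simps)
    ultimately show "u *\<^sub>R s + w *\<^sub>R t \<in> ?S" using * by simp
  qed
  obtain R where R: "\<And>y. y \<in> \<Omega> \<Longrightarrow> norm y \<le> R"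
    using \<open>bounded \<Omega>\<close> by (auto simp: bounded_iff)
  have bd: "bounded ?S"
  proof (rule boundedI)
    fix s assume "s \<in> ?S"
    then have "norm (x + s *\<^sub>R v) \<le> R" using R by auto
    then have "norm (s *\<^sub>R v) \<le> R + norm x"
      by (smt (verit) add_diff_cancel_left' norm_triangle_ineq4)
    then show "norm s \<le> (R + norm x) / norm v"
      using v by (simp add: field_simps)
  qed
  define A B where "A = Inf ?S" and "B = Sup ?S"
  have bb: "bdd_below ?S" "bdd_above ?S" using bd by (auto intro: bounded_imp_bdd_below bounded_imp_bdd_above)
  have conn: "is_interval ?S" using cv by (simp add: is_interval_convex_1)
  have sub: "s \<in> {A..B}" if "s \<in> ?S" for s
    using that bb by (auto simp: A_def B_def intro: cInf_lower cSup_upper)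
  have nA: "A \<notin> ?S"
  proof
    assume "A \<in> ?S"
    then obtain e where "e > 0" "ball A e \<subseteq> ?S" using op openE by blast
    then have "A - e/2 \<in> ?S" by (auto simp: subset_eq dist_real_def)
    then show False using sub[of "A - e/2"] \<open>e > 0\<close> by auto
  qed
  have nB: "B \<notin> ?S"
  proof
    assume "B \<in> ?S"
    then obtain e where "e > 0" "ball B e \<subseteq> ?S" using op openE by blast
    then have "B + e/2 \<in> ?S" by (auto simp: subset_eq dist_real_def)
    then show False using sub[of "B + e/2"] \<open>e > 0\<close> by auto
  qed
  have eq: "?S = {A<..<B}"
  proof
    show "?S \<subseteq> {A<..<B}" using sub nA nB by (force simp: less_le)
    show "{A<..<B} \<subseteq> ?S"
    proof
      fix s assume s: "s \<in> {A<..<B}"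
      obtain a where "a \<in> ?S" "a < s" using s ne bb(1) unfolding A_def by (meson cInf_less_iff greaterThanLessThan_iff)
      moreover obtain b where "b \<in> ?S" "s < b" using s ne bb(2) unfolding B_def by (meson less_cSup_iff greaterThanLessThan_iff)
      ultimately show "s \<in> ?S" using conn by (meson is_interval_1 less_imp_le)
    qed
  qed
  have "A < B" using ne eq by auto
  have fr: "x + s *\<^sub>R v \<in> frontier \<Omega>" if "s \<in> {A, B}" for s
  proof -
    have "s \<in> closure ?S" using that \<open>A < B\<close> by (auto simp: eq closure_greaterThanLessThan)
    then have "x + s *\<^sub>R v \<in> closure \<Omega>"
    proof -
      have "(\<lambda>s. x + s *\<^sub>R v) ` closure ?S \<subseteq> closure \<Omega>"
        by (rule image_closure_subset) (use closure_subset[of \<Omega>] in \<open>auto intro!: continuous_intros\<close>)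
      then show ?thesis using \<open>s \<in> closure ?S\<close> by auto
    qed
    moreover have "x + s *\<^sub>R v \<notin> \<Omega>" using that nA nB by auto
    ultimately show ?thesis using \<open>open \<Omega>\<close> by (simp add: frontier_def interior_open)
  qed
  show ?thesis using that[OF \<open>A < B\<close> eq] fr by auto
qed

lemma integrable_indicator_open:
  fixes h :: "'a :: euclidean_space \<Rightarrow> 'b :: euclidean_space"
  assumes "open \<Omega>" "bounded \<Omega>" "continuous_on (closure \<Omega>) h"
  shows "integrable lborel (\<lambda>x. indicator \<Omega> x *\<^sub>R h x)"
proof (rule Bochner_Integration.integrable_bound)
  show "integrable lborel (\<lambda>x. indicator (closure \<Omega>) x *\<^sub>R h x)"
    using assms by (intro borel_integrable_compact) auto
  have "continuous_on \<Omega> h" using assms(3) closure_subset continuous_on_subset by blast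
  then show "(\<lambda>x. indicator \<Omega> x *\<^sub>R h x) \<in> borel_measurable lborel"
    using borel_measurable_continuous_on_indicator[of \<Omega> h] \<open>open \<Omega>\<close> by simp
  have "norm (indicator \<Omega> x *\<^sub>R h x) \<le> norm (indicator (closure \<Omega>) x *\<^sub>R h x)" for x
    using closure_subset[of \<Omega>] by (auto simp: indicator_def)
  then show "AE x in lborel. norm (indicator \<Omega> x *\<^sub>R h x) \<le> norm (indicator (closure \<Omega>) x *\<^sub>R h x)"
    by simp
qed

text \<open>\<open>L2_inner\<close> integrates over \<open>lebesgue_on\<close>, whereas Fubini above
  is for \<open>lborel\<close>. Continuity on the open set gives the Borel measurability that
  identifies the two integrals.\<close>

lemma integral_lebesgue_on_eq:
  fixes h :: "'a :: euclidean_space \<Rightarrow> 'b :: euclidean_space"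
  assumes "open \<Omega>" "continuous_on \<Omega> h"
  shows "(LINT x|lebesgue_on \<Omega>. h x) = (LINT x|lborel. indicator \<Omega> x *\<^sub>R h x)"
proof -
  have "(LINT x|lebesgue_on \<Omega>. h x) = (LINT x|lebesgue. indicator \<Omega> x *\<^sub>R h x)"
    using \<open>open \<Omega>\<close> by (subst integral_restrict_space) auto
  also have "\<dots> = (LINT x|lborel. indicator \<Omega> x *\<^sub>R h x)"
    by (rule integral_completion)
      (use borel_measurable_continuous_on_indicator[of \<Omega> h] assms in simp)
  finally show ?thesis .
qed

text \<open>Since \<open>f\<close> vanishes at both ends of a slice, Lagrange's identity leaves only
  the two values of \<open>w * f1\<close>, at most \<open>2 * M * C\<close> together, and the
  derivatives of \<open>w\<close> drop out. The lines meeting \<open>\<Omega>\<close> have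
  parameters in an interval of length \<open>2 * R\<close>.\<close>

lemma slice_green_bound:
  fixes \<Omega> U :: "(real^2) set" and i :: 2
  assumes \<Omega>: "open \<Omega>" "convex \<Omega>" "bounded \<Omega>" and U: "closure \<Omega> \<subseteq> U"
    and w: "axis_deriv i U w w1" "axis_deriv i U w1 w2"
    and f: "axis_deriv i UNIV f f1" "axis_deriv i UNIV f1 f2"
    and f0: "\<And>x. x \<in> frontier \<Omega> \<Longrightarrow> f x = 0"
    and M: "\<And>x. x \<in> frontier \<Omega> \<Longrightarrow> norm (w x) \<le> M"
    and C: "\<And>x. x \<in> frontier \<Omega> \<Longrightarrow> norm (f1 x) \<le> C"
    and R: "\<And>x. x \<in> \<Omega> \<Longrightarrow> norm x \<le> R" and nn: "0 \<le> R" "0 \<le> M" "0 \<le> C"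
  shows "norm (LINT x|lborel. indicator \<Omega> x *\<^sub>R (w x * f2 x - f x * w2 x)) \<le> 4 * R * M * C"
proof -
  obtain j :: 2 where "i \<noteq> j" by (metis (full_types) exhaust_2 one_neq_zero zero_neq_one)
  let ?h = "\<lambda>x. w x * f2 x - f x * w2 x"
  have contU: "continuous_on U w" "continuous_on U w1" "continuous_on U w2"
    "continuous_on UNIV f" "continuous_on UNIV f1" "continuous_on UNIV f2"
    using w f unfolding axis_deriv_def by blast+
  have ch: "continuous_on (closure \<Omega>) ?h"
    using contU(1,3) U continuous_on_subset[OF contU(4), of "closure \<Omega>"]
      continuous_on_subset[OF contU(6), of "closure \<Omega>"]
    by (auto intro!: continuous_intros intro: continuous_on_subset)
  have hi: "integrable lborel (\<lambda>x. indicator \<Omega> x *\<^sub>R ?h x)"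
    by (rule integrable_indicator_open[OF \<Omega>(1) \<Omega>(3) ch])
  define I where "I t = (LINT s|lborel. indicator \<Omega> (s *\<^sub>R axis i 1 + t *\<^sub>R axis j 1) *\<^sub>R
     ?h (s *\<^sub>R axis i 1 + t *\<^sub>R axis j 1))" for t :: real
  have I: "integrable lborel I" "(LINT x|lborel. indicator \<Omega> x *\<^sub>R ?h x) = (LINT t|lborel. I t)"
    using integral_lborel_axes[OF \<open>i \<noteq> j\<close> hi] unfolding I_def by auto
  have Ib: "norm (I t) \<le> indicator {-R..R} t *\<^sub>R (2 * M * C)" for t
  proof (cases "{s. t *\<^sub>R axis j 1 + s *\<^sub>R axis i 1 \<in> \<Omega>} = {}")
    case True
    then have "I t = 0" unfolding I_def by (auto simp: add.commute)
    then show ?thesis using nn by simp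
  next
    case False
    have "axis i 1 \<noteq> (0 :: real^2)" by simp
    from open_convex_bounded_slice[OF \<Omega> this False] obtain A B where AB: "A < B"
      "{s. t *\<^sub>R axis j 1 + s *\<^sub>R axis i 1 \<in> \<Omega>} = {A<..<B}"
      "t *\<^sub>R axis j 1 + A *\<^sub>R axis i 1 \<in> frontier \<Omega>" "t *\<^sub>R axis j 1 + B *\<^sub>R axis i 1 \<in> frontier \<Omega>"
      by blast
    define L where "L s = t *\<^sub>R axis j 1 + s *\<^sub>R (axis i 1 :: real^2)" for s
    obtain s where "L s \<in> \<Omega>" using False by (auto simp: L_def)
    then have "\<bar>L s $ j\<bar> \<le> R" using R component_le_norm_cart order_trans by blast
    then have tR: "t \<in> {-R..R}" using \<open>i \<noteq> j\<close> by (auto simp: L_def axis_def)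
    have clos: "L s \<in> closure \<Omega>" if "s \<in> {A..B}" for s
    proof (cases "s \<in> {A<..<B}")
      case True
      then have "L s \<in> \<Omega>" using AB(2) unfolding L_def by blast
      then show ?thesis using closure_subset by blast
    next
      case s: False
      then have "s = A \<or> s = B" using that by auto
      then show ?thesis using AB(3,4) unfolding L_def by (auto simp: frontier_def)
    qed
    have Lc: "continuous_on {A..B} L" unfolding L_def by (intro continuous_intros)
    have "I t = (LINT s|lborel. indicator {A<..<B} s *\<^sub>R (w (L s) * f2 (L s) - f (L s) * w2 (L s)))"
    proof -
      have "indicator \<Omega> (s *\<^sub>R axis i 1 + t *\<^sub>R axis j 1) = (indicator {A<..<B} s :: real)" for s
      proof -
        have "t *\<^sub>R axis j 1 + s *\<^sub>R axis i 1 \<in> \<Omega> \<longleftrightarrow> s \<in> {A<..<B}"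
          using AB(2) by blast
        then show ?thesis unfolding indicator_def by (simp only: add.commute)
      qed
      then show ?thesis unfolding I_def L_def by (simp add: add.commute[of "t *\<^sub>R axis j 1"])
    qed
    also have "\<dots> = (w (L B) * f1 (L B) - f (L B) * w1 (L B)) - (w (L A) * f1 (L A) - f (L A) * w1 (L A))"
    proof (rule integral_lagrange_identity)
      fix s assume "s \<in> {A..B}"
      then have LU: "t *\<^sub>R axis j 1 + s *\<^sub>R axis i 1 \<in> U" using clos U unfolding L_def by blast
      show "((\<lambda>s. w (L s)) has_vector_derivative w1 (L s)) (at s within {A..B})"
        "((\<lambda>s. w1 (L s)) has_vector_derivative w2 (L s)) (at s within {A..B})"
        "((\<lambda>s. f (L s)) has_vector_derivative f1 (L s)) (at s within {A..B})"
        "((\<lambda>s. f1 (L s)) has_vector_derivative f2 (L s)) (at s within {A..B})"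
        unfolding L_def by (rule axis_deriv_line[OF w(1)] axis_deriv_line[OF w(2)]
            axis_deriv_line[OF f(1)] axis_deriv_line[OF f(2)]; simp add: LU)+
    next
      show "continuous_on {A..B} (\<lambda>s. w2 (L s))" "continuous_on {A..B} (\<lambda>s. f2 (L s))"
        by (rule continuous_on_compose2[OF contU(3) Lc] continuous_on_compose2[OF contU(6) Lc],
            use clos U in blast)+
    qed (use AB in auto)
    also have "\<dots> = w (L B) * f1 (L B) - w (L A) * f1 (L A)"
      using f0 AB(3,4) by (simp add: L_def)
    also have "norm \<dots> \<le> norm (w (L B)) * norm (f1 (L B)) + norm (w (L A)) * norm (f1 (L A))"
      by (metis norm_mult norm_triangle_ineq4)
    also have "\<dots> \<le> M * C + M * C"
      using AB(3,4) M C nn unfolding L_def by (intro add_mono mult_mono) auto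
    finally show ?thesis using tR by (simp add: mult_ac)
  qed
  have "norm (LINT t|lborel. I t) \<le> (LINT t|lborel. norm (I t))"
    by simp
  also have "\<dots> \<le> (LINT t|lborel. indicator {-R..R} t *\<^sub>R (2 * M * C))"
  proof (rule integral_mono)
    show "integrable lborel (\<lambda>t. norm (I t))" using I(1) by (rule integrable_norm)
    have "integrable lborel (\<lambda>t. indicator {-R..R} t *\<^sub>R (2 * M * C) :: real)"
      by (intro borel_integrable_compact) auto
    then show "integrable lborel (\<lambda>t. indicator {-R..R} t *\<^sub>R (2 * M * C) :: real)" .
  qed (rule Ib)
  also have "\<dots> = 4 * R * M * C"
    using nn by simp
  finally show ?thesis using I(2) by simp
qed

text \<open>\<open>C\<close> is fixed before \<open>U\<close>, \<open>\<nu>\<close>,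
  \<open>w\<close> and \<open>M\<close> are chosen. One constant therefore serves the whole family
  of dilations of a function, whose domains and eigenvalues vary.\<close>

lemma green_bound:
  fixes \<Omega> :: "(real^2) set"
  assumes \<Omega>: "open \<Omega>" "convex \<Omega>" "bounded \<Omega>"
    and f: "helmholtz_on UNIV \<kappa> f" and f0: "\<And>x. x \<in> frontier \<Omega> \<Longrightarrow> f x = 0"
  obtains C where "\<And>U \<nu> w M. closure \<Omega> \<subseteq> U \<Longrightarrow> helmholtz_on U \<nu> w \<Longrightarrow> 0 \<le> M \<Longrightarrow>
      (\<And>x. x \<in> frontier \<Omega> \<Longrightarrow> norm (w x) \<le> M) \<Longrightarrow>
      norm (of_real (\<nu> - \<kappa>) * (LINT x|lborel. indicator \<Omega> x *\<^sub>R (w x * f x))) \<le> C * M"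
proof -
  obtain f1 f2 where F: "\<And>i. axis_deriv i UNIV f (f1 i)" "\<And>i. axis_deriv i UNIV (f1 i) (f2 i)"
    "\<And>x. sum (\<lambda>i. f2 i x) UNIV = - of_real \<kappa> * f x"
    using f unfolding helmholtz_on_def by blast
  obtain R where R: "R > 0" "\<And>x. x \<in> \<Omega> \<Longrightarrow> norm x \<le> R"
    using \<Omega>(3) bounded_pos by metis
  have "\<exists>C>0. \<forall>x\<in>frontier \<Omega>. norm (f1 i x) \<le> C" for i
  proof -
    have "continuous_on (frontier \<Omega>) (f1 i)"
      using F(1)[of i] continuous_on_subset unfolding axis_deriv_def by blast
    moreover have "compact (frontier \<Omega>)"
      using \<Omega>(3) by (simp add: compact_frontier_bounded)
    ultimately have "bounded (f1 i ` frontier \<Omega>)"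
      using compact_continuous_image compact_imp_bounded by blast
    then show ?thesis unfolding bounded_pos by auto
  qed
  then obtain C where C: "\<And>i. C i > 0" "\<And>i x. x \<in> frontier \<Omega> \<Longrightarrow> norm (f1 i x) \<le> C i"
    by metis
  show ?thesis
  proof (rule that[of "\<Sum>i\<in>UNIV. 4 * R * C i"])
    fix U \<nu> w M
    assume U: "closure \<Omega> \<subseteq> U" and w: "helmholtz_on U \<nu> w" and M: "0 \<le> M"
      "\<And>x. x \<in> frontier \<Omega> \<Longrightarrow> norm (w x) \<le> M"
    obtain w1 w2 where W: "\<And>i. axis_deriv i U w (w1 i)" "\<And>i. axis_deriv i U (w1 i) (w2 i)"
      "\<And>x. x \<in> U \<Longrightarrow> sum (\<lambda>i. w2 i x) UNIV = - of_real \<nu> * w x"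
      using w unfolding helmholtz_on_def by blast
    let ?h = "\<lambda>i x. w x * f2 i x - f x * w2 i x"
    have int: "integrable lborel (\<lambda>x. indicator \<Omega> x *\<^sub>R ?h i x)" for i
    proof (rule integrable_indicator_open[OF \<Omega>(1) \<Omega>(3)])
      have "continuous_on U w" "continuous_on U (w2 i)" "continuous_on UNIV f" "continuous_on UNIV (f2 i)"
        using W F unfolding axis_deriv_def by blast+
      then show "continuous_on (closure \<Omega>) (?h i)"
        using U by (auto intro!: continuous_intros intro: continuous_on_subset)
    qed
    have pt: "indicator \<Omega> x *\<^sub>R (of_real (\<nu> - \<kappa>) * (w x * f x)) = (\<Sum>i\<in>UNIV. indicator \<Omega> x *\<^sub>R ?h i x)" for x
    proof (cases "x \<in> \<Omega>")
      case True
      then have "x \<in> U" using U closure_subset by blast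
      have "(\<Sum>i\<in>UNIV. ?h i x) = w x * sum (\<lambda>i. f2 i x) UNIV - f x * sum (\<lambda>i. w2 i x) UNIV"
        by (simp only: sum_subtractf sum_distrib_left)
      also have "\<dots> = of_real (\<nu> - \<kappa>) * (w x * f x)"
        unfolding F(3) W(3)[OF \<open>x \<in> U\<close>] by (simp add: algebra_simps)
      finally show ?thesis using True by simp
    qed simp
    have "of_real (\<nu> - \<kappa>) * (LINT x|lborel. indicator \<Omega> x *\<^sub>R (w x * f x)) =
        (LINT x|lborel. indicator \<Omega> x *\<^sub>R (of_real (\<nu> - \<kappa>) * (w x * f x)))"
      by (simp only: integral_mult_right_zero[symmetric] mult_scaleR_right)
    also have "\<dots> = (\<Sum>i\<in>UNIV. LINT x|lborel. indicator \<Omega> x *\<^sub>R ?h i x)"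
      unfolding pt by (rule Bochner_Integration.integral_sum) (rule int)
    also have "norm \<dots> \<le> (\<Sum>i\<in>UNIV. 4 * R * M * C i)"
    proof (rule order_trans[OF norm_sum sum_mono])
      fix i :: 2
      show "norm (LINT x|lborel. indicator \<Omega> x *\<^sub>R ?h i x) \<le> 4 * R * M * C i"
        by (rule slice_green_bound[OF \<Omega> U W(1) W(2) F(1) F(2) f0 M(2) C(2) R(2)])
          (use R M C(1)[of i] in auto)
    qed
    also have "\<dots> = (\<Sum>i\<in>UNIV. 4 * R * C i) * M"
      by (simp add: sum_distrib_left sum_distrib_right algebra_simps)
    finally show "norm (of_real (\<nu> - \<kappa>) * (LINT x|lborel. indicator \<Omega> x *\<^sub>R (w x * f x)))
        \<le> (\<Sum>i\<in>UNIV. 4 * R * C i) * M" .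
  qed
qed

section \<open>Orthogonality of Dirichlet eigenfunctions for different eigenvalues\<close>

lemma helmholtz_on_scale:
  assumes "helmholtz_on S \<nu> u"
  shows "helmholtz_on {x. p + t *\<^sub>R (x - p) \<in> S} (t\<^sup>2 * \<nu>) (\<lambda>x. u (p + t *\<^sub>R (x - p)))"
proof -
  let ?L = "\<lambda>x. p + t *\<^sub>R (x - p)" and ?S = "{x. p + t *\<^sub>R (x - p) \<in> S}"
  obtain f1 f2 where F: "\<And>i. axis_deriv i S u (f1 i)" "\<And>i. axis_deriv i S (f1 i) (f2 i)"
    "\<And>x. x \<in> S \<Longrightarrow> sum (\<lambda>i. f2 i x) UNIV = - of_real \<nu> * u x"
    using assms unfolding helmholtz_on_def by blast
  \<comment> \<open>The factor \<open>c\<close> lets one fact serve both orders: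
    \<open>c = 1\<close> for \<open>u\<close> and \<open>c = t\<close> for its first
    derivative.\<close>
  have *: "axis_deriv i ?S (\<lambda>x. of_real c * f (?L x)) (\<lambda>x. of_real (c * t) * f' (?L x))"
    if "axis_deriv i S f f'" for i f f' c
  proof -
    have "continuous_on ?S (\<lambda>x. f (?L x))" "continuous_on ?S (\<lambda>x. f' (?L x))"
    proof -
      have "continuous_on S f" "continuous_on S f'" using that unfolding axis_deriv_def by auto
      moreover have "continuous_on ?S ?L" by (intro continuous_intros)
      ultimately show "continuous_on ?S (\<lambda>x. f (?L x))" "continuous_on ?S (\<lambda>x. f' (?L x))"
        by (auto intro: continuous_on_compose2)
    qed
    moreover have "((\<lambda>s. of_real c * f (?L (x + s *\<^sub>R axis i 1))) has_vector_derivative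
        of_real (c * t) * f' (?L x)) (at 0)" if x: "x \<in> ?S" for x
    proof -
      have "((\<lambda>s. f (?L x + s *\<^sub>R axis i 1)) has_vector_derivative f' (?L x)) (at (t * 0))"
        using \<open>axis_deriv i S f f'\<close> x unfolding axis_deriv_def by auto
      moreover have "((\<lambda>s. t * s) has_vector_derivative t) (at 0)"
        by (auto intro!: derivative_eq_intros)
      ultimately have "((\<lambda>s. f (?L x + s *\<^sub>R axis i 1)) \<circ> (\<lambda>s. t * s) has_vector_derivative
          t *\<^sub>R f' (?L x)) (at 0)"
        using vector_diff_chain_at[where f = "\<lambda>s. t * s" and x = 0 and f' = t
          and g = "\<lambda>s. f (?L x + s *\<^sub>R axis i 1)" and g' = "f' (?L x)"] by simp
      moreover have "(\<lambda>s. f (?L x + s *\<^sub>R axis i 1)) \<circ> (\<lambda>s. t * s) = (\<lambda>s. f (?L (x + s *\<^sub>R axis i 1)))"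
        by (simp add: o_def algebra_simps)
      ultimately have "((\<lambda>s. f (?L (x + s *\<^sub>R axis i 1))) has_vector_derivative t *\<^sub>R f' (?L x)) (at 0)"
        by simp
      then have "((\<lambda>s. of_real c * f (?L (x + s *\<^sub>R axis i 1))) has_vector_derivative
          of_real c * (t *\<^sub>R f' (?L x))) (at 0)"
        by (rule has_vector_derivative_mult_right)
      then show ?thesis by (simp add: scaleR_conv_of_real mult.assoc)
    qed
    ultimately show ?thesis unfolding axis_deriv_def by (auto intro!: continuous_intros)
  qed
  have "axis_deriv i ?S (\<lambda>x. u (?L x)) (\<lambda>x. of_real t * f1 i (?L x))" for i
    using *[OF F(1), of i 1] by simp
  moreover have "axis_deriv i ?S (\<lambda>x. of_real t * f1 i (?L x)) (\<lambda>x. of_real (t * t) * f2 i (?L x))" for i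
    using *[OF F(2), of i t] by simp
  moreover have "sum (\<lambda>i. of_real (t * t) * f2 i (?L x)) UNIV = - of_real (t\<^sup>2 * \<nu>) * u (?L x)"
    if "x \<in> ?S" for x
  proof -
    have "sum (\<lambda>i. of_real (t * t) * f2 i (?L x)) UNIV = of_real (t * t) * sum (\<lambda>i. f2 i (?L x)) UNIV"
      by (simp only: sum_distrib_left)
    also have "\<dots> = - of_real (t\<^sup>2 * \<nu>) * u (?L x)"
      using F(3)[of "?L x"] that by (simp add: power2_eq_square)
    finally show ?thesis .
  qed
  ultimately show ?thesis
    unfolding helmholtz_on_def
    by (intro exI[of _ "\<lambda>i x. of_real t * f1 i (?L x)"] exI[of _ "\<lambda>i x. of_real (t * t) * f2 i (?L x)"]) blast
qed

text \<open>The gradient of \<open>u\<close> may blow up at the boundary, so Green's identity is applied to the dilated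
  functions \<open>x \<mapsto> u (p + t (x - p))\<close> with \<open>t < 1\<close>.  As \<open>f\<close> vanishes on the boundary, only the boundary
  values of these functions enter, and they tend to 0 as \<open>t \<rightarrow> 1\<close>.\<close>

lemma helmholtz_dirichlet_orthogonal:
  fixes \<Omega> :: "(real^2) set"
  assumes \<Omega>: "open \<Omega>" "convex \<Omega>" "bounded \<Omega>"
    and u: "helmholtz_on \<Omega> \<nu> u" "continuous_on (closure \<Omega>) u" "\<And>x. x \<in> frontier \<Omega> \<Longrightarrow> u x = 0"
    and f: "helmholtz_on UNIV \<kappa> f" "\<And>x. x \<in> frontier \<Omega> \<Longrightarrow> f x = 0"
    and "\<nu> \<noteq> \<kappa>"
  shows "(LINT x|lborel. indicator \<Omega> x *\<^sub>R (u x * f x)) = 0"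
proof (cases "\<Omega> = {}")
  case False
  then obtain p where "p \<in> \<Omega>" by blast
  define J where "J = (LINT x|lborel. indicator \<Omega> x *\<^sub>R (u x * f x))"
  \<comment> \<open>The shift by 2 keeps every \<open>t n\<close> strictly between 0 and 1, starting
    with \<open>t 0 = 1/2\<close>.\<close>
  define t :: "nat \<Rightarrow> real" where "t n = 1 - 1 / real (n + 2)" for n
  let ?L = "\<lambda>n x. p + t n *\<^sub>R (x - p)"
  have t: "0 < t n" "t n < 1" for n by (auto simp: t_def field_simps)
  have tl: "t \<longlonglongrightarrow> 1"
  proof -
    have "(\<lambda>n. 1 - 1 / real (n + 2)) \<longlonglongrightarrow> 1 - 0"
      by (intro tendsto_intros LIMSEQ_ignore_initial_segment[OF lim_1_over_n])
    then show ?thesis by (simp add: t_def[abs_def])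
  qed
  have cpt: "compact (closure \<Omega>)" using \<Omega> by simp
  obtain D where D: "D > 0" "\<And>x. x \<in> closure \<Omega> \<Longrightarrow> norm (x - p) \<le> D"
  proof -
    have "bounded ((\<lambda>x. x - p) ` closure \<Omega>)"
      using \<Omega>(3) by (intro bounded_translation_minus bounded_closure)
    then show ?thesis using that unfolding bounded_pos by auto
  qed
  \<comment> \<open>Shrinking the convex closure towards the interior point \<open>p\<close> moves
    it into \<open>\<Omega>\<close>; hence the dilated function solves its equation on a set
    containing the whole closure.\<close>
  have LU: "?L n x \<in> \<Omega>" if "x \<in> closure \<Omega>" for n x
  proof -
    have "x - (1 - t n) *\<^sub>R (x - p) \<in> interior \<Omega>"
      using that \<open>p \<in> \<Omega>\<close> \<Omega> t[of n]
      by (intro mem_interior_closure_convex_shrink) (auto simp: interior_open)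
    moreover have "x - (1 - t n) *\<^sub>R (x - p) = ?L n x" by (simp add: algebra_simps)
    ultimately show ?thesis using \<Omega>(1) by (simp add: interior_open)
  qed
  obtain C where C: "\<And>U \<nu> w M. closure \<Omega> \<subseteq> U \<Longrightarrow> helmholtz_on U \<nu> w \<Longrightarrow> 0 \<le> M \<Longrightarrow>
      (\<And>x. x \<in> frontier \<Omega> \<Longrightarrow> norm (w x) \<le> M) \<Longrightarrow>
      norm (of_real (\<nu> - \<kappa>) * (LINT x|lborel. indicator \<Omega> x *\<^sub>R (w x * f x))) \<le> C * M"
    using green_bound[OF \<Omega> f] by blast
  have fc: "continuous_on A f" for A
  proof -
    have "continuous_on UNIV f" using f(1) unfolding helmholtz_on_def axis_deriv_def by blast
    then show ?thesis by (rule continuous_on_subset) simp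
  qed
  define K where "K = (LINT x|lborel. indicator \<Omega> x *\<^sub>R norm (f x))"
  have Kint: "integrable lborel (\<lambda>x. indicator \<Omega> x *\<^sub>R norm (f x))"
    by (rule integrable_indicator_open[OF \<Omega>(1) \<Omega>(3)]) (intro continuous_intros fc)
  have K0: "K \<ge> 0" unfolding K_def by (intro integral_nonneg_AE) auto
  \<comment> \<open>Two errors of size \<open>\<epsilon>\<close> add up: \<open>C\<close> comes from
    the boundary values of the dilated function, \<open>K\<close> from replacing it by
    \<open>u\<close> under the integral, where
    \<open>\<bar>\<nu>\<bar> + \<bar>\<kappa>\<bar>\<close> bounds the factor
    \<open>(t n)\<^sup>2 * \<nu> - \<kappa>\<close>.\<close>
  have key: "norm (of_real (\<nu> - \<kappa>) * J) \<le> \<epsilon> * (C + (\<bar>\<nu>\<bar> + \<bar>\<kappa>\<bar>) * K)" if "\<epsilon> > 0" for \<epsilon>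
  proof -
    obtain \<delta> where \<delta>: "\<delta> > 0"
      "\<And>x x'. x \<in> closure \<Omega> \<Longrightarrow> x' \<in> closure \<Omega> \<Longrightarrow> dist x' x < \<delta> \<Longrightarrow> dist (u x') (u x) < \<epsilon>"
      using compact_uniformly_continuous[OF u(2) cpt] \<open>\<epsilon> > 0\<close> unfolding uniformly_continuous_on_def by metis
    have "eventually (\<lambda>n. t n > 1 - \<delta> / D) sequentially"
      using tl by (rule order_tendstoD) (use \<delta> D in auto)
    then have "eventually (\<lambda>n. norm (of_real ((t n)\<^sup>2 * \<nu> - \<kappa>) * J) \<le> \<epsilon> * (C + (\<bar>\<nu>\<bar> + \<bar>\<kappa>\<bar>) * K)) sequentially"
    proof eventually_elim
      case (elim n)
      have close: "norm (u (?L n x) - u x) < \<epsilon>" if "x \<in> closure \<Omega>" for x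
      proof -
        have "?L n x - x = (t n - 1) *\<^sub>R (x - p)" by (simp add: algebra_simps)
        then have "dist (?L n x) x = (1 - t n) * norm (x - p)"
          using t[of n] by (simp add: dist_norm)
        also have "\<dots> \<le> (1 - t n) * D" using D(2)[OF that] t[of n] by (intro mult_left_mono) auto
        also have "\<dots> < \<delta>" using elim D(1) by (simp add: field_simps)
        finally have "dist (u (?L n x)) (u x) < \<epsilon>"
          using \<delta>(2) that LU closure_subset by blast
        then show ?thesis by (simp add: dist_norm)
      qed
      have cw: "continuous_on (closure \<Omega>) (\<lambda>x. u (?L n x))"
      proof (rule continuous_on_compose2[OF u(2)])
        show "continuous_on (closure \<Omega>) (?L n)" by (intro continuous_intros)
        show "?L n ` closure \<Omega> \<subseteq> closure \<Omega>" using LU closure_subset by blast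
      qed
      define Jn where "Jn = (LINT x|lborel. indicator \<Omega> x *\<^sub>R (u (?L n x) * f x))"
      have intn: "integrable lborel (\<lambda>x. indicator \<Omega> x *\<^sub>R (u (?L n x) * f x))"
        "integrable lborel (\<lambda>x. indicator \<Omega> x *\<^sub>R (u x * f x))"
        by (rule integrable_indicator_open[OF \<Omega>(1) \<Omega>(3)], intro continuous_intros fc cw u(2))+
      have 1: "norm (of_real ((t n)\<^sup>2 * \<nu> - \<kappa>) * Jn) \<le> C * \<epsilon>"
        unfolding Jn_def
      proof (rule C)
        show "helmholtz_on {x. ?L n x \<in> \<Omega>} ((t n)\<^sup>2 * \<nu>) (\<lambda>x. u (?L n x))"
          by (rule helmholtz_on_scale[OF u(1)])
        show "closure \<Omega> \<subseteq> {x. ?L n x \<in> \<Omega>}" using LU by blast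
        show "norm (u (?L n x)) \<le> \<epsilon>" if "x \<in> frontier \<Omega>" for x
          using close[of x] u(3)[OF that] that by (auto simp: frontier_def)
      qed (use \<open>\<epsilon> > 0\<close> in auto)
      have "J - Jn = (LINT x|lborel. indicator \<Omega> x *\<^sub>R (u x * f x) - indicator \<Omega> x *\<^sub>R (u (?L n x) * f x))"
        unfolding J_def Jn_def by (rule Bochner_Integration.integral_diff[symmetric, OF intn(2) intn(1)])
      also have "norm \<dots> \<le> (LINT x|lborel. norm (indicator \<Omega> x *\<^sub>R (u x * f x) - indicator \<Omega> x *\<^sub>R (u (?L n x) * f x)))"
        by (rule integral_norm_bound)
      also have "\<dots> \<le> (LINT x|lborel. \<epsilon> * (indicator \<Omega> x *\<^sub>R norm (f x)))"
      proof (rule integral_mono)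
        fix x :: "real^2"
        show "norm (indicator \<Omega> x *\<^sub>R (u x * f x) - indicator \<Omega> x *\<^sub>R (u (?L n x) * f x)) \<le>
            \<epsilon> * (indicator \<Omega> x *\<^sub>R norm (f x))"
        proof (cases "x \<in> \<Omega>")
          case True
          then have "norm (u (?L n x) - u x) \<le> \<epsilon>" using close[of x] closure_subset by fastforce
          then have "norm (u x - u (?L n x)) * norm (f x) \<le> \<epsilon> * norm (f x)"
            by (intro mult_right_mono) (auto simp: norm_minus_commute)
          then show ?thesis using True by (simp add: norm_mult[symmetric] left_diff_distrib)
        qed simp
      qed (intro integrable_norm Bochner_Integration.integrable_diff intn, use Kint in simp)
      also have "\<dots> = \<epsilon> * K" unfolding K_def by simp
      finally have 2: "norm (J - Jn) \<le> \<epsilon> * K" .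
      have "\<bar>(t n)\<^sup>2 * \<nu> - \<kappa>\<bar> \<le> \<bar>(t n)\<^sup>2 * \<nu>\<bar> + \<bar>\<kappa>\<bar>" by (rule abs_triangle_ineq4)
      also have "\<bar>(t n)\<^sup>2 * \<nu>\<bar> \<le> 1 * \<bar>\<nu>\<bar>"
        unfolding abs_mult using t[of n] by (intro mult_right_mono) (auto intro: power_le_one)
      finally have 3: "\<bar>(t n)\<^sup>2 * \<nu> - \<kappa>\<bar> \<le> \<bar>\<nu>\<bar> + \<bar>\<kappa>\<bar>" by simp
      have "norm (of_real ((t n)\<^sup>2 * \<nu> - \<kappa>) * J) = norm (of_real ((t n)\<^sup>2 * \<nu> - \<kappa>) * Jn + of_real ((t n)\<^sup>2 * \<nu> - \<kappa>) * (J - Jn))"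
        by (simp add: algebra_simps)
      also have "\<dots> \<le> C * \<epsilon> + norm (of_real ((t n)\<^sup>2 * \<nu> - \<kappa>) * (J - Jn))"
        by (rule norm_triangle_le) (use 1 in simp)
      also have "norm (of_real ((t n)\<^sup>2 * \<nu> - \<kappa>) * (J - Jn)) = \<bar>(t n)\<^sup>2 * \<nu> - \<kappa>\<bar> * norm (J - Jn)"
        by (simp only: norm_mult norm_of_real)
      also have "\<dots> \<le> (\<bar>\<nu>\<bar> + \<bar>\<kappa>\<bar>) * (\<epsilon> * K)"
        using 2 3 by (intro mult_mono) auto
      finally show ?case by (simp add: algebra_simps)
    qed
    moreover have "(\<lambda>n. norm (of_real ((t n)\<^sup>2 * \<nu> - \<kappa>) * J)) \<longlonglongrightarrow> norm (of_real (1\<^sup>2 * \<nu> - \<kappa>) * J)"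
      by (intro tendsto_intros tl)
    ultimately have "norm (of_real (1\<^sup>2 * \<nu> - \<kappa>) * J) \<le> \<epsilon> * (C + (\<bar>\<nu>\<bar> + \<bar>\<kappa>\<bar>) * K)"
      by (intro tendsto_upperbound) auto
    then show ?thesis by simp
  qed
  have "norm (of_real (\<nu> - \<kappa>) * J) \<le> 0"
  proof (rule field_le_epsilon)
    fix e :: real assume "e > 0"
    define B where "B = \<bar>C + (\<bar>\<nu>\<bar> + \<bar>\<kappa>\<bar>) * K\<bar> + 1"
    have "norm (of_real (\<nu> - \<kappa>) * J) \<le> e / B * (C + (\<bar>\<nu>\<bar> + \<bar>\<kappa>\<bar>) * K)"
      by (rule key) (use \<open>e > 0\<close> in \<open>auto simp: B_def\<close>)
    also have "\<dots> \<le> e / B * B" using \<open>e > 0\<close> by (intro mult_left_mono) (auto simp: B_def)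
    also have "\<dots> = e" by (simp add: B_def)
    finally show "norm (of_real (\<nu> - \<kappa>) * J) \<le> 0 + e" by simp
  qed
  then show ?thesis using \<open>\<nu> \<noteq> \<kappa>\<close> by (simp add: J_def)
qed simp

lemma dirichlet_eigenfunction_helmholtz:
  assumes "dirichlet_eigenfunction \<Omega> \<mu> f" "open \<Omega>"
  shows "helmholtz_on \<Omega> (\<mu>\<^sup>2) f"
proof -
  have C2: "f differentiable_on \<Omega>" "\<And>i. partial_deriv i f differentiable_on \<Omega>"
    "\<And>i j. continuous_on \<Omega> (partial_deriv i (partial_deriv j f))"
    and lap: "\<And>x. x \<in> \<Omega> \<Longrightarrow> laplacian f x = - (\<mu>\<^sup>2) *\<^sub>R f x"
    using assms unfolding dirichlet_eigenfunction_def C2_on_def by blast+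
  have *: "((\<lambda>s. g (x + s *\<^sub>R axis i 1)) has_vector_derivative partial_deriv i g x) (at 0)"
    if "g differentiable_on \<Omega>" "x \<in> \<Omega>" for g i x
  proof -
    have "g differentiable (at x)"
      using that \<open>open \<Omega>\<close> by (simp add: differentiable_on_eq_differentiable_at)
    then have "g differentiable (at ((\<lambda>s. x + s *\<^sub>R axis i 1) (0::real)))" by simp
    moreover have "(\<lambda>s. x + s *\<^sub>R axis i 1) differentiable (at (0::real))"
      by (intro derivative_intros)
    ultimately have "(g \<circ> (\<lambda>s. x + s *\<^sub>R axis i 1)) differentiable (at (0::real))"
      by (rule differentiable_chain_at[rotated])
    then show ?thesis
      unfolding partial_deriv_def o_def by (simp add: vector_derivative_works)
  qed
  show ?thesis unfolding helmholtz_on_def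
  proof (intro exI conjI allI ballI)
    fix i
    show "axis_deriv i \<Omega> f (partial_deriv i f)"
      using C2 * by (auto simp: axis_deriv_def differentiable_imp_continuous_on)
    show "axis_deriv i \<Omega> (partial_deriv i f) (partial_deriv i (partial_deriv i f))"
      using C2 * by (auto simp: axis_deriv_def differentiable_imp_continuous_on)
  next
    fix x assume "x \<in> \<Omega>"
    then show "sum (\<lambda>i. partial_deriv i (partial_deriv i f) x) UNIV = - of_real (\<mu>\<^sup>2) * f x"
      using lap[of x] unfolding laplacian_def by (simp add: scaleR_conv_of_real)
  qed
qed

section \<open>Solutions of the Helmholtz equation\<close>

lemma axis_deriv_add:
  "axis_deriv i S f f' \<Longrightarrow> axis_deriv i S g g' \<Longrightarrow> axis_deriv i S (\<lambda>x. f x + g x) (\<lambda>x. f' x + g' x)"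
  unfolding axis_deriv_def by (auto intro!: continuous_intros has_vector_derivative_add)

lemma axis_deriv_cmult:
  "axis_deriv i S f f' \<Longrightarrow> axis_deriv i S (\<lambda>x. c * f x) (\<lambda>x. c * f' x)"
  unfolding axis_deriv_def by (auto intro!: continuous_intros has_vector_derivative_mult_right)

lemma axis_deriv_cnj:
  "axis_deriv i S f f' \<Longrightarrow> axis_deriv i S (\<lambda>x. cnj (f x)) (\<lambda>x. cnj (f' x))"
  unfolding axis_deriv_def by (auto intro!: continuous_intros has_vector_derivative_cnj)

lemma helmholtz_onI:
  assumes "\<And>i. axis_deriv i S f (f1 i)" "\<And>i. axis_deriv i S (f1 i) (f2 i)"
    "\<And>x. x \<in> S \<Longrightarrow> sum (\<lambda>i. f2 i x) UNIV = - of_real \<kappa> * f x"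
  shows "helmholtz_on S \<kappa> f"
  unfolding helmholtz_on_def using assms by blast

lemma helmholtz_on_imp_continuous_on: "helmholtz_on S \<kappa> f \<Longrightarrow> continuous_on S f"
  unfolding helmholtz_on_def axis_deriv_def by blast

lemma helmholtz_on_subset: "helmholtz_on S \<kappa> f \<Longrightarrow> T \<subseteq> S \<Longrightarrow> helmholtz_on T \<kappa> f"
  unfolding helmholtz_on_def axis_deriv_def by (blast intro: continuous_on_subset)

lemma helmholtz_on_add:
  assumes "helmholtz_on S \<kappa> f" "helmholtz_on S \<kappa> g"
  shows "helmholtz_on S \<kappa> (\<lambda>x. f x + g x)"
proof -
  obtain f1 f2 where f: "\<And>i. axis_deriv i S f (f1 i)" "\<And>i. axis_deriv i S (f1 i) (f2 i)"
    "\<And>x. x \<in> S \<Longrightarrow> sum (\<lambda>i. f2 i x) UNIV = - of_real \<kappa> * f x"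
    using assms(1) unfolding helmholtz_on_def by blast
  obtain g1 g2 where g: "\<And>i. axis_deriv i S g (g1 i)" "\<And>i. axis_deriv i S (g1 i) (g2 i)"
    "\<And>x. x \<in> S \<Longrightarrow> sum (\<lambda>i. g2 i x) UNIV = - of_real \<kappa> * g x"
    using assms(2) unfolding helmholtz_on_def by blast
  show ?thesis
  proof (rule helmholtz_onI)
    show "axis_deriv i S (\<lambda>x. f x + g x) (\<lambda>x. f1 i x + g1 i x)" for i by (intro axis_deriv_add f g)
    show "axis_deriv i S (\<lambda>x. f1 i x + g1 i x) (\<lambda>x. f2 i x + g2 i x)" for i by (intro axis_deriv_add f g)
    show "sum (\<lambda>i. f2 i x + g2 i x) UNIV = - of_real \<kappa> * (f x + g x)" if "x \<in> S" for x
      using f(3)[OF that] g(3)[OF that] by (simp add: sum.distrib algebra_simps)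
  qed
qed

lemma helmholtz_on_cmult:
  assumes "helmholtz_on S \<kappa> f"
  shows "helmholtz_on S \<kappa> (\<lambda>x. c * f x)"
proof -
  obtain f1 f2 where f: "\<And>i. axis_deriv i S f (f1 i)" "\<And>i. axis_deriv i S (f1 i) (f2 i)"
    "\<And>x. x \<in> S \<Longrightarrow> sum (\<lambda>i. f2 i x) UNIV = - of_real \<kappa> * f x"
    using assms(1) unfolding helmholtz_on_def by blast
  show ?thesis
  proof (rule helmholtz_onI)
    show "axis_deriv i S (\<lambda>x. c * f x) (\<lambda>x. c * f1 i x)" for i by (intro axis_deriv_cmult f)
    show "axis_deriv i S (\<lambda>x. c * f1 i x) (\<lambda>x. c * f2 i x)" for i by (intro axis_deriv_cmult f)
    show "sum (\<lambda>i. c * f2 i x) UNIV = - of_real \<kappa> * (c * f x)" if "x \<in> S" for x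
      unfolding sum_distrib_left[symmetric] using f(3)[OF that] by simp
  qed
qed

lemma helmholtz_on_diff:
  assumes "helmholtz_on S \<kappa> f" "helmholtz_on S \<kappa> g"
  shows "helmholtz_on S \<kappa> (\<lambda>x. f x - g x)"
  using helmholtz_on_add[OF assms(1) helmholtz_on_cmult[OF assms(2), of "-1"]] by simp

lemma helmholtz_on_cnj:
  assumes "helmholtz_on S \<kappa> f"
  shows "helmholtz_on S \<kappa> (\<lambda>x. cnj (f x))"
proof -
  obtain f1 f2 where f: "\<And>i. axis_deriv i S f (f1 i)" "\<And>i. axis_deriv i S (f1 i) (f2 i)"
    "\<And>x. x \<in> S \<Longrightarrow> sum (\<lambda>i. f2 i x) UNIV = - of_real \<kappa> * f x"
    using assms(1) unfolding helmholtz_on_def by blast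
  show ?thesis
  proof (rule helmholtz_onI)
    show "axis_deriv i S (\<lambda>x. cnj (f x)) (\<lambda>x. cnj (f1 i x))" for i by (intro axis_deriv_cnj f)
    show "axis_deriv i S (\<lambda>x. cnj (f1 i x)) (\<lambda>x. cnj (f2 i x))" for i by (intro axis_deriv_cnj f)
    show "sum (\<lambda>i. cnj (f2 i x)) UNIV = - of_real \<kappa> * cnj (f x)" if "x \<in> S" for x
      unfolding cnj_sum[symmetric] using f(3)[OF that] by simp
  qed
qed

lemma has_vector_derivative_cis_line:
  fixes k x v :: "'a :: real_inner"
  shows "((\<lambda>s. cis (c + k \<bullet> (x + s *\<^sub>R v))) has_vector_derivative
      \<i> * of_real (k \<bullet> v) * cis (c + k \<bullet> x)) (at 0)"
proof -
  have "((\<lambda>s. complex_of_real (c + k \<bullet> (x + s *\<^sub>R v))) has_vector_derivative of_real (k \<bullet> v)) (at 0)"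
    by (intro has_vector_derivative_of_real) (auto intro!: derivative_eq_intros simp: algebra_simps)
  moreover have "((\<lambda>z. exp (\<i> * z)) has_field_derivative \<i> * exp (\<i> * complex_of_real (c + k \<bullet> (x + 0 *\<^sub>R v))))
      (at (complex_of_real (c + k \<bullet> (x + 0 *\<^sub>R v))))"
    by (auto intro!: derivative_eq_intros)
  ultimately have "((\<lambda>z. exp (\<i> * z)) \<circ> (\<lambda>s. complex_of_real (c + k \<bullet> (x + s *\<^sub>R v))) has_vector_derivative
      of_real (k \<bullet> v) * (\<i> * exp (\<i> * complex_of_real (c + k \<bullet> (x + 0 *\<^sub>R v))))) (at 0)"
    by (rule field_vector_diff_chain_at)
  then show ?thesis by (simp add: o_def cis_conv_exp mult_ac)
qed

lemma helmholtz_on_cis: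
  fixes k :: "real^2"
  assumes "k \<bullet> k = \<kappa>"
  shows "helmholtz_on UNIV \<kappa> (\<lambda>x. cis (c + k \<bullet> x))"
proof -
  let ?w = "\<lambda>x. cis (c + k \<bullet> x)" and ?d = "\<lambda>i. \<i> * of_real (k \<bullet> axis i 1)"
  have w: "axis_deriv i UNIV ?w (\<lambda>x. ?d i * ?w x)" for i
    unfolding axis_deriv_def by (auto intro!: continuous_intros has_vector_derivative_cis_line)
  show ?thesis
  proof (rule helmholtz_onI)
    show "axis_deriv i UNIV ?w (\<lambda>x. ?d i * ?w x)" for i by (rule w)
    show "axis_deriv i UNIV (\<lambda>x. ?d i * ?w x) (\<lambda>x. ?d i * (?d i * ?w x))" for i
      by (rule axis_deriv_cmult[OF w])
    fix x :: "real^2"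
    have "(\<Sum>i\<in>UNIV. ?d i * (?d i * ?w x)) = - of_real (\<Sum>i\<in>UNIV. k $ i * k $ i) * ?w x"
      by (simp add: inner_axis sum_distrib_left sum_distrib_right sum_negf mult_ac)
    then show "(\<Sum>i\<in>UNIV. ?d i * (?d i * ?w x)) = - of_real \<kappa> * ?w x"
    proof -
      have "(\<Sum>i\<in>UNIV. k $ i * k $ i) = \<kappa>" using assms by (simp add: inner_vec_def)
      then show ?thesis using \<open>(\<Sum>i\<in>UNIV. ?d i * (?d i * ?w x)) = _\<close> by (simp only:)
    qed
  qed
qed

lemma helmholtz_on_cos:
  fixes k :: "real^2"
  assumes "k \<bullet> k = \<kappa>"
  shows "helmholtz_on UNIV \<kappa> (\<lambda>x. of_real (cos (c + k \<bullet> x)))"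
proof -
  have "helmholtz_on UNIV \<kappa> (\<lambda>x. (1/2) * (cis (c + k \<bullet> x) + cnj (cis (c + k \<bullet> x))))"
    by (intro helmholtz_on_cmult helmholtz_on_add helmholtz_on_cis helmholtz_on_cnj assms)
  moreover have "(1/2) * (cis t + cnj (cis t)) = of_real (cos t)" for t
    by (simp add: complex_eq_iff)
  ultimately show ?thesis by (simp only:)
qed

section \<open>Completeness by Stone-Weierstrass\<close>

inductive_set cspan :: "('a \<Rightarrow> complex) set \<Rightarrow> ('a \<Rightarrow> complex) set" for G where
  base: "g \<in> G \<Longrightarrow> g \<in> cspan G"
| zero: "(\<lambda>_. 0) \<in> cspan G"
| add: "f \<in> cspan G \<Longrightarrow> g \<in> cspan G \<Longrightarrow> (\<lambda>x. f x + g x) \<in> cspan G"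
| scale: "f \<in> cspan G \<Longrightarrow> (\<lambda>x. c * f x) \<in> cspan G"

lemma integral_eq_0_imp_zero_on_open:
  fixes h :: "'a :: euclidean_space \<Rightarrow> real"
  assumes "open \<Omega>" "continuous_on \<Omega> h" "\<And>x. x \<in> \<Omega> \<Longrightarrow> 0 \<le> h x"
    and int: "integrable lborel (\<lambda>x. indicator \<Omega> x *\<^sub>R h x)"
    and zero: "(LINT x|lborel. indicator \<Omega> x *\<^sub>R h x) = 0" and "x \<in> \<Omega>"
  shows "h x = 0"
proof (rule ccontr)
  assume "h x \<noteq> 0"
  then have hx: "h x > 0" using assms by (simp add: less_le)
  have "isCont h x" using assms by (simp add: continuous_on_eq_continuous_at)
  then have "eventually (\<lambda>y. h y > 0) (at x)"
    using hx by (simp add: isCont_def order_tendstoD)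
  then have "eventually (\<lambda>y. h y > 0) (nhds x)"
    using hx by (simp add: eventually_nhds_conv_at)
  then have "eventually (\<lambda>y. y \<in> \<Omega> \<and> h y > 0) (nhds x)"
    using \<open>open \<Omega>\<close> \<open>x \<in> \<Omega>\<close> by (intro eventually_conj eventually_nhds_in_open)
  then obtain r where r: "r > 0" "\<And>y. dist y x < r \<Longrightarrow> y \<in> \<Omega> \<and> h y > 0"
    unfolding eventually_nhds_metric by blast
  have "AE y in lborel. indicator \<Omega> y *\<^sub>R h y = 0"
    using integral_nonneg_eq_0_iff_AE[OF int] zero assms(3) by (auto simp: indicator_def)
  then have "AE y in lborel. y \<notin> ball x r"
    by eventually_elim (use r(2) in \<open>force simp: indicator_def dist_commute\<close>)
  then have "emeasure lborel (ball x r) = 0"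
    using AE_iff_null_sets[of "ball x r" lborel] by (simp add: null_setsD1)
  moreover have "emeasure lborel (ball x r) > 0"
    using content_ball_pos[OF r(1), of x] by (metis calculation enn2real_0 less_irrefl measure_def)
  ultimately show False by simp
qed

text \<open>With \<open>w\<close> in the span, \<open>u * w\<close> is orthogonal to every
  multiplier of the span, hence by uniform approximation to every real continuous function, hence
  zero; inside \<open>\<Omega>\<close> the factor \<open>w\<close> can be divided out.\<close>

lemma stone_weierstrass_completeness:
  fixes \<Omega> :: "(real^2) set" and F :: "'k \<Rightarrow> real^2 \<Rightarrow> complex"
  assumes \<Omega>: "open \<Omega>" "bounded \<Omega>"
    and F: "\<And>k. k \<in> K \<Longrightarrow> continuous_on (closure \<Omega>) (F k)"
    and w: "w \<in> cspan (F ` K)" "\<And>x. x \<in> \<Omega> \<Longrightarrow> w x \<noteq> 0"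
    and S: "\<And>r. r \<in> S \<Longrightarrow> continuous_on (closure \<Omega>) r"
      "\<And>r k. r \<in> S \<Longrightarrow> k \<in> K \<Longrightarrow> (\<lambda>x. complex_of_real (r x) * F k x) \<in> cspan (F ` K)"
    and sep: "\<And>x y. x \<in> closure \<Omega> \<Longrightarrow> y \<in> closure \<Omega> \<Longrightarrow> x \<noteq> y \<Longrightarrow> \<exists>r\<in>S. r x \<noteq> r y"
    and u: "continuous_on (closure \<Omega>) u"
    and orth: "\<And>k. k \<in> K \<Longrightarrow> (LINT x|lborel. indicator \<Omega> x *\<^sub>R (u x * F k x)) = 0"
    and "x \<in> \<Omega>"
  shows "u x = 0"
proof -
  let ?V = "cspan (F ` K)"
  note int = integrable_indicator_open[OF \<Omega>]
  have cV: "continuous_on (closure \<Omega>) h" if "h \<in> ?V" for h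
    using that by induction (auto intro!: continuous_intros F)
  have oV: "(LINT x|lborel. indicator \<Omega> x *\<^sub>R (u x * h x)) = 0" if "h \<in> ?V" for h
    using that
  proof induction
    case (base g)
    then show ?case using orth by auto
  next
    case (add f g)
    have "(LINT x|lborel. indicator \<Omega> x *\<^sub>R (u x * (f x + g x))) =
       (LINT x|lborel. indicator \<Omega> x *\<^sub>R (u x * f x) + indicator \<Omega> x *\<^sub>R (u x * g x))"
      by (simp add: algebra_simps)
    also have "\<dots> = 0"
      using int[OF continuous_on_mult[OF u cV[OF add.hyps(1)]]] int[OF continuous_on_mult[OF u cV[OF add.hyps(2)]]]
      by (subst Bochner_Integration.integral_add) (simp_all add: add.IH)
    finally show ?case .
  next
    case (scale f c)
    have "(LINT x|lborel. indicator \<Omega> x *\<^sub>R (u x * (c * f x))) =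
       (LINT x|lborel. c * (indicator \<Omega> x *\<^sub>R (u x * f x)))"
      by (simp only: mult.left_commute[of _ c] mult_scaleR_right)
    then show ?case using scale by (simp only: integral_mult_right_zero mult_zero_right)
  qed simp
  \<comment> \<open>Taking all continuous multipliers of the span makes closure under products
    immediate; \<open>S\<close> only has to be found inside this ring.\<close>
  define R where "R = {r :: real^2 \<Rightarrow> real. continuous_on (closure \<Omega>) r \<and>
     (\<forall>h\<in>?V. (\<lambda>x. complex_of_real (r x) * h x) \<in> ?V)}"
  have SR: "r \<in> R" if "r \<in> S" for r
  proof -
    have "(\<lambda>x. complex_of_real (r x) * h x) \<in> ?V" if "h \<in> ?V" for h
      using that
    proof induction
      case (base g) then show ?case using S(2)[OF \<open>r \<in> S\<close>] by auto
    next
      case zero show ?case using cspan.zero by simp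
    next
      case (add f g) then show ?case using cspan.add[OF add.IH] by (simp add: distrib_left)
    next
      case (scale f c) then show ?case using cspan.scale[OF scale.IH, of c] by (simp add: mult.left_commute)
    qed
    then show ?thesis using S(1)[OF that] by (simp add: R_def)
  qed
  interpret function_ring_on R "closure \<Omega>"
  proof
    show "compact (closure \<Omega>)" using \<Omega> by simp
    show "continuous_on (closure \<Omega>) f" if "f \<in> R" for f using that by (simp add: R_def)
    show "(\<lambda>x. f x + g x) \<in> R" if "f \<in> R" "g \<in> R" for f g
      using that by (auto simp: R_def distrib_right intro!: continuous_intros cspan.add)
    show "(\<lambda>x. f x * g x) \<in> R" if "f \<in> R" "g \<in> R" for f g
      using that by (auto simp: R_def mult.assoc intro!: continuous_intros)
    show "(\<lambda>x. c) \<in> R" for c by (auto simp: R_def intro!: cspan.scale)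
    show "\<exists>f\<in>R. f x \<noteq> f y" if "x \<in> closure \<Omega>" "y \<in> closure \<Omega>" "x \<noteq> y" for x y
      using sep[OF that] SR by blast
  qed
  define \<psi> where "\<psi> x = u x * w x" for x
  have c\<psi>: "continuous_on (closure \<Omega>) \<psi>" unfolding \<psi>_def by (intro continuous_intros u cV w)
  have R0: "(LINT x|lborel. indicator \<Omega> x *\<^sub>R (of_real (r x) * \<psi> x)) = 0" if "r \<in> R" for r
    using that oV[of "\<lambda>x. complex_of_real (r x) * w x"] w(1)
    by (simp add: R_def \<psi>_def mult.left_commute)
  define B where "B = (LINT x|lborel. indicator \<Omega> x *\<^sub>R norm (\<psi> x))"
  have B0: "B \<ge> 0" unfolding B_def by (intro integral_nonneg_AE) auto
  have C0: "(LINT x|lborel. indicator \<Omega> x *\<^sub>R (of_real (g x) * \<psi> x)) = 0"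
    if g: "continuous_on (closure \<Omega>) g" for g :: "real^2 \<Rightarrow> real"
  proof -
    let ?I = "LINT x|lborel. indicator \<Omega> x *\<^sub>R (of_real (g x) * \<psi> x)"
    have key: "norm ?I \<le> e * B" if "e > 0" for e
    proof -
      obtain r where r: "r \<in> R" "\<And>x. x \<in> closure \<Omega> \<Longrightarrow> \<bar>g x - r x\<bar> < e"
        using Stone_Weierstrass_basic[OF g \<open>e > 0\<close>] by blast
      have cr: "continuous_on (closure \<Omega>) r" using r(1) by (simp add: R_def)
      have "?I = ?I - (LINT x|lborel. indicator \<Omega> x *\<^sub>R (of_real (r x) * \<psi> x))"
        using R0[OF r(1)] by simp
      also have "\<dots> = (LINT x|lborel. indicator \<Omega> x *\<^sub>R (of_real (g x) * \<psi> x) - indicator \<Omega> x *\<^sub>R (of_real (r x) * \<psi> x))"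
        by (intro Bochner_Integration.integral_diff[symmetric] int continuous_intros c\<psi> g cr)
      also have "norm \<dots> \<le> (LINT x|lborel. norm (indicator \<Omega> x *\<^sub>R (of_real (g x) * \<psi> x) - indicator \<Omega> x *\<^sub>R (of_real (r x) * \<psi> x)))"
        by (rule integral_norm_bound)
      also have "\<dots> \<le> (LINT x|lborel. e * (indicator \<Omega> x *\<^sub>R norm (\<psi> x)))"
      proof (rule integral_mono)
        show "integrable lborel (\<lambda>x. norm (indicator \<Omega> x *\<^sub>R (of_real (g x) * \<psi> x) - indicator \<Omega> x *\<^sub>R (of_real (r x) * \<psi> x)))"
          by (intro integrable_norm Bochner_Integration.integrable_diff int continuous_intros c\<psi> g cr)
        show "integrable lborel (\<lambda>x. e * (indicator \<Omega> x *\<^sub>R norm (\<psi> x)))"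
          by (intro integrable_mult_right int continuous_intros c\<psi>)
        fix x
        show "norm (indicator \<Omega> x *\<^sub>R (of_real (g x) * \<psi> x) - indicator \<Omega> x *\<^sub>R (of_real (r x) * \<psi> x))
            \<le> e * (indicator \<Omega> x *\<^sub>R norm (\<psi> x))"
        proof (cases "x \<in> \<Omega>")
          case True
          then have "\<bar>g x - r x\<bar> \<le> e" using r(2)[of x] closure_subset by fastforce
          then have "\<bar>g x - r x\<bar> * norm (\<psi> x) \<le> e * norm (\<psi> x)" by (intro mult_right_mono) auto
          moreover have "norm (of_real (g x) * \<psi> x - of_real (r x) * \<psi> x) = \<bar>g x - r x\<bar> * norm (\<psi> x)"
            by (metis left_diff_distrib norm_mult norm_of_real of_real_diff)
          ultimately show ?thesis using True by simp
        qed simp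
      qed
      also have "\<dots> = e * B" unfolding B_def by simp
      finally show ?thesis .
    qed
    have "norm ?I \<le> 0 + e" if "e > 0" for e
    proof -
      have "norm ?I \<le> e / (B + 1) * B" using key[of "e / (B + 1)"] that B0 by simp
      also have "\<dots> \<le> e" using that B0 by (simp add: field_simps)
      finally show ?thesis by simp
    qed
    then have "norm ?I \<le> 0" by (rule field_le_epsilon)
    then show ?thesis by simp
  qed
  \<comment> \<open>\<open>C0\<close> tests against real functions only, so
    \<open>cnj \<psi>\<close> is split into real and imaginary part.\<close>
  have sq: "(LINT x|lborel. indicator \<Omega> x *\<^sub>R (norm (\<psi> x))\<^sup>2) = 0"
  proof -
    have "complex_of_real (LINT x|lborel. indicator \<Omega> x *\<^sub>R (norm (\<psi> x))\<^sup>2) =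
       (LINT x|lborel. indicator \<Omega> x *\<^sub>R (of_real (Re (\<psi> x)) * \<psi> x) - \<i> * (indicator \<Omega> x *\<^sub>R (of_real (Im (\<psi> x)) * \<psi> x)))"
      unfolding integral_complex_of_real[symmetric]
    proof (rule Bochner_Integration.integral_cong[OF refl])
      fix x
      have "complex_of_real ((norm (\<psi> x))\<^sup>2) = of_real (Re (\<psi> x)) * \<psi> x - \<i> * (of_real (Im (\<psi> x)) * \<psi> x)"
        by (simp add: complex_eq_iff cmod_power2 flip: power2_eq_square)
      then show "complex_of_real (indicator \<Omega> x *\<^sub>R (norm (\<psi> x))\<^sup>2) =
          indicator \<Omega> x *\<^sub>R (of_real (Re (\<psi> x)) * \<psi> x) - \<i> * (indicator \<Omega> x *\<^sub>R (of_real (Im (\<psi> x)) * \<psi> x))"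
        by (simp add: indicator_def)
    qed
    also have "\<dots> = (LINT x|lborel. indicator \<Omega> x *\<^sub>R (of_real (Re (\<psi> x)) * \<psi> x)) -
        (LINT x|lborel. \<i> * (indicator \<Omega> x *\<^sub>R (of_real (Im (\<psi> x)) * \<psi> x)))"
      by (intro Bochner_Integration.integral_diff integrable_mult_right int continuous_intros c\<psi>)
    also have "\<dots> = 0"
      unfolding integral_mult_right_zero
      using C0[of "\<lambda>x. Re (\<psi> x)"] C0[of "\<lambda>x. Im (\<psi> x)"] c\<psi> by (simp add: continuous_intros)
    finally show ?thesis by simp
  qed
  have "(norm (\<psi> x))\<^sup>2 = 0"
  proof (rule integral_eq_0_imp_zero_on_open[OF \<Omega>(1) _ _ _ sq \<open>x \<in> \<Omega>\<close>])
    show "continuous_on \<Omega> (\<lambda>x. (norm (\<psi> x))\<^sup>2)"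
      by (intro continuous_intros continuous_on_subset[OF c\<psi> closure_subset])
    show "integrable lborel (\<lambda>x. indicator \<Omega> x *\<^sub>R (norm (\<psi> x))\<^sup>2)"
      by (intro int continuous_intros c\<psi>)
  qed simp
  then show ?thesis using w(2)[OF \<open>x \<in> \<Omega>\<close>] by (simp add: \<psi>_def)
qed

section \<open>Jumps of the counting function and eigenspaces\<close>

lemma weyl_jump_eq_of_weyl_eq:
  assumes "filterlim lam at_top sequentially" "0 < lam 0" "mono lam"
    and eq: "\<forall>\<mu>\<ge>0. local_weyl_counting lam e x \<mu> = local_weyl_counting lam e y \<mu>"
    and "\<mu> > 0"
  shows "(\<Sum>j | lam j = \<mu>. (norm (e j x))\<^sup>2) = (\<Sum>j | lam j = \<mu>. (norm (e j y))\<^sup>2)"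
proof -
  have fin: "finite {j. lam j \<le> m}" for m
  proof -
    have "eventually (\<lambda>j. lam j > m) sequentially"
      using assms(1) by (simp add: filterlim_at_top_dense)
    then obtain n where "\<And>j. j \<ge> n \<Longrightarrow> lam j > m" unfolding eventually_sequentially by blast
    then have "{j. lam j \<le> m} \<subseteq> {..<n}" by (metis (mono_tags, lifting) lessThan_iff linorder_not_le mem_Collect_eq subsetI)
    then show ?thesis using finite_subset by blast
  qed
  have pos: "lam j > 0" for j using assms(2,3) by (meson less_le_trans monoD zero_le)
  \<comment> \<open>\<open>m\<close> is the largest frequency below \<open>\<mu>\<close>; the extra
    0 covers the case that there is none and keeps \<open>m\<close> in the range of
    \<open>eq\<close>.\<close>
  define m where "m = Max (insert 0 (lam ` {j. lam j < \<mu>}))"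
  have fin': "finite {j. lam j < \<mu>}" by (rule finite_subset[OF _ fin[of \<mu>]]) auto
  have m: "0 \<le> m" "m < \<mu>" "\<And>j. lam j < \<mu> \<Longrightarrow> lam j \<le> m"
    using fin' \<open>\<mu> > 0\<close> by (auto simp: m_def)
  have split: "(\<Sum>j | lam j = \<mu>. (norm (e j z))\<^sup>2) = local_weyl_counting lam e z \<mu> - local_weyl_counting lam e z m" for z
  proof -
    have "{j. lam j = \<mu>} = {j. lam j \<le> \<mu>} - {j. lam j \<le> m}" using m by force
    then show ?thesis unfolding local_weyl_counting_def
      using m fin by (simp only:) (intro sum_diff; force)
  qed
  show ?thesis unfolding split using eq m by simp
qed

lemma integrable_lebesgue_on_open:
  fixes h :: "'a :: euclidean_space \<Rightarrow> 'b :: euclidean_space"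
  assumes "open \<Omega>" "bounded \<Omega>" "continuous_on (closure \<Omega>) h"
  shows "integrable (lebesgue_on \<Omega>) h"
proof -
  have "integrable lborel (\<lambda>x. indicator \<Omega> x *\<^sub>R h x)"
    by (rule integrable_indicator_open[OF assms])
  then have "integrable lebesgue (\<lambda>x. indicator \<Omega> x *\<^sub>R h x)"
    by (simp add: integrable_completion borel_measurable_integrable)
  then show ?thesis using \<open>open \<Omega>\<close> by (simp add: integrable_restrict_space)
qed

text \<open>Both \<open>e\<close> restricted to the eigenvalue \<open>\<mu>\<close> and the normalised \<open>v\<close> are orthonormal bases of one
  space: the first expands in the second by completeness of \<open>F\<close>, the second in the first by
  completeness of \<open>e\<close>.\<close>

lemma eigenspace_kernel:
  fixes \<Omega> :: "(real^2) set" and F :: "'k \<Rightarrow> real^2 \<Rightarrow> complex" and v :: "'i \<Rightarrow> real^2 \<Rightarrow> complex"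
  assumes \<Omega>: "open \<Omega>" "convex \<Omega>" "bounded \<Omega>"
    and basis: "dirichlet_eigenbasis \<Omega> lam e"
    and compl: "\<And>u x. continuous_on (closure \<Omega>) u \<Longrightarrow>
      (\<And>k. k \<in> K \<Longrightarrow> (LINT x|lborel. indicator \<Omega> x *\<^sub>R (u x * F k x)) = 0) \<Longrightarrow> x \<in> \<Omega> \<Longrightarrow> u x = 0"
    and F: "\<And>k. k \<in> K \<Longrightarrow> helmholtz_on UNIV (\<kappa> k) (F k)"
      "\<And>k x. k \<in> K \<Longrightarrow> x \<in> frontier \<Omega> \<Longrightarrow> F k x = 0"
    and I: "finite I"
    and v: "\<And>i. i \<in> I \<Longrightarrow> helmholtz_on UNIV \<mu> (v i)"
      "\<And>i x. i \<in> I \<Longrightarrow> x \<in> frontier \<Omega> \<Longrightarrow> v i x = 0"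
      "\<And>i. i \<in> I \<Longrightarrow> \<exists>x\<in>\<Omega>. v i x \<noteq> 0"
      "\<And>i j. i \<in> I \<Longrightarrow> j \<in> I \<Longrightarrow> i \<noteq> j \<Longrightarrow> (LINT x|lborel. indicator \<Omega> x *\<^sub>R (v i x * cnj (v j x))) = 0"
    and span: "\<And>k. k \<in> K \<Longrightarrow> \<kappa> k = \<mu> \<Longrightarrow> \<exists>d. \<forall>x\<in>\<Omega>. F k x = (\<Sum>i\<in>I. d i * cnj (v i x))"
    and "\<mu> > 0"
  obtains N where "\<And>i. i \<in> I \<Longrightarrow> 0 < N i"
    "\<And>x. x \<in> \<Omega> \<Longrightarrow> (\<Sum>j | lam j = sqrt \<mu>. (norm (e j x))\<^sup>2) = (\<Sum>i\<in>I. (norm (v i x))\<^sup>2 / N i)"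
proof -
  have onb: "orthonormal_basis_L2 \<Omega> e" and eig: "\<And>j. dirichlet_eigenfunction \<Omega> (lam j) (e j)"
    and lam: "0 < lam 0" "mono lam" "filterlim lam at_top sequentially"
    using basis unfolding dirichlet_eigenbasis_def by blast+
  have lampos: "lam j > 0" for j using lam by (meson less_le_trans monoD zero_le)
  have lamsq: "(lam j)\<^sup>2 = \<mu> \<longleftrightarrow> lam j = sqrt \<mu>" for j
    using lampos[of j] \<open>\<mu> > 0\<close> by (auto simp: real_sqrt_unique[symmetric])
  define J where "J = {j. lam j = sqrt \<mu>}"
  obtain n0 where n0: "\<And>j. j \<in> J \<Longrightarrow> j < n0"
  proof -
    have "eventually (\<lambda>j. lam j > sqrt \<mu>) sequentially"
      using lam(3) by (simp add: filterlim_at_top_dense)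
    then obtain n where "\<And>j. j \<ge> n \<Longrightarrow> lam j > sqrt \<mu>" unfolding eventually_sequentially by blast
    then show ?thesis using that[of n] unfolding J_def by (metis (mono_tags) linorder_not_le mem_Collect_eq less_irrefl)
  qed
  have finJ: "finite J" using n0 by (meson finite_lessThan finite_subset lessThan_iff subsetI)
  have eh: "helmholtz_on \<Omega> ((lam j)\<^sup>2) (e j)" for j
    by (rule dirichlet_eigenfunction_helmholtz[OF eig \<Omega>(1)])
  have ec: "continuous_on (closure \<Omega>) (e j)" and e0: "\<And>x. x \<in> frontier \<Omega> \<Longrightarrow> e j x = 0" for j
    using eig unfolding dirichlet_eigenfunction_def by blast+
  have cU: "continuous_on A f" if "helmholtz_on UNIV m f" for A m f
    using helmholtz_on_imp_continuous_on[OF that] by (rule continuous_on_subset) simp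
  have vc: "continuous_on A (v i)" if "i \<in> I" for i A by (rule cU[OF v(1)[OF that]])
  have Fc: "continuous_on A (F k)" if "k \<in> K" for k A by (rule cU[OF F(1)[OF that]])
  \<comment> \<open>No conjugation is built in, as in \<open>helmholtz_dirichlet_orthogonal\<close>;
    an inner product with \<open>v i\<close> is an integral against \<open>cnj (v i)\<close>, which
    is why \<open>span\<close> speaks of conjugates.\<close>
  define P :: "(real^2 \<Rightarrow> complex) \<Rightarrow> complex" where "P f = (LINT x|lborel. indicator \<Omega> x *\<^sub>R f x)" for f
  note int = integrable_indicator_open[OF \<Omega>(1,3)]
  have Pcong: "P f = P g" if "\<And>x. x \<in> \<Omega> \<Longrightarrow> f x = g x" for f g
    unfolding P_def by (rule Bochner_Integration.integral_cong) (auto simp: indicator_def that)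
  have Pdiff: "P (\<lambda>x. f x - g x) = P f - P g"
    if "continuous_on (closure \<Omega>) f" "continuous_on (closure \<Omega>) g" for f g
    unfolding P_def scaleR_diff_right by (rule Bochner_Integration.integral_diff[OF int int]) (fact that)+
  have Pcm: "P (\<lambda>x. c * f x) = c * P f" for c f
    unfolding P_def mult_scaleR_right[symmetric] by (rule integral_mult_right_zero)
  have Psum: "P (\<lambda>x. \<Sum>i\<in>I. f i x) = (\<Sum>i\<in>I. P (f i))" if "\<And>i. i \<in> I \<Longrightarrow> continuous_on (closure \<Omega>) (f i)" for f
    unfolding P_def scaleR_sum_right by (rule Bochner_Integration.integral_sum[OF int]) (fact that)
  have Pcnj: "P (\<lambda>x. cnj (f x)) = cnj (P f)" for f
  proof -
    have "P (\<lambda>x. cnj (f x)) = (LINT x|lborel. cnj (indicator \<Omega> x *\<^sub>R f x))" unfolding P_def by simp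
    then show ?thesis unfolding P_def by (simp only: Bochner_Integration.integral_cnj)
  qed
  have norm2: "z * cnj z = of_real ((norm z)\<^sup>2)" for z :: complex
    by (simp add: complex_norm_square del: of_real_power)
  define N where "N i = (LINT x|lborel. indicator \<Omega> x *\<^sub>R (norm (v i x))\<^sup>2)" for i
  have PN: "P (\<lambda>x. v i x * cnj (v i x)) = of_real (N i)" for i
    unfolding P_def N_def norm2 integral_complex_of_real[symmetric] by (simp add: scaleR_conv_of_real)
  have Npos: "N i > 0" if "i \<in> I" for i
  proof -
    have "N i \<ge> 0" unfolding N_def by (intro integral_nonneg_AE) auto
    moreover have "N i \<noteq> 0"
    proof
      assume "N i = 0"
      moreover have "continuous_on A (\<lambda>x. (norm (v i x))\<^sup>2)" for A
        by (intro continuous_intros vc that)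
      ultimately have "(norm (v i x))\<^sup>2 = 0" if "x \<in> \<Omega>" for x
        using that unfolding N_def
        by (intro integral_eq_0_imp_zero_on_open[OF \<Omega>(1), of "\<lambda>x. (norm (v i x))\<^sup>2"] int) auto
      then show False using v(3)[OF that] by auto
    qed
    ultimately show ?thesis by simp
  qed
  define a where "a j i = P (\<lambda>x. e j x * cnj (v i x))" for j i
  have expand_e: "e j x = (\<Sum>i\<in>I. a j i / N i * v i x)" if "j \<in> J" "x \<in> \<Omega>" for j x
  proof -
    have lj: "(lam j)\<^sup>2 = \<mu>" using that(1) \<open>\<mu> > 0\<close> by (simp add: J_def)
    let ?s = "\<lambda>x. \<Sum>i\<in>I. a j i / N i * v i x"
    have cs: "continuous_on (closure \<Omega>) ?s" by (intro continuous_intros vc)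
    have PI: "P (\<lambda>x. ?s x * g x) = (\<Sum>i\<in>I. a j i / N i * P (\<lambda>x. v i x * g x))"
      if "continuous_on (closure \<Omega>) g" for g
    proof -
      have "P (\<lambda>x. ?s x * g x) = P (\<lambda>x. \<Sum>i\<in>I. a j i / N i * (v i x * g x))"
        by (simp add: sum_distrib_right mult.assoc)
      also have "\<dots> = (\<Sum>i\<in>I. P (\<lambda>x. a j i / N i * (v i x * g x)))"
        by (rule Psum) (intro continuous_intros vc that)
      finally show ?thesis by (simp only: Pcm)
    qed
    have "e j x - ?s x = 0"
    proof (rule compl[OF _ _ that(2), of "\<lambda>x. e j x - ?s x"])
      show "continuous_on (closure \<Omega>) (\<lambda>x. e j x - ?s x)" by (intro continuous_intros ec cs)
      fix k assume k: "k \<in> K"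
      show "(LINT x|lborel. indicator \<Omega> x *\<^sub>R ((e j x - ?s x) * F k x)) = 0"
      \<comment> \<open>For another eigenvalue both parts are orthogonal to \<open>F k\<close> by
        Green's identity. For the same one, \<open>F k\<close> combines the
        \<open>cnj (v i)\<close>, against which the remainder integrates to 0 by the choice of the
        coefficients.\<close>
      proof (cases "\<kappa> k = \<mu>")
        case False
        have 1: "P (\<lambda>x. e j x * F k x) = 0" unfolding P_def
          by (rule helmholtz_dirichlet_orthogonal[OF \<Omega> eh ec e0 F(1)[OF k] F(2)[OF k]]) (use lj False in auto)
        have 2: "P (\<lambda>x. v i x * F k x) = 0" if "i \<in> I" for i unfolding P_def
          by (rule helmholtz_dirichlet_orthogonal[OF \<Omega> helmholtz_on_subset[OF v(1)[OF that]] vc[OF that] v(2)[OF that] F(1)[OF k] F(2)[OF k]])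
            (use False in auto)
        have "P (\<lambda>x. (e j x - ?s x) * F k x) = P (\<lambda>x. e j x * F k x) - P (\<lambda>x. ?s x * F k x)"
          unfolding left_diff_distrib by (intro Pdiff continuous_intros ec cs Fc k vc)
        also have "\<dots> = 0" unfolding PI[OF Fc[OF k]] using 1 2 by simp
        finally show ?thesis unfolding P_def .
      next
        case True
        obtain d where d: "\<And>x. x \<in> \<Omega> \<Longrightarrow> F k x = (\<Sum>i\<in>I. d i * cnj (v i x))"
          using span[OF k True] by blast
        have z: "P (\<lambda>x. (e j x - ?s x) * cnj (v i x)) = 0" if i: "i \<in> I" for i
        proof -
          have cc: "continuous_on (closure \<Omega>) (\<lambda>x. cnj (v i x))" by (intro continuous_intros vc i)
          have "P (\<lambda>x. (e j x - ?s x) * cnj (v i x)) = P (\<lambda>x. e j x * cnj (v i x)) - P (\<lambda>x. ?s x * cnj (v i x))"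
            unfolding left_diff_distrib by (intro Pdiff continuous_intros ec cs vc i)
          also have "P (\<lambda>x. ?s x * cnj (v i x)) = (\<Sum>i'\<in>I. a j i' / N i' * P (\<lambda>x. v i' x * cnj (v i x)))"
            by (rule PI[OF cc])
          also have "\<dots> = (\<Sum>i'\<in>I. if i' = i then a j i else 0)"
          proof (rule sum.cong[OF refl])
            fix i' assume "i' \<in> I"
            then show "a j i' / N i' * P (\<lambda>x. v i' x * cnj (v i x)) = (if i' = i then a j i else 0)"
              using v(4)[of i' i] i Npos[OF i] PN[of i] unfolding P_def by auto
          qed
          also have "\<dots> = a j i" using i I by simp
          finally show ?thesis by (simp add: a_def)
        qed
        have "P (\<lambda>x. (e j x - ?s x) * F k x) = P (\<lambda>x. \<Sum>i\<in>I. d i * ((e j x - ?s x) * cnj (v i x)))"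
          by (rule Pcong) (simp only: d sum_distrib_left mult.left_commute)
        also have "\<dots> = (\<Sum>i\<in>I. P (\<lambda>x. d i * ((e j x - ?s x) * cnj (v i x))))"
          by (rule Psum) (intro continuous_intros ec vc cs)
        also have "\<dots> = 0" by (simp only: Pcm z mult_zero_right sum.neutral_const cong: sum.cong)
        finally show ?thesis unfolding P_def .
      qed
    qed
    then show ?thesis by simp
  qed
  have expand_v: "v i x = (\<Sum>j\<in>J. cnj (a j i) * e j x)" if i: "i \<in> I" and x: "x \<in> \<Omega>" for i x
  proof -
    have inner: "L2_inner \<Omega> (v i) (e j) = cnj (a j i)" for j
    proof -
      have "L2_inner \<Omega> (v i) (e j) = P (\<lambda>x. v i x * cnj (e j x))"
        unfolding L2_inner_def P_def
        by (rule integral_lebesgue_on_eq[OF \<Omega>(1)])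
          (intro continuous_intros vc i continuous_on_subset[OF ec closure_subset])
      also have "\<dots> = P (\<lambda>x. cnj (e j x * cnj (v i x)))" by (simp add: mult.commute)
      finally show ?thesis unfolding Pcnj a_def .
    qed
    \<comment> \<open>Coefficients outside \<open>J\<close> vanish, so the partial sums of the
      expansion are constant from \<open>n0\<close> on and the L2 limit becomes an identity of
      continuous functions.\<close>
    have az: "a j i = 0" if "j \<notin> J" for j unfolding a_def P_def
      by (rule helmholtz_dirichlet_orthogonal[OF \<Omega> eh ec e0 helmholtz_on_cnj[OF v(1)[OF i]]])
        (use v(2)[OF i] that lamsq in \<open>auto simp: J_def\<close>)
    have L2: "v i \<in> L2_on \<Omega>" unfolding L2_on_def
    proof (intro CollectI conjI)
      show "v i \<in> borel_measurable (lebesgue_on \<Omega>)"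
        by (rule continuous_imp_measurable_on_sets_lebesgue[OF vc[OF i]]) (use \<Omega> in auto)
      show "integrable (lebesgue_on \<Omega>) (\<lambda>x. (norm (v i x))\<^sup>2)"
        by (rule integrable_lebesgue_on_open[OF \<Omega>(1,3)]) (intro continuous_intros vc i)
    qed
    let ?s = "\<lambda>x. \<Sum>j\<in>J. cnj (a j i) * e j x"
    let ?R = "LINT x|lebesgue_on \<Omega>. (norm (v i x - ?s x))\<^sup>2"
    have "(\<lambda>n. LINT x|lebesgue_on \<Omega>. ((norm (v i x - (\<Sum>j<n. L2_inner \<Omega> (v i) (e j) * e j x)))\<^sup>2)) \<longlonglongrightarrow> 0"
      using onb L2 unfolding orthonormal_basis_L2_def by blast
    moreover have "eventually (\<lambda>n. (LINT x|lebesgue_on \<Omega>. ((norm (v i x - (\<Sum>j<n. L2_inner \<Omega> (v i) (e j) * e j x)))\<^sup>2)) = ?R) sequentially"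
    proof (rule eventually_sequentiallyI)
      fix n assume "n0 \<le> n"
      then have "(\<Sum>j<n. L2_inner \<Omega> (v i) (e j) * e j x) = ?s x" for x
        unfolding inner by (intro sum.mono_neutral_right) (use n0 az in \<open>auto intro: less_le_trans\<close>)
      then show "(LINT x|lebesgue_on \<Omega>. ((norm (v i x - (\<Sum>j<n. L2_inner \<Omega> (v i) (e j) * e j x)))\<^sup>2)) = ?R"
        by simp
    qed
    ultimately have "(\<lambda>n::nat. ?R) \<longlonglongrightarrow> 0" by (rule Lim_transform_eventually)
    then have "?R = 0" by (simp add: LIMSEQ_const_iff)
    moreover have ch: "continuous_on (closure \<Omega>) (\<lambda>x. (norm (v i x - ?s x))\<^sup>2)"
      by (intro continuous_intros vc i ec)
    ultimately have zero: "(LINT x|lborel. indicator \<Omega> x *\<^sub>R (norm (v i x - ?s x))\<^sup>2) = 0"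
      using integral_lebesgue_on_eq[OF \<Omega>(1) continuous_on_subset[OF ch closure_subset]] by simp
    have "(norm (v i x - ?s x))\<^sup>2 = 0"
      by (rule integral_eq_0_imp_zero_on_open[OF \<Omega>(1) continuous_on_subset[OF ch closure_subset] _ int[OF ch] zero x]) simp
    then show ?thesis by simp
  qed
  have "(\<Sum>j | lam j = sqrt \<mu>. (norm (e j x))\<^sup>2) = (\<Sum>i\<in>I. (norm (v i x))\<^sup>2 / N i)" if x: "x \<in> \<Omega>" for x
  proof -
    \<comment> \<open>Only the conjugated factor is expanded in the \<open>v i\<close>; summing over
      \<open>j\<close> first then turns the other one into \<open>v i\<close> by
      \<open>expand_v\<close>.\<close>
    have "complex_of_real (\<Sum>j\<in>J. (norm (e j x))\<^sup>2) = (\<Sum>j\<in>J. e j x * cnj (e j x))"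
      by (simp only: of_real_sum norm2)
    also have "\<dots> = (\<Sum>j\<in>J. e j x * cnj (\<Sum>i\<in>I. a j i / N i * v i x))"
      by (rule sum.cong[OF refl]) (simp only: expand_e[OF _ x, symmetric])
    also have "\<dots> = (\<Sum>j\<in>J. \<Sum>i\<in>I. cnj (v i x) / N i * (cnj (a j i) * e j x))"
      by (simp add: sum_distrib_left mult_ac)
    also have "\<dots> = (\<Sum>i\<in>I. cnj (v i x) / N i * (\<Sum>j\<in>J. cnj (a j i) * e j x))"
      by (subst sum.swap) (simp only: sum_distrib_left)
    also have "\<dots> = (\<Sum>i\<in>I. cnj (v i x) / N i * v i x)"
      by (rule sum.cong[OF refl]) (simp only: expand_v[OF _ x, symmetric])
    also have "\<dots> = (\<Sum>i\<in>I. of_real ((norm (v i x))\<^sup>2 / N i))"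
    proof (rule sum.cong[OF refl])
      fix i
      show "cnj (v i x) / N i * v i x = of_real ((norm (v i x))\<^sup>2 / N i)"
        using norm2[of "v i x"] by (simp add: mult.commute del: of_real_power)
    qed
    also have "\<dots> = of_real (\<Sum>i\<in>I. (norm (v i x))\<^sup>2 / N i)" by (simp only: of_real_sum)
    finally show ?thesis unfolding J_def of_real_eq_iff .
  qed
  then show ?thesis using that Npos by blast
qed

section \<open>Triangle coordinates\<close>

text \<open>\<open>P\<close>, \<open>Q\<close> is the basis dual to the edge vectors
  \<open>p\<close>, \<open>q\<close> at the vertex \<open>a\<close>; thus \<open>bc\<close> and
  \<open>gc\<close> are the barycentric weights of the vertices \<open>a + p\<close> and
  \<open>a + q\<close>. The dual vectors are named because the phases of the plane waves are built
  from them.\<close>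

locale triangle_coordinates =
  fixes a p q P Q :: "real^2"
  assumes dual: "P \<bullet> p = 1" "P \<bullet> q = 0" "Q \<bullet> p = 0" "Q \<bullet> q = 1"
begin

definition bc :: "real^2 \<Rightarrow> real" where "bc x = P \<bullet> (x - a)"
definition gc :: "real^2 \<Rightarrow> real" where "gc x = Q \<bullet> (x - a)"
definition pt :: "real \<Rightarrow> real \<Rightarrow> real^2" where "pt s t = a + s *\<^sub>R p + t *\<^sub>R q"
definition tri :: "(real^2) set" where "tri = {x. 0 < bc x \<and> 0 < gc x \<and> bc x + gc x < 1}"

lemma bc_pt [simp]: "bc (pt s t) = s" and gc_pt [simp]: "gc (pt s t) = t"
  using dual by (simp_all add: bc_def gc_def pt_def inner_add_right inner_diff_right)

lemma pt_bc_gc: "pt (bc x) (gc x) = x"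
proof -
  define w where "w = x - pt (bc x) (gc x)"
  have "P \<bullet> w = 0" "Q \<bullet> w = 0"
    using bc_pt[of "bc x" "gc x"] gc_pt[of "bc x" "gc x"]
    unfolding bc_def gc_def w_def by (simp_all add: inner_diff_right)
  then have w: "P$1 * w$1 + P$2 * w$2 = 0" "Q$1 * w$1 + Q$2 * w$2 = 0"
    by (simp_all add: inner_vec_def sum_2)
  have d: "P$1 * p$1 + P$2 * p$2 = 1" "P$1 * q$1 + P$2 * q$2 = 0"
    "Q$1 * p$1 + Q$2 * p$2 = 0" "Q$1 * q$1 + Q$2 * q$2 = 1"
    using dual by (simp_all add: inner_vec_def sum_2)
  \<comment> \<open>The product of the determinants of \<open>(P, Q)\<close> and
    \<open>(p, q)\<close> is the determinant of the pairings, which is 1. So \<open>P\<close> and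
    \<open>Q\<close> are independent, and \<open>w\<close> is orthogonal to both.\<close>
  have "(P$1 * Q$2 - P$2 * Q$1) * (p$1 * q$2 - p$2 * q$1) = 
    (P$1 * p$1 + P$2 * p$2) * (Q$1 * q$1 + Q$2 * q$2) - (P$1 * q$1 + P$2 * q$2) * (Q$1 * p$1 + Q$2 * p$2)"
    by algebra
  then have ne: "P$1 * Q$2 - P$2 * Q$1 \<noteq> 0" unfolding d by auto
  have "(P$1 * Q$2 - P$2 * Q$1) * w$1 = 0" "(P$1 * Q$2 - P$2 * Q$1) * w$2 = 0"
    using w by algebra+
  then have "w$1 = 0" "w$2 = 0" using ne by auto
  then have "w = 0" by (simp add: vec_eq_iff forall_2)
  then show ?thesis by (simp add: w_def)
qed

lemma coords_eqI: "bc x = bc y \<Longrightarrow> gc x = gc y \<Longrightarrow> x = y"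
  using pt_bc_gc by metis

lemma continuous_on_bc [continuous_intros]: "continuous_on S bc"
  and continuous_on_gc [continuous_intros]: "continuous_on S gc"
  unfolding bc_def[abs_def] gc_def[abs_def] by (intro continuous_intros)+

lemma open_tri: "open tri"
proof -
  have "tri = {x. 0 < bc x} \<inter> {x. 0 < gc x} \<inter> {x. bc x + gc x < 1}" by (auto simp: tri_def)
  then show ?thesis
    by (simp only:) (intro open_Int open_Collect_less continuous_intros)
qed

lemma convex_hull_eq: "convex hull {a, a + p, a + q} = {x. 0 \<le> bc x \<and> 0 \<le> gc x \<and> bc x + gc x \<le> 1}"
proof (intro equalityI subsetI)
  fix x assume "x \<in> convex hull {a, a + p, a + q}"
  then obtain u v w where uvw: "0 \<le> u" "0 \<le> v" "0 \<le> w" "u + v + w = 1"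
    "x = u *\<^sub>R a + v *\<^sub>R (a + p) + w *\<^sub>R (a + q)"
    unfolding convex_hull_3 by blast
  have "x = (u + v + w) *\<^sub>R a + v *\<^sub>R p + w *\<^sub>R q"
    unfolding uvw(5) by (simp add: algebra_simps)
  then have "x = pt v w" using uvw(4) by (simp add: pt_def)
  then show "x \<in> {x. 0 \<le> bc x \<and> 0 \<le> gc x \<and> bc x + gc x \<le> 1}" using uvw by simp
next
  fix x assume "x \<in> {x. 0 \<le> bc x \<and> 0 \<le> gc x \<and> bc x + gc x \<le> 1}"
  moreover have "x = (1 - bc x - gc x) *\<^sub>R a + bc x *\<^sub>R (a + p) + gc x *\<^sub>R (a + q)"
    using pt_bc_gc[of x] unfolding pt_def by (simp add: algebra_simps)
  ultimately show "x \<in> convex hull {a, a + p, a + q}"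
    unfolding convex_hull_3 by force
qed

lemma interior_hull_eq: "interior (convex hull {a, a + p, a + q}) = tri"
proof (rule interior_unique)
  show "tri \<subseteq> convex hull {a, a + p, a + q}" by (auto simp: convex_hull_eq tri_def)
  show "open tri" by (rule open_tri)
  fix T assume T: "T \<subseteq> convex hull {a, a + p, a + q}" "open T"
  show "T \<subseteq> tri"
  proof
    fix x assume "x \<in> T"
    have *: "\<exists>s>0. x + s *\<^sub>R d \<in> T" for d
    proof -
      have "continuous_on UNIV (\<lambda>s::real. x + s *\<^sub>R d)" by (intro continuous_intros)
      then have "open ((\<lambda>s::real. x + s *\<^sub>R d) -` T)" using T(2) by (rule open_vimage[rotated])
      moreover have "0 \<in> (\<lambda>s::real. x + s *\<^sub>R d) -` T" using \<open>x \<in> T\<close> by simp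
      ultimately obtain e where e: "e > 0" "ball 0 e \<subseteq> (\<lambda>s::real. x + s *\<^sub>R d) -` T" using openE by blast
      then have "e / 2 \<in> (\<lambda>s::real. x + s *\<^sub>R d) -` T" by (auto simp: subset_eq dist_real_def)
      then show ?thesis using e(1) by (intro exI[of _ "e/2"]) auto
    qed
    have H: "0 \<le> bc y \<and> 0 \<le> gc y \<and> bc y + gc y \<le> 1" if "y \<in> T" for y
      using T(1) that convex_hull_eq by blast
    have lin: "bc (x + s *\<^sub>R d) = bc x + s * (P \<bullet> d)" "gc (x + s *\<^sub>R d) = gc x + s * (Q \<bullet> d)" for s d
      by (simp_all add: bc_def gc_def inner_add_right inner_diff_right)
    \<comment> \<open>Small moves along \<open>- p\<close>, \<open>- q\<close> and \<open>p\<close>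
      stay in the hull; each makes one of the three inequalities strict.\<close>
    obtain s1 where s1: "s1 > 0" "x + s1 *\<^sub>R (- p) \<in> T" using * by blast
    obtain s2 where s2: "s2 > 0" "x + s2 *\<^sub>R (- q) \<in> T" using * by blast
    obtain s3 where s3: "s3 > 0" "x + s3 *\<^sub>R p \<in> T" using * by blast
    show "x \<in> tri" using H[OF s1(2)] H[OF s2(2)] H[OF s3(2)] s1(1) s2(1) s3(1)
      unfolding lin tri_def by (simp add: dual)
  qed
qed

lemma convex_tri: "convex tri"
  using interior_hull_eq convex_interior convex_convex_hull by metis

lemma bounded_tri: "bounded tri"
proof -
  have "bounded (convex hull {a, a + p, a + q})"
    by (intro compact_imp_bounded compact_convex_hull) (simp add: finite_imp_compact)
  then show ?thesis using interior_hull_eq bounded_subset interior_subset by metis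
qed

lemma closure_tri: "x \<in> closure tri \<Longrightarrow> 0 \<le> bc x \<and> 0 \<le> gc x \<and> bc x + gc x \<le> 1"
proof -
  have "closure tri \<subseteq> convex hull {a, a + p, a + q}"
  proof (rule closure_minimal)
    show "tri \<subseteq> convex hull {a, a + p, a + q}" using interior_hull_eq interior_subset by blast
    show "closed (convex hull {a, a + p, a + q})"
      by (intro compact_imp_closed compact_convex_hull) (simp add: finite_imp_compact)
  qed
  then show "x \<in> closure tri \<Longrightarrow> 0 \<le> bc x \<and> 0 \<le> gc x \<and> bc x + gc x \<le> 1"
    unfolding convex_hull_eq by blast
qed

lemma frontier_tri: "x \<in> frontier tri \<Longrightarrow> bc x = 0 \<or> gc x = 0 \<or> bc x + gc x = 1"
  using closure_tri[of x] open_tri by (auto simp: frontier_def interior_open tri_def)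

lemma dist_eq_coords:
  "(dist x y)\<^sup>2 = (bc x - bc y)\<^sup>2 * (p \<bullet> p) + 2 * (bc x - bc y) * (gc x - gc y) * (p \<bullet> q) + (gc x - gc y)\<^sup>2 * (q \<bullet> q)"
proof -
  have "x - y = pt (bc x) (gc x) - pt (bc y) (gc y)" by (simp only: pt_bc_gc)
  also have "\<dots> = (bc x - bc y) *\<^sub>R p + (gc x - gc y) *\<^sub>R q"
    by (simp add: pt_def algebra_simps)
  finally have "(dist x y)\<^sup>2 = ((bc x - bc y) *\<^sub>R p + (gc x - gc y) *\<^sub>R q) \<bullet> ((bc x - bc y) *\<^sub>R p + (gc x - gc y) *\<^sub>R q)"
    by (simp add: dist_norm power2_norm_eq_inner)
  then show ?thesis
    by (simp add: inner_add_left inner_add_right inner_commute[of q p] power2_eq_square algebra_simps)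
qed

end

section \<open>Invariance of Lebesgue measure under isometries of the plane\<close>

lemma lborel_eq_distr_isometry:
  fixes \<phi> :: "real^2 \<Rightarrow> real^2"
  assumes "\<And>x y. dist (\<phi> x) (\<phi> y) = dist x y"
  shows "lborel = distr lborel borel \<phi>"
proof (rule lborel_eqI)
  have cont: "continuous_on UNIV \<phi>"
    unfolding continuous_on_iff using assms by auto
  then have meas: "\<phi> \<in> lborel \<rightarrow>\<^sub>M borel" by (simp add: borel_measurable_continuous_onI)
  \<comment> \<open>An isometry is an orthogonal map followed by a translation, so the preimage of a
    box is measured by undoing these two in turn.\<close>
  define T where "T x = \<phi> x - \<phi> 0" for x
  have T: "orthogonal_transformation T"
    unfolding orthogonal_transformation_isometry using assms by (simp add: T_def dist_norm)
  then obtain T' where T': "orthogonal_transformation T'" "\<And>x. T' (T x) = x" "\<And>x. T (T' x) = x"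
    by (metis orthogonal_transformation_inv orthogonal_transformation_bij bij_inv_eq_iff)
  fix l u :: "real^2"
  assume le: "\<And>b. b \<in> Basis \<Longrightarrow> l \<bullet> b \<le> u \<bullet> b"
  have vim: "\<phi> -` box l u = T' ` ((+) (- \<phi> 0) ` box l u)"
  proof (intro equalityI subsetI)
    fix x assume "x \<in> \<phi> -` box l u"
    moreover have "x = T' (- \<phi> 0 + \<phi> x)" using T'(2)[of x] by (simp add: T_def)
    ultimately show "x \<in> T' ` ((+) (- \<phi> 0) ` box l u)" by blast
  next
    fix x assume "x \<in> T' ` ((+) (- \<phi> 0) ` box l u)"
    then obtain z where z: "z \<in> box l u" "x = T' (- \<phi> 0 + z)" by blast
    then have "T x = - \<phi> 0 + z" using T'(3) by simp
    then have "\<phi> x = z" by (simp add: T_def)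
    then show "x \<in> \<phi> -` box l u" using z by simp
  qed
  have lm: "((+) (- \<phi> 0) ` box l u) \<in> lmeasurable"
    by (intro measurable_translation) simp
  have "measure lebesgue (\<phi> -` box l u) = measure lebesgue ((+) (- \<phi> 0) ` box l u)"
    unfolding vim by (rule measure_orthogonal_image[OF T'(1) lm])
  also have "\<dots> = measure lebesgue (box l u)" by (rule measure_translation)
  also have "\<dots> = (\<Prod>b\<in>Basis. (u - l) \<bullet> b)" using le by (simp add: inner_diff_left)
  finally have M: "measure lebesgue (\<phi> -` box l u) = (\<Prod>b\<in>Basis. (u - l) \<bullet> b)" .
  have fm: "\<phi> -` box l u \<in> lmeasurable"
    unfolding vim using lm measurable_orthogonal_image[OF T'(1)] by blast
  have ms: "\<phi> -` box l u \<in> sets borel"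
    using measurable_sets[OF meas, of "box l u"] by simp
  have "emeasure (distr lborel borel \<phi>) (box l u) = emeasure lborel (\<phi> -` box l u)"
    using meas by (subst emeasure_distr) auto
  also have "\<dots> = emeasure lebesgue (\<phi> -` box l u)" using ms by simp
  also have "\<dots> = measure lebesgue (\<phi> -` box l u)"
    using fm by (simp add: emeasure_eq_measure2)
  finally show "emeasure (distr lborel borel \<phi>) (box l u) = (\<Prod>b\<in>Basis. (u - l) \<bullet> b)"
    unfolding M .
qed simp

text \<open>Used for the rotation of the equilateral triangle, which separates two eigenfunctions of
  the same eigenvalue.\<close>

lemma integral_lborel_isometry:
  fixes \<phi> :: "real^2 \<Rightarrow> real^2" and h :: "real^2 \<Rightarrow> 'b :: {banach, second_countable_topology}"
  assumes iso: "\<And>x y. dist (\<phi> x) (\<phi> y) = dist x y" and h: "h \<in> borel_measurable borel"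
  shows "(LINT x|lborel. h (\<phi> x)) = (LINT x|lborel. h x)"
proof -
  have "continuous_on UNIV \<phi>" unfolding continuous_on_iff using iso by auto
  then have meas: "\<phi> \<in> lborel \<rightarrow>\<^sub>M borel" by (simp add: borel_measurable_continuous_onI)
  have "(LINT x|lborel. h x) = (LINT x|distr lborel borel \<phi>. h x)"
    using lborel_eq_distr_isometry[OF iso] by simp
  also have "\<dots> = (LINT x|lborel. h (\<phi> x))"
    by (rule integral_distr[OF meas h])
  finally show ?thesis by simp
qed

section \<open>The isosceles right triangle\<close>

locale right_triangle = triangle_coordinates a p q P Q for a p q P Q :: "real^2" +
  fixes l :: real
  assumes l: "l > 0" "p \<bullet> p = l" "q \<bullet> q = l" "p \<bullet> q = 0" "P = (1 / l) *\<^sub>R p" "Q = (1 / l) *\<^sub>R q"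
begin

text \<open>In the coordinates \<open>u = uc x\<close>, \<open>v = vc x\<close> the triangle becomes \<open>0 < v < u < \<pi>\<close>.\<close>

definition uc :: "real^2 \<Rightarrow> real" where "uc x = pi * (1 - bc x)"
definition vc :: "real^2 \<Rightarrow> real" where "vc x = pi * gc x"
text \<open>An eigenfunction of the square with side \<open>pi\<close>, antisymmetrised to vanish on
  the diagonal as well. The sides \<open>bc = 0\<close>, \<open>gc = 0\<close> and
  \<open>bc + gc = 1\<close> are \<open>u = pi\<close>, \<open>v = 0\<close> and
  \<open>u = v\<close>.\<close>

definition eigfun :: "nat \<Rightarrow> nat \<Rightarrow> real^2 \<Rightarrow> real" where
  "eigfun m n x = sin (m * uc x) * sin (n * vc x) - sin (n * uc x) * sin (m * vc x)"
definition sc :: "real^2 \<Rightarrow> real" where "sc x = cos (uc x) + cos (vc x)"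
definition pc :: "real^2 \<Rightarrow> real" where "pc x = cos (uc x) * cos (vc x)"

lemma continuous_on_uc: "continuous_on S uc" and continuous_on_vc: "continuous_on S vc"
  unfolding uc_def[abs_def] vc_def[abs_def] by (intro continuous_intros)+

lemma helmholtz_cos:
  "helmholtz_on UNIV (pi\<^sup>2 * (m\<^sup>2 + n\<^sup>2) / l) (\<lambda>x. of_real (cos (m * uc x + n * vc x)))"
proof -
  \<comment> \<open>\<open>?k\<close> is the gradient of the affine phase
    \<open>m * uc x + n * vc x\<close> and \<open>?c\<close> its value at
    \<open>x = 0\<close>.\<close>
  let ?k = "(n * pi) *\<^sub>R Q - (m * pi) *\<^sub>R P" and ?c = "m * pi + (m * pi) * (P \<bullet> a) - (n * pi) * (Q \<bullet> a)"
  have PQ: "P \<bullet> P = 1 / l" "Q \<bullet> Q = 1 / l" "P \<bullet> Q = 0" "Q \<bullet> P = 0"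
    using l by (auto simp: power2_eq_square inner_commute)
  have "?k \<bullet> ?k = pi\<^sup>2 * (m\<^sup>2 + n\<^sup>2) / l"
    by (simp add: inner_diff_left inner_diff_right PQ power2_eq_square add_divide_distrib algebra_simps)
  from helmholtz_on_cos[OF this, of ?c]
  have "helmholtz_on UNIV (pi\<^sup>2 * (m\<^sup>2 + n\<^sup>2) / l) (\<lambda>x. of_real (cos (?c + ?k \<bullet> x)))" .
  moreover have "?c + ?k \<bullet> x = m * uc x + n * vc x" for x
    by (simp add: uc_def vc_def bc_def gc_def inner_diff_left inner_diff_right algebra_simps)
  ultimately show ?thesis by (simp only:)
qed

lemma helmholtz_eigfun: "helmholtz_on UNIV (pi\<^sup>2 * ((real m)\<^sup>2 + (real n)\<^sup>2) / l) (\<lambda>x. complex_of_real (eigfun m n x))"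
proof -
  let ?C = "\<lambda>m n x. complex_of_real (cos (m * uc x + n * vc x))"
  have *: "helmholtz_on UNIV (pi\<^sup>2 * ((real m)\<^sup>2 + (real n)\<^sup>2) / l) (?C m' n')"
    if "m'\<^sup>2 + n'\<^sup>2 = (real m)\<^sup>2 + (real n)\<^sup>2" for m' n'
    using helmholtz_cos[of m' n'] that by simp
  have "helmholtz_on UNIV (pi\<^sup>2 * ((real m)\<^sup>2 + (real n)\<^sup>2) / l)
     (\<lambda>x. (1/2) * ((?C m (- n) x - ?C m n x) - (?C n (- m) x - ?C n m x)))"
    by (intro helmholtz_on_cmult helmholtz_on_diff *) (simp_all add: add.commute)
  moreover have "(1/2) * ((?C m (- n) x - ?C m n x) - (?C n (- m) x - ?C n m x)) = complex_of_real (eigfun m n x)" for x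
  proof -
    have E: "eigfun m n x = (1/2) * ((cos (m * uc x + - n * vc x) - cos (m * uc x + n * vc x)) -
        (cos (n * uc x + - m * vc x) - cos (n * uc x + m * vc x)))"
      by (simp add: eigfun_def cos_add cos_diff algebra_simps)
    show ?thesis unfolding E by simp
  qed
  ultimately show ?thesis by (simp only:)
qed

lemma eigfun_zero: "eigfun 0 n x = 0" "eigfun m 0 x = 0" by (simp_all add: eigfun_def)

lemma eigfun_swap: "eigfun n m x = - eigfun m n x" by (simp add: eigfun_def)

lemma eigfun_frontier: "x \<in> frontier tri \<Longrightarrow> eigfun m n x = 0"
proof -
  assume "x \<in> frontier tri"
  then consider "bc x = 0" | "gc x = 0" | "1 - bc x = gc x" using frontier_tri[of x] by fastforce
  then show ?thesis by cases (auto simp: eigfun_def uc_def vc_def)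
qed

section \<open>Completeness of the eigenfunctions of the right triangle\<close>

definition idx :: "(nat \<times> nat) set" where "idx = {(m, n). 1 \<le> m \<and> 1 \<le> n}"
definition ff :: "nat \<times> nat \<Rightarrow> real^2 \<Rightarrow> complex" where "ff k x = of_real (eigfun (fst k) (snd k) x)"

text \<open>The recurrences below lower an index to 0 at worst, where the function vanishes; both
  orders of a pair and the diagonal belong to \<open>idx\<close>, so no pair has to be
  reordered.\<close>

lemma eigfun_in_cspan: "(\<lambda>x. complex_of_real (eigfun m n x)) \<in> cspan (ff ` idx)"
proof (cases "m = 0 \<or> n = 0")
  case True
  then have "(\<lambda>x. complex_of_real (eigfun m n x)) = (\<lambda>_. 0)" by (auto simp: eigfun_zero)
  then show ?thesis by (simp add: cspan.zero)
next
  case False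
  then have "(m, n) \<in> idx" by (simp add: idx_def)
  moreover have "ff (m, n) = (\<lambda>x. complex_of_real (eigfun m n x))" by (simp add: ff_def fun_eq_iff)
  ultimately show ?thesis using cspan.base by (metis image_eqI)
qed

lemma sin_times_cos: "sin (real (Suc m) * t) * cos t = (sin (real (Suc (Suc m)) * t) + sin (real m * t)) / 2"
proof -
  have "real (Suc (Suc m)) * t = real (Suc m) * t + t" "real m * t = real (Suc m) * t - t"
    by (simp_all add: algebra_simps)
  then show ?thesis by (simp only: sin_add sin_diff) simp
qed

text \<open>Multiplication by \<open>cos u + cos v\<close> moves one index a step up or down; the
  indices are successors so that the lower neighbour is again a natural number.\<close>

lemma sc_eigfun: "sc x * eigfun (Suc m) (Suc n) x =
   (1/2) * ((eigfun (Suc (Suc m)) (Suc n) x + eigfun m (Suc n) x) + (eigfun (Suc m) (Suc (Suc n)) x + eigfun (Suc m) n x))"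
proof -
  have "sc x * eigfun (Suc m) (Suc n) x =
     (sin (Suc m * uc x) * cos (uc x)) * sin (Suc n * vc x) + sin (Suc m * uc x) * (sin (Suc n * vc x) * cos (vc x))
     - (sin (Suc n * uc x) * cos (uc x)) * sin (Suc m * vc x) - sin (Suc n * uc x) * (sin (Suc m * vc x) * cos (vc x))"
    by (simp add: sc_def eigfun_def algebra_simps del: of_nat_Suc)
  then show ?thesis unfolding sin_times_cos by (simp add: eigfun_def algebra_simps add_divide_distrib del: of_nat_Suc)
qed

lemma pc_eigfun: "pc x * eigfun (Suc m) (Suc n) x =
   (1/4) * ((eigfun (Suc (Suc m)) (Suc (Suc n)) x + eigfun (Suc (Suc m)) n x) + (eigfun m (Suc (Suc n)) x + eigfun m n x))"
proof -
  have "pc x * eigfun (Suc m) (Suc n) x =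
     (sin (Suc m * uc x) * cos (uc x)) * (sin (Suc n * vc x) * cos (vc x))
     - (sin (Suc n * uc x) * cos (uc x)) * (sin (Suc m * vc x) * cos (vc x))"
    by (simp add: pc_def eigfun_def algebra_simps del: of_nat_Suc)
  then show ?thesis unfolding sin_times_cos by (simp add: eigfun_def algebra_simps add_divide_distrib del: of_nat_Suc)
qed

lemma multipliers:
  assumes "r \<in> {sc, pc}" "k \<in> idx"
  shows "(\<lambda>x. complex_of_real (r x) * ff k x) \<in> cspan (ff ` idx)"
proof -
  obtain m n where k: "k = (Suc m, Suc n)"
    using assms(2) by (cases k) (auto simp: idx_def Suc_le_eq gr0_conv_Suc)
  have S: "(\<lambda>x. complex_of_real (1/2) * ((of_real (eigfun (Suc (Suc m)) (Suc n) x) + of_real (eigfun m (Suc n) x)) +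
      (of_real (eigfun (Suc m) (Suc (Suc n)) x) + of_real (eigfun (Suc m) n x)))) \<in> cspan (ff ` idx)"
    by (intro cspan.scale cspan.add eigfun_in_cspan)
  have P: "(\<lambda>x. complex_of_real (1/4) * ((of_real (eigfun (Suc (Suc m)) (Suc (Suc n)) x) + of_real (eigfun (Suc (Suc m)) n x)) +
      (of_real (eigfun m (Suc (Suc n)) x) + of_real (eigfun m n x)))) \<in> cspan (ff ` idx)"
    by (intro cspan.scale cspan.add eigfun_in_cspan)
  from assms(1) consider "r = sc" | "r = pc" by blast
  then show ?thesis
  proof cases
    case 1
    show ?thesis
      using S unfolding 1 k ff_def fst_conv snd_conv of_real_add[symmetric] of_real_mult[symmetric] sc_eigfun .
  next
    case 2
    show ?thesis
      using P unfolding 2 k ff_def fst_conv snd_conv of_real_add[symmetric] of_real_mult[symmetric] pc_eigfun .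
  qed
qed

text \<open>\<open>cos u\<close> and \<open>cos v\<close> are the roots of
  \<open>T\<^sup>2 - sc * T + pc\<close>, and \<open>v \<le> u\<close> decides which is which. The
  closed triangle is treated because Stone-Weierstrass has to separate boundary points too.\<close>

lemma sc_pc_inj:
  assumes "x \<in> closure tri" "y \<in> closure tri" "sc x = sc y" "pc x = pc y"
  shows "x = y"
proof -
  have rng: "0 \<le> vc z \<and> vc z \<le> uc z \<and> uc z \<le> pi \<and> cos (uc z) \<le> cos (vc z)" if "z \<in> closure tri" for z
  proof -
    have "0 \<le> bc z" "0 \<le> gc z" "gc z \<le> 1 - bc z" using closure_tri[OF that] by auto
    then have "0 \<le> vc z" "vc z \<le> uc z" "uc z \<le> pi"
      unfolding uc_def vc_def by (auto intro: mult_left_mono mult_left_le)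
    then show ?thesis by (auto intro: cos_monotone_0_pi_le)
  qed
  have "(cos (uc x) - cos (uc y)) * (cos (uc x) - cos (vc y)) = 0"
  proof -
    have "(cos (uc x) - cos (uc y)) * (cos (uc x) - cos (vc y)) = (cos (uc x))\<^sup>2 - cos (uc x) * sc y + pc y"
      by (simp add: sc_def pc_def power2_eq_square algebra_simps)
    also have "\<dots> = 0" unfolding assms(3,4)[symmetric] by (simp add: sc_def pc_def power2_eq_square algebra_simps)
    finally show ?thesis .
  qed
  then have "cos (uc x) = cos (uc y) \<or> cos (uc x) = cos (vc y)" by simp
  moreover have "cos (uc x) + cos (vc x) = cos (uc y) + cos (vc y)" using assms(3) by (simp add: sc_def)
  ultimately have "cos (uc x) = cos (uc y)" "cos (vc x) = cos (vc y)"
    using rng[OF assms(1)] rng[OF assms(2)] by auto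
  then have "uc x = uc y" "vc x = vc y"
    using rng[OF assms(1)] rng[OF assms(2)] by (auto intro!: cos_inj_pi)
  then have "bc x = bc y" "gc x = gc y" by (auto simp: uc_def vc_def)
  then show ?thesis by (rule coords_eqI)
qed

lemma eigfun21: "eigfun 2 1 x = 2 * sin (uc x) * sin (vc x) * (cos (uc x) - cos (vc x))"
  by (simp add: eigfun_def sin_double algebra_simps)

lemma tri_range: "x \<in> tri \<Longrightarrow> 0 < vc x \<and> vc x < uc x \<and> uc x < pi"
  unfolding uc_def vc_def tri_def
  using mult_strict_left_mono[OF _ pi_gt_zero, of "gc x" "1 - bc x"] mult_strict_left_mono[OF _ pi_gt_zero, of "1 - bc x" 1]
  by auto

lemma eigfun21_nonzero: "x \<in> tri \<Longrightarrow> eigfun 2 1 x \<noteq> 0"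
proof -
  assume "x \<in> tri"
  then have r: "0 < vc x" "vc x < uc x" "uc x < pi" using tri_range by auto
  then have "sin (uc x) > 0" "sin (vc x) > 0" "cos (uc x) < cos (vc x)"
    by (auto intro: sin_gt_zero cos_monotone_0_pi)
  then show ?thesis by (simp add: eigfun21 del: One_nat_def)
qed

lemma completeness:
  assumes "continuous_on (closure tri) u"
    "\<And>k. k \<in> idx \<Longrightarrow> (LINT x|lborel. indicator tri x *\<^sub>R (u x * ff k x)) = 0" "x \<in> tri"
  shows "u x = 0"
proof (rule stone_weierstrass_completeness[OF open_tri bounded_tri, where F = ff and K = idx and
    S = "{sc, pc}" and w = "\<lambda>x. complex_of_real (eigfun 2 1 x)"])
  show "continuous_on (closure tri) (ff k)" for k
    unfolding ff_def[abs_def] using helmholtz_on_imp_continuous_on[OF helmholtz_eigfun] continuous_on_subset by blast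
  show "continuous_on (closure tri) r" if "r \<in> {sc, pc}" for r
    using that unfolding sc_def[abs_def] pc_def[abs_def]
    by (auto intro!: continuous_intros continuous_on_uc continuous_on_vc)
  show "\<exists>r\<in>{sc, pc}. r x \<noteq> r y" if "x \<in> closure tri" "y \<in> closure tri" "x \<noteq> y" for x y
    using sc_pc_inj[OF that(1,2)] that(3) by auto
qed (use assms eigfun_in_cspan eigfun21_nonzero multipliers in \<open>auto\<close>)

text \<open>\<open>uniq\<close> makes the eigenvalue simple, so the jump is one square over an
  unknown positive \<open>N\<close>. A function vanishing throughout \<open>tri\<close> is split
  off, since \<open>eigenspace_kernel\<close> asks for a nonzero one; both sides are then 0.\<close>

lemma eigfun_abs_eq:
  assumes basis: "dirichlet_eigenbasis tri lam e" and xy: "x \<in> tri" "y \<in> tri"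
    and eq: "\<forall>\<mu>\<ge>0. local_weyl_counting lam e x \<mu> = local_weyl_counting lam e y \<mu>"
    and uniq: "\<And>m n. 1 \<le> m \<Longrightarrow> 1 \<le> n \<Longrightarrow> m\<^sup>2 + n\<^sup>2 = m0\<^sup>2 + n0\<^sup>2 \<Longrightarrow> (m, n) = (m0, n0) \<or> (m, n) = (n0, m0)"
    and "1 \<le> m0" "1 \<le> n0"
  shows "(eigfun m0 n0 x)\<^sup>2 = (eigfun m0 n0 y)\<^sup>2"
proof (cases "\<exists>z\<in>tri. eigfun m0 n0 z \<noteq> 0")
  case True
  define \<kappa> where "\<kappa> = (\<lambda>(m::nat, n::nat). pi\<^sup>2 * ((real m)\<^sup>2 + (real n)\<^sup>2) / l)"
  define \<mu> where "\<mu> = \<kappa> (m0, n0)"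
  have "\<mu> > 0" using l(1) \<open>1 \<le> m0\<close> by (auto simp: \<mu>_def \<kappa>_def intro!: divide_pos_pos mult_pos_pos add_pos_nonneg)
  have span: "\<exists>d. \<forall>x\<in>tri. ff k x = (\<Sum>i\<in>{()}. d i * cnj (complex_of_real (eigfun m0 n0 x)))" if "k \<in> idx" "\<kappa> k = \<mu>" for k
  proof -
    obtain m n where k: "k = (m, n)" by (cases k)
    have "(real m)\<^sup>2 + (real n)\<^sup>2 = (real m0)\<^sup>2 + (real n0)\<^sup>2"
      using that(2) l(1) by (simp add: \<mu>_def \<kappa>_def k)
    then have "m\<^sup>2 + n\<^sup>2 = m0\<^sup>2 + n0\<^sup>2" by (metis of_nat_add of_nat_eq_iff of_nat_power)
    then have "(m, n) = (m0, n0) \<or> (m, n) = (n0, m0)" using uniq that(1) by (simp add: k idx_def)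
    then show ?thesis
    proof
      assume "(m, n) = (m0, n0)"
      then show ?thesis by (intro exI[of _ "\<lambda>_. 1"]) (simp add: k ff_def)
    next
      assume "(m, n) = (n0, m0)"
      then show ?thesis by (intro exI[of _ "\<lambda>_. -1"]) (simp add: k ff_def eigfun_swap[of n0 m0])
    qed
  qed
  obtain N where N: "\<And>i. i \<in> {()} \<Longrightarrow> 0 < N i"
    "\<And>x. x \<in> tri \<Longrightarrow> (\<Sum>j | lam j = sqrt \<mu>. (norm (e j x))\<^sup>2) =
      (\<Sum>i\<in>{()}. (norm (complex_of_real (eigfun m0 n0 x)))\<^sup>2 / N i)"
  proof (rule eigenspace_kernel[OF open_tri convex_tri bounded_tri basis, where
        K = idx and F = ff and I = "{()}" and v = "\<lambda>_ x. complex_of_real (eigfun m0 n0 x)" and \<kappa> = \<kappa> and \<mu> = \<mu>])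
    show "u x = 0" if "continuous_on (closure tri) u" "x \<in> tri"
      "\<And>k. k \<in> idx \<Longrightarrow> (LINT x|lborel. indicator tri x *\<^sub>R (u x * ff k x)) = 0" for u x
      by (rule completeness) (fact that)+
    show "helmholtz_on UNIV (\<kappa> k) (ff k)" for k
      unfolding \<kappa>_def ff_def[abs_def] by (cases k) (simp add: helmholtz_eigfun)
    show "helmholtz_on UNIV \<mu> (\<lambda>x. complex_of_real (eigfun m0 n0 x))"
      unfolding \<mu>_def \<kappa>_def by (simp add: helmholtz_eigfun)
  qed (use True span \<open>\<mu> > 0\<close> in \<open>auto simp: ff_def eigfun_frontier\<close>)
  have "(\<Sum>j | lam j = sqrt \<mu>. (norm (e j x))\<^sup>2) = (\<Sum>j | lam j = sqrt \<mu>. (norm (e j y))\<^sup>2)"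
    by (rule weyl_jump_eq_of_weyl_eq) (use basis eq \<open>\<mu> > 0\<close> in \<open>auto simp: dirichlet_eigenbasis_def\<close>)
  then show ?thesis using N(1)[of "()"] by (simp add: N(2)[OF xy(1)] N(2)[OF xy(2)])
qed (use xy in auto)

text \<open>\<open>eigfun 2 1\<close> plays the part of a Weyl denominator, with quotients symmetric
  in \<open>cos u\<close> and \<open>cos v\<close>. In the last formula
  \<open>(1 + pc)\<^sup>2 - sc\<^sup>2\<close> is \<open>(sin u)\<^sup>2 * (sin v)\<^sup>2\<close>
  and \<open>sc\<^sup>2 - 4 * pc\<close> is the discriminant
  \<open>(cos u - cos v)\<^sup>2\<close>.\<close>

lemma eigfun_factor:
  "eigfun 3 1 x = eigfun 2 1 x * (2 * sc x)"
  "eigfun 3 2 x = eigfun 2 1 x * (4 * pc x + 1)"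
  "eigfun 4 1 x = eigfun 2 1 x * (4 * ((sc x)\<^sup>2 - pc x) - 2)"
  "(eigfun 2 1 x)\<^sup>2 = 4 * (((1 + pc x)\<^sup>2 - (sc x)\<^sup>2) * ((sc x)\<^sup>2 - 4 * pc x))"
proof -
  have s2: "sin (2 * t) = sin t * (2 * cos t)" for t :: real by (simp add: sin_double)
  have sq: "sin t * sin t = 1 - cos t * cos t" for t :: real
    using sin_cos_squared_add[of t] by (simp add: power2_eq_square)
  have s3: "sin (3 * t) = sin t * (4 * (cos t)\<^sup>2 - 1)" for t :: real
  proof -
    have "sin (3 * t) = sin (2 * t + t)" by (rule arg_cong[where f = sin]) simp
    also have "\<dots> = sin t * (2 * cos t * cos t + cos (2 * t))"
      unfolding sin_add s2 by (simp add: algebra_simps)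
    finally show ?thesis unfolding cos_double_cos by (simp add: power2_eq_square algebra_simps)
  qed
  have s4: "sin (4 * t) = sin t * (8 * (cos t)^3 - 4 * cos t)" for t :: real
  proof -
    have "sin (4 * t) = sin (2 * (2 * t))" by simp
    also have "\<dots> = sin t * (4 * cos t * cos (2 * t))" unfolding s2 by (simp add: algebra_simps)
    finally show ?thesis unfolding cos_double_cos by (simp add: power2_eq_square power3_eq_cube algebra_simps)
  qed
  show "eigfun 3 1 x = eigfun 2 1 x * (2 * sc x)" "eigfun 3 2 x = eigfun 2 1 x * (4 * pc x + 1)"
    "eigfun 4 1 x = eigfun 2 1 x * (4 * ((sc x)\<^sup>2 - pc x) - 2)"
    by (simp_all add: eigfun_def s2 s3 s4 sc_def pc_def power2_eq_square power3_eq_cube algebra_simps)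
  have "(eigfun 2 1 x)\<^sup>2 = 4 * ((sin (uc x) * sin (uc x)) * (sin (vc x) * sin (vc x))) * (cos (uc x) - cos (vc x))\<^sup>2"
    unfolding eigfun21 by (simp add: power2_eq_square algebra_simps)
  also have "\<dots> = 4 * (((1 + pc x)\<^sup>2 - (sc x)\<^sup>2) * ((sc x)\<^sup>2 - 4 * pc x))"
    unfolding sq by (simp add: sc_def pc_def power2_eq_square algebra_simps)
  finally show "(eigfun 2 1 x)\<^sup>2 = 4 * (((1 + pc x)\<^sup>2 - (sc x)\<^sup>2) * ((sc x)\<^sup>2 - 4 * pc x))" .
qed

text \<open>The reflection in the axis of the triangle. It sends \<open>(u, v)\<close> to
  \<open>(pi - v, pi - u)\<close>, so it negates \<open>sc\<close> and preserves
  \<open>pc\<close>.\<close>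

lemma swap_isometry: "is_isometry_of tri (\<lambda>x. pt (gc x) (bc x))"
  unfolding is_isometry_of_def
proof (intro conjI ballI)
  show "bij_betw (\<lambda>x. pt (gc x) (bc x)) tri tri"
    by (rule bij_betw_byWitness[where f' = "\<lambda>x. pt (gc x) (bc x)"]) (auto simp: pt_bc_gc tri_def add.commute)
  show "dist (pt (gc x) (bc x)) (pt (gc y) (bc y)) = dist x y" for x y
  proof -
    have "(dist (pt (gc x) (bc x)) (pt (gc y) (bc y)))\<^sup>2 = (dist x y)\<^sup>2"
      unfolding dist_eq_coords using l(2-4) by simp
    then show ?thesis by simp
  qed
qed

text \<open>The sums are 5, 10, 13 and 17, the four lowest eigenvalues up to a common factor; a
  finite search below 17 shows each representation to be unique up to order.\<close>

lemma two_squares_unique: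
  fixes m n m0 n0 :: nat
  assumes "(m0, n0) \<in> {(2, 1), (3, 1), (3, 2), (4, 1)}" "1 \<le> m" "1 \<le> n" "m\<^sup>2 + n\<^sup>2 = m0\<^sup>2 + n0\<^sup>2"
  shows "(m, n) = (m0, n0) \<or> (m, n) = (n0, m0)"
proof -
  have *: "k \<le> 4" if "k\<^sup>2 \<le> 17" for k :: nat
  proof (rule ccontr)
    assume "\<not> k \<le> 4"
    then have "5 ^ 2 \<le> k ^ 2" by (intro power_mono) auto
    then show False using that by simp
  qed
  have "m\<^sup>2 + n\<^sup>2 \<le> 17" using assms by auto
  then have "m \<le> 4" "n \<le> 4" using *[of m] *[of n] by auto
  then have "m \<in> {1, 2, 3, 4}" "n \<in> {1, 2, 3, 4}" using assms by auto
  then show ?thesis using assms(1,4) by auto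
qed

text \<open>The eigenvalues given by (3, 1), (3, 2), (4, 1) leave a second candidate for \<open>pc y\<close> only if
  \<open>(sc x)\<^sup>2 = 1/4\<close>; the value of the first eigenfunction (2, 1) then excludes it.\<close>

theorem isometry_exists:
  assumes basis: "dirichlet_eigenbasis tri lam e" and xy: "x \<in> tri" "y \<in> tri"
    and eq: "\<forall>\<mu>\<ge>0. local_weyl_counting lam e x \<mu> = local_weyl_counting lam e y \<mu>"
  shows "\<exists>\<phi>. is_isometry_of tri \<phi> \<and> \<phi> x = y"
proof -
  have E: "(eigfun m n x)\<^sup>2 = (eigfun m n y)\<^sup>2" if "(m, n) \<in> {(2, 1), (3, 1), (3, 2), (4, 1)}" for m n
    by (rule eigfun_abs_eq[OF basis xy eq two_squares_unique[OF that]]) (use that in auto)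
  define s p s' p' where d: "s = sc x" "p = pc x" "s' = sc y" "p' = pc y"
  define D where "D = (eigfun 2 1 x)\<^sup>2"
  have D0: "D > 0" using eigfun21_nonzero[OF xy(1)] by (simp add: D_def)
  have D': "(eigfun 2 1 y)\<^sup>2 = D" using E[of 2 1] by (simp add: D_def)
  have "D * (2 * s)\<^sup>2 = D * (2 * s')\<^sup>2" "D * (4 * p + 1)\<^sup>2 = D * (4 * p' + 1)\<^sup>2"
    "D * (4 * (s\<^sup>2 - p) - 2)\<^sup>2 = D * (4 * (s'\<^sup>2 - p') - 2)\<^sup>2"
    using E[of 3 1] E[of 3 2] E[of 4 1] D' unfolding eigfun_factor(1-3) power_mult_distrib d
    by (simp_all add: D_def del: power_mult_distrib)
  then have q: "(2 * s)\<^sup>2 = (2 * s')\<^sup>2" "(4 * p + 1)\<^sup>2 = (4 * p' + 1)\<^sup>2"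
    "(4 * (s\<^sup>2 - p) - 2)\<^sup>2 = (4 * (s'\<^sup>2 - p') - 2)\<^sup>2"
    using D0 by auto
  have s: "s\<^sup>2 = s'\<^sup>2" using q(1) by simp
  have "((1 + p)\<^sup>2 - s\<^sup>2) * (s\<^sup>2 - 4 * p) = ((1 + p')\<^sup>2 - s'\<^sup>2) * (s'\<^sup>2 - 4 * p')"
    using E[of 2 1] unfolding eigfun_factor(4) d by simp
  then have G: "((1 + p)\<^sup>2 - s\<^sup>2) * (s\<^sup>2 - 4 * p) = ((1 + p')\<^sup>2 - s\<^sup>2) * (s\<^sup>2 - 4 * p')"
    by (simp only: s)
  \<comment> \<open>\<open>s\<^sup>2 - 4 * p\<close> is the square of \<open>cos u - cos v\<close>;
    that both cosines are real is what bounds the second candidate below.\<close>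
  have disc: "4 * p \<le> s\<^sup>2" "4 * p' \<le> s\<^sup>2"
  proof -
    have "(sc z)\<^sup>2 - 4 * pc z = (cos (uc z) - cos (vc z))\<^sup>2" for z
      by (simp add: sc_def pc_def power2_eq_square algebra_simps)
    then show "4 * p \<le> s\<^sup>2" "4 * p' \<le> s\<^sup>2" unfolding s unfolding d
      by (metis diff_ge_0_iff_ge zero_le_power2 s d(1) d(3))+
  qed
  have p: "p = p'"
  proof (rule ccontr)
    assume ne: "p \<noteq> p'"
    have "4 * p + 1 = 4 * p' + 1 \<or> 4 * p + 1 = - (4 * p' + 1)" using q(2) by (simp add: power2_eq_iff)
    then have pp: "p' = - 1/2 - p" using ne by auto
    have "4 * (s\<^sup>2 - p) - 2 = 4 * (s\<^sup>2 - p') - 2 \<or> 4 * (s\<^sup>2 - p) - 2 = - (4 * (s\<^sup>2 - p') - 2)"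
      using q(3) unfolding s by (simp add: power2_eq_iff)
    then have s14: "s\<^sup>2 = 1/4" using ne pp by auto
    have pb: "p \<le> 1/16" "p' \<le> 1/16" using disc s14 by auto
    \<comment> \<open>The two candidates are symmetric about \<open>- 1/4\<close>, so
      \<open>G\<close> compares one cubic at \<open>r\<close> and \<open>- r\<close>: only its odd
      part \<open>r * (5/8 - 4 * r\<^sup>2)\<close> survives, whose nonzero roots violate
      \<open>rb\<close>.\<close>
    define r where "r = p + 1/4"
    have r: "p = r - 1/4" "p' = - r - 1/4" using pp by (auto simp: r_def)
    have rb: "\<bar>r\<bar> \<le> 5/16" using pb unfolding r by auto
    have rn: "r \<noteq> 0" using ne r by auto
    have "r * (5/8 - 4 * r\<^sup>2) = 0"
      using G unfolding s14 r by (simp add: power2_eq_square field_simps)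
    then have "r\<^sup>2 = 5/32" using rn by simp
    moreover have "r\<^sup>2 \<le> (5/16)\<^sup>2" using rb by (metis abs_ge_zero power2_abs power_mono)
    ultimately show False by (simp add: power2_eq_square)
  qed
  have cl: "x \<in> closure tri" "y \<in> closure tri" using xy closure_subset by blast+
  have "s = s' \<or> s' = - s" using s by (auto simp: power2_eq_iff)
  then show ?thesis
  proof
    assume "s = s'"
    then have "x = y" using sc_pc_inj[OF cl] p by (simp add: d)
    then show ?thesis by (intro exI[of _ id]) (simp add: is_isometry_of_def)
  next
    \<comment> \<open>Changing the sign of \<open>sc\<close> and keeping \<open>pc\<close> is the
      effect of the reflection, so the reflected \<open>x\<close> has the same symmetric functions
      as \<open>y\<close>.\<close>
    assume s': "s' = - s"
    let ?z = "pt (gc x) (bc x)"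
    have z: "?z \<in> closure tri" using xy(1) closure_subset[of tri] by (auto simp: tri_def)
    have "cos (uc ?z) = - cos (vc x)" "cos (vc ?z) = - cos (uc x)"
      by (simp_all add: uc_def vc_def right_diff_distrib cos_diff)
    then have "sc ?z = sc y" "pc ?z = pc y" using s' p by (simp_all add: sc_def pc_def d mult.commute)
    then have "?z = y" by (rule sc_pc_inj[OF z cl(2)])
    then show ?thesis using swap_isometry by blast
  qed
qed

end

section \<open>The equilateral triangle\<close>

lemma is_isometry_of_id: "is_isometry_of \<Omega> (\<lambda>x. x)"
  unfolding is_isometry_of_def by (simp add: bij_betw_id[unfolded id_def])

lemma is_isometry_of_comp:
  assumes "is_isometry_of \<Omega> \<phi>" "is_isometry_of \<Omega> \<psi>"
  shows "is_isometry_of \<Omega> (\<lambda>x. \<psi> (\<phi> x))"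
proof -
  have "bij_betw (\<psi> \<circ> \<phi>) \<Omega> \<Omega>"
    using assms bij_betw_trans unfolding is_isometry_of_def by blast
  moreover have "\<phi> x \<in> \<Omega>" if "x \<in> \<Omega>" for x
    using assms(1) that unfolding is_isometry_of_def bij_betw_def by blast
  ultimately show ?thesis
    using assms unfolding is_isometry_of_def by (simp add: o_def)
qed

text \<open>\<open>w1\<close> is a root of the cubic with the roots \<open>z1\<close>,
  \<open>z2\<close>, \<open>z3\<close>; once it is identified, a quadratic compares the other
  two.\<close>

lemma triple_eq_perm:
  fixes z1 z2 z3 w1 w2 w3 :: "'a :: idom"
  assumes "z1 + z2 + z3 = w1 + w2 + w3" "z1 * z2 + z2 * z3 + z1 * z3 = w1 * w2 + w2 * w3 + w1 * w3"
    "z1 * z2 * z3 = w1 * w2 * w3"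
  shows "(w1 = z1 \<and> w2 = z2 \<and> w3 = z3) \<or> (w1 = z1 \<and> w2 = z3 \<and> w3 = z2) \<or>
    (w1 = z2 \<and> w2 = z1 \<and> w3 = z3) \<or> (w1 = z2 \<and> w2 = z3 \<and> w3 = z1) \<or>
    (w1 = z3 \<and> w2 = z1 \<and> w3 = z2) \<or> (w1 = z3 \<and> w2 = z2 \<and> w3 = z1)"
proof -
  have "(w1 - z1) * ((w1 - z2) * (w1 - z3)) = 0" using assms by algebra
  then consider "w1 = z1" | "w1 = z2" | "w1 = z3" by auto
  then show ?thesis
  proof cases
    case 1
    then have s: "w2 + w3 = z2 + z3" using assms(1) by (simp add: add.assoc)
    have "(w2 - z2) * (w2 - z3) = 0" using assms(2) 1 s by algebra
    then have "w2 = z2 \<or> w2 = z3" by simp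
    moreover have "w3 = z2 + z3 - w2" using s by algebra
    ultimately show ?thesis using 1 by auto
  next
    case 2
    have "z2 + (w2 + w3) = z2 + (z1 + z3)" using assms(1) 2 by (simp add: ac_simps)
    then have s: "w2 + w3 = z1 + z3" by simp
    have "(w2 - z1) * (w2 - z3) = 0" using assms(2) 2 s by algebra
    then have "w2 = z1 \<or> w2 = z3" by simp
    moreover have "w3 = z1 + z3 - w2" using s by algebra
    ultimately show ?thesis using 2 by auto
  next
    case 3
    have "z3 + (w2 + w3) = z3 + (z1 + z2)" using assms(1) 3 by (simp add: ac_simps)
    then have s: "w2 + w3 = z1 + z2" by simp
    have "(w2 - z1) * (w2 - z2) = 0" using assms(2) 3 s by algebra
    then have "w2 = z1 \<or> w2 = z2" by simp
    moreover have "w3 = z1 + z2 - w2" using s by algebra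
    ultimately show ?thesis using 3 by auto
  qed
qed

text \<open>The closed triangle is an alcove of the affine Weyl group of type A2, so it meets each
  orbit once. \<open>t1\<close>, \<open>t2\<close>, \<open>t3\<close> are the phases of three waves
  in units of \<open>2 * pi\<close>; they add up to 0, so two of them determine the third.\<close>

lemma alcove_fundamental_domain:
  fixes b g b' g' r1 r2 t1 t2 t3 :: real and n1 n2 :: int
  assumes "0 \<le> b" "0 \<le> g" "b + g \<le> 1" "0 \<le> b'" "0 \<le> g'" "b' + g' \<le> 1"
    and t: "t1 = (b + 2 * g) / 3" "t2 = (b - g) / 3" "t3 = (- 2 * b - g) / 3"
    and n: "(b' + 2 * g') / 3 = r1 + of_int n1" "(b' - g') / 3 = r2 + of_int n2"
    and perm: "(r1 = t1 \<and> r2 = t2) \<or> (r1 = t1 \<and> r2 = t3) \<or> (r1 = t2 \<and> r2 = t1) \<or>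
    (r1 = t2 \<and> r2 = t3) \<or> (r1 = t3 \<and> r2 = t1) \<or> (r1 = t3 \<and> r2 = t2)"
  shows "b = b' \<and> g = g'"
proof -
  have "\<bar>t1\<bar> \<le> 2/3" "\<bar>t2\<bar> \<le> 2/3" "\<bar>t3\<bar> \<le> 2/3"
    unfolding t using assms(1-6) by auto
  then have rb: "\<bar>r1\<bar> \<le> 2/3" "\<bar>r2\<bar> \<le> 2/3" using perm by auto
  have bd: "\<bar>(b' + 2 * g') / 3\<bar> \<le> 2/3" "\<bar>(b' - g') / 3\<bar> \<le> 2/3"
    using assms(4-6) by auto
  \<comment> \<open>All phases are at most 2/3 in absolute value, so an integer difference is -1, 0
    or 1; what remains is a finite list of linear systems.\<close>
  have small: "k = -1 \<or> k = 0 \<or> k = 1" if "\<bar>u\<bar> \<le> 2/3" "\<bar>v\<bar> \<le> 2/3" "u = v + of_int k" for u v :: real and k :: int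
  proof -
    have "\<bar>of_int k :: real\<bar> < 2" using that by linarith
    then show ?thesis by linarith
  qed
  define m1 m2 :: real where m: "m1 = of_int n1" "m2 = of_int n2"
  have k: "m1 = -1 \<or> m1 = 0 \<or> m1 = 1" "m2 = -1 \<or> m2 = 0 \<or> m2 = 1"
    using small[OF bd(1) rb(1) n(1)] small[OF bd(2) rb(2) n(2)] unfolding m by auto
  have e: "b' + 2 * g' = 3 * r1 + 3 * m1" "b' - g' = 3 * r2 + 3 * m2"
    using n(1,2) unfolding m by (simp_all add: field_simps)
  have T: "3 * t1 = b + 2 * g" "3 * t2 = b - g" "3 * t3 = - 2 * b - g" unfolding t by simp_all
  have "(3 * r1 = b + 2 * g \<and> 3 * r2 = b - g) \<or> (3 * r1 = b + 2 * g \<and> 3 * r2 = - 2 * b - g) \<or>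
    (3 * r1 = b - g \<and> 3 * r2 = b + 2 * g) \<or> (3 * r1 = b - g \<and> 3 * r2 = - 2 * b - g) \<or>
    (3 * r1 = - 2 * b - g \<and> 3 * r2 = b + 2 * g) \<or> (3 * r1 = - 2 * b - g \<and> 3 * r2 = b - g)"
    using perm T by metis
  then have p: "(b' + 2 * g' - 3 * m1 = b + 2 * g \<and> b' - g' - 3 * m2 = b - g) \<or>
    (b' + 2 * g' - 3 * m1 = b + 2 * g \<and> b' - g' - 3 * m2 = - 2 * b - g) \<or>
    (b' + 2 * g' - 3 * m1 = b - g \<and> b' - g' - 3 * m2 = b + 2 * g) \<or>
    (b' + 2 * g' - 3 * m1 = b - g \<and> b' - g' - 3 * m2 = - 2 * b - g) \<or>
    (b' + 2 * g' - 3 * m1 = - 2 * b - g \<and> b' - g' - 3 * m2 = b + 2 * g) \<or>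
    (b' + 2 * g' - 3 * m1 = - 2 * b - g \<and> b' - g' - 3 * m2 = b - g)"
    unfolding e by simp
  have "b = b'" using p k assms(1-6) by (elim disjE conjE; linarith)
  moreover have "g = g'" using p k assms(1-6) by (elim disjE conjE; linarith)
  ultimately show ?thesis by simp
qed

text \<open>\<open>P\<close> and \<open>Q\<close> come from inverting the Gram matrix of
  \<open>p\<close>, \<open>q\<close>, with diagonal \<open>l\<close> and off-diagonal entry
  \<open>l / 2\<close>.\<close>

locale equilateral_triangle = triangle_coordinates a p q P Q for a p q P Q :: "real^2" +
  fixes l :: real
  assumes l: "l > 0" "p \<bullet> p = l" "q \<bullet> q = l" "p \<bullet> q = l / 2"
    "P = (4 / (3 * l)) *\<^sub>R (p - (1/2) *\<^sub>R q)" "Q = (4 / (3 * l)) *\<^sub>R (q - (1/2) *\<^sub>R p)"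
begin

text \<open>The third in the exponent gives the waves \<open>wave 1 2\<close>,
  \<open>wave 1 (- 1)\<close>, \<open>wave (- 2) (- 1)\<close> integral indices, while their ratios
  are \<open>cis\<close> of \<open>2 * pi\<close> times \<open>gc\<close>, \<open>bc\<close> and
  \<open>bc + gc\<close>.\<close>

definition wave :: "int \<Rightarrow> int \<Rightarrow> real^2 \<Rightarrow> complex" where
  "wave A B x = cis (2 * pi / 3 * (A * bc x + B * gc x))"

lemma wave_add: "wave A B x * wave A' B' x = wave (A + A') (B + B') x"
  by (simp add: wave_def cis_mult algebra_simps)

lemma wave_cnj: "cnj (wave A B x) = wave (- A) (- B) x"
  by (simp add: wave_def cis_cnj algebra_simps)

lemma wave_0: "wave 0 0 x = 1" by (simp add: wave_def)

lemma helmholtz_wave: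
  "helmholtz_on UNIV (16 * pi\<^sup>2 / (27 * l) * real_of_int (A\<^sup>2 - A * B + B\<^sup>2)) (wave A B)"
proof -
  let ?c = "2 * pi / 3"
  have PQ: "P \<bullet> P = 4 / (3 * l)" "P \<bullet> Q = - 2 / (3 * l)" "Q \<bullet> Q = 4 / (3 * l)" "Q \<bullet> P = - 2 / (3 * l)"
  proof -
    have 1: "w \<bullet> P = 4 / (3 * l) * (w \<bullet> p - w \<bullet> q / 2)" "w \<bullet> Q = 4 / (3 * l) * (w \<bullet> q - w \<bullet> p / 2)" for w
      unfolding l(5,6) by (simp_all add: inner_diff_right)
    show "P \<bullet> P = 4 / (3 * l)" "P \<bullet> Q = - 2 / (3 * l)" "Q \<bullet> Q = 4 / (3 * l)" "Q \<bullet> P = - 2 / (3 * l)"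
      unfolding 1 dual by simp_all
  qed
  let ?k = "(?c * A) *\<^sub>R P + (?c * B) *\<^sub>R Q"
  have "?k \<bullet> ?k = ?c\<^sup>2 * (real_of_int A * real_of_int A * (4 / (3 * l)) + real_of_int B * real_of_int B * (4 / (3 * l)) - 2 * (real_of_int A * real_of_int B * (2 / (3 * l))))"
    unfolding inner_add_left inner_add_right inner_scaleR_left inner_scaleR_right PQ
    by (simp add: power2_eq_square algebra_simps)
  also have "\<dots> = 16 * pi\<^sup>2 / (27 * l) * real_of_int (A\<^sup>2 - A * B + B\<^sup>2)"
    using l(1) by (simp add: power2_eq_square field_simps)
  finally have "?k \<bullet> ?k = 16 * pi\<^sup>2 / (27 * l) * real_of_int (A\<^sup>2 - A * B + B\<^sup>2)" .
  from helmholtz_on_cis[OF this, of "- (?c * A) * (P \<bullet> a) - (?c * B) * (Q \<bullet> a)"]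
  have "helmholtz_on UNIV (16 * pi\<^sup>2 / (27 * l) * real_of_int (A\<^sup>2 - A * B + B\<^sup>2))
     (\<lambda>x. cis (- (?c * A) * (P \<bullet> a) - (?c * B) * (Q \<bullet> a) + ?k \<bullet> x))" .
  moreover have "- (?c * A) * (P \<bullet> a) - (?c * B) * (Q \<bullet> a) + ?k \<bullet> x = ?c * (A * bc x + B * gc x)" for x
    unfolding bc_def gc_def inner_add_left inner_diff_right inner_scaleR_left by (simp add: algebra_simps)
  ultimately show ?thesis unfolding wave_def[abs_def] by (simp only:)
qed

text \<open>The waves \<open>z\<^sub>1 = wave 1 2\<close>, \<open>z\<^sub>2 = wave 1 (- 1)\<close>, \<open>z\<^sub>3 = wave (- 2) (- 1)\<close> have product 1, and
  two of them agree on each side of the triangle.  \<open>alternant m n\<close> is the determinant with rows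
  \<open>(z\<^sub>i^(m + n), z\<^sub>i^n, 1)\<close>.\<close>

definition alternant :: "int \<Rightarrow> int \<Rightarrow> real^2 \<Rightarrow> complex" where
  "alternant m n x = wave (m + 2 * n) (2 * m + n) x - wave (m + 2 * n) (n - m) x + wave (m - n) (- m - 2 * n) x
     - wave (- 2 * m - n) (- m - 2 * n) x + wave (- 2 * m - n) (n - m) x - wave (m - n) (2 * m + n) x"

text \<open>Each wave in \<open>alternant m n\<close> has \<open>A\<^sup>2 - A * B + B\<^sup>2 = 3 *
  (m\<^sup>2 + m * n + n\<^sup>2)\<close>; the 3 turns the denominator 27 of
  \<open>helmholtz_wave\<close> into 9.\<close>

definition eigval :: "int \<Rightarrow> int \<Rightarrow> real" where "eigval m n = 16 * pi\<^sup>2 / (9 * l) * real_of_int (m\<^sup>2 + m * n + n\<^sup>2)"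

lemma helmholtz_alternant: "helmholtz_on UNIV (eigval m n) (alternant m n)"
proof -
  have *: "helmholtz_on UNIV (eigval m n) (wave A B)" if "A\<^sup>2 - A * B + B\<^sup>2 = 3 * (m\<^sup>2 + m * n + n\<^sup>2)" for A B
  proof -
    have "16 * pi\<^sup>2 / (27 * l) * real_of_int (3 * (m\<^sup>2 + m * n + n\<^sup>2)) = eigval m n"
      unfolding eigval_def using l(1) by (simp add: field_simps)
    then show ?thesis using helmholtz_wave[of A B] unfolding that by simp
  qed
  show ?thesis unfolding alternant_def[abs_def]
    by (intro helmholtz_on_diff helmholtz_on_add *) (simp_all add: power2_eq_square algebra_simps)
qed

lemma alternant_zero: "alternant 0 n x = 0" "alternant m 0 x = 0" by (simp_all add: alternant_def)

text \<open>Conjugation negates the exponents \<open>(m + n, n, 0)\<close>. As the three waves have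
  product 1, adding \<open>m + n\<close> to all of them gives \<open>(0, m, m + n)\<close>, the
  exponents of \<open>alternant n m\<close> in reverse order, whence the sign.\<close>

lemma alternant_cnj: "cnj (alternant m n x) = - alternant n m x"
proof -
  have e: "- (m + 2 * n) = - 2 * n - m" "- (2 * m + n) = - n - 2 * m" "- (n - m) = m - n" "- (m - n) = n - m"
    "- (- m - 2 * n) = 2 * n + m" "- (- 2 * m - n) = n + 2 * m" by simp_all
  show ?thesis
    unfolding alternant_def complex_cnj_diff complex_cnj_add wave_cnj e by simp
qed

section \<open>Multiplication by \<open>e1\<close> and completeness for the equilateral
  triangle\<close>

definition e1 :: "real^2 \<Rightarrow> complex" where "e1 x = wave 1 2 x + wave 1 (- 1) x + wave (- 2) (- 1) x"

lemma e1_cnj: "cnj (e1 x) = wave (- 1) (- 2) x + wave (- 1) 1 x + wave 2 1 x"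
  by (simp add: e1_def wave_cnj)

text \<open>Pieri's rule: multiplying the determinant by
  \<open>z\<^sub>1 + z\<^sub>2 + z\<^sub>3\<close> raises one of the exponents
  \<open>(m + n, n, 0)\<close> by one, and raising the last amounts to lowering the other
  two.\<close>

lemma e1_alternant: "e1 x * alternant m n x = alternant (m + 1) n x + alternant (m - 1) (n + 1) x + alternant m (n - 1) x"
  unfolding e1_def alternant_def by (simp add: distrib_left distrib_right left_diff_distrib right_diff_distrib wave_add) (simp add: algebra_simps)

lemma e1_cnj_alternant: "cnj (e1 x) * alternant m n x = alternant (m - 1) n x + alternant (m + 1) (n - 1) x + alternant m (n + 1) x"
proof -
  have "cnj (e1 x) * alternant m n x = cnj (e1 x * cnj (alternant m n x))" by simp
  also have "\<dots> = - cnj (e1 x * alternant n m x)" unfolding alternant_cnj by simp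
  also have "\<dots> = alternant m (n + 1) x + alternant (m + 1) (n - 1) x + alternant (m - 1) n x"
    unfolding e1_alternant complex_cnj_add alternant_cnj by simp
  finally show ?thesis by simp
qed

definition idx :: "(int \<times> int) set" where "idx = {(m, n). 1 \<le> m \<and> 1 \<le> n}"
definition ff :: "int \<times> int \<Rightarrow> real^2 \<Rightarrow> complex" where "ff k x = alternant (fst k) (snd k) x"

lemma alternant_in_cspan:
  assumes "0 \<le> m" "0 \<le> n"
  shows "alternant m n \<in> cspan (ff ` idx)"
proof (cases "m = 0 \<or> n = 0")
  case True
  then have "alternant m n = (\<lambda>_. 0)" by (auto simp: alternant_zero)
  then show ?thesis by (simp add: cspan.zero)
next
  case False
  then have "(m, n) \<in> idx" using assms by (simp add: idx_def)
  moreover have "ff (m, n) = alternant m n" by (simp add: ff_def fun_eq_iff)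
  ultimately show ?thesis using cspan.base by (metis image_eqI)
qed

text \<open>\<open>e1\<close> is complex, whereas Stone-Weierstrass works with real multipliers;
  products with \<open>e1\<close> and with \<open>cnj (e1 x)\<close> both stay in the span, hence so
  do those with its real and imaginary part.\<close>

lemma multipliers:
  assumes "r \<in> {\<lambda>x. Re (e1 x), \<lambda>x. Im (e1 x)}" "k \<in> idx"
  shows "(\<lambda>x. complex_of_real (r x) * ff k x) \<in> cspan (ff ` idx)"
proof -
  obtain m n where k: "k = (m, n)" "1 \<le> m" "1 \<le> n"
    using assms(2) by (cases k) (auto simp: idx_def)
  have A: "(\<lambda>x. e1 x * alternant m n x) \<in> cspan (ff ` idx)"
    unfolding e1_alternant by (intro cspan.add alternant_in_cspan) (use k in auto)
  have B: "(\<lambda>x. cnj (e1 x) * alternant m n x) \<in> cspan (ff ` idx)"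
    unfolding e1_cnj_alternant by (intro cspan.add alternant_in_cspan) (use k in auto)
  have re: "complex_of_real (Re z) * w = (1/2) * (z * w + cnj z * w)" for z w
    by (simp add: complex_eq_iff)
  have im: "complex_of_real (Im z) * w = (- \<i> / 2) * (z * w + (- 1) * (cnj z * w))" for z w
    by (simp add: complex_eq_iff)
  have ffk: "ff k x = alternant m n x" for x by (simp add: k ff_def)
  from assms(1) consider "r = (\<lambda>x. Re (e1 x))" | "r = (\<lambda>x. Im (e1 x))" by blast
  then show ?thesis
  proof cases
    case 1
    show ?thesis unfolding 1 ffk re by (intro cspan.scale cspan.add A B)
  next
    case 2
    show ?thesis unfolding 2 ffk im by (intro cspan.scale cspan.add A B)
  qed
qed

lemma wave_eq_iff: "wave A B x = wave A' B' y \<longleftrightarrow>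
  (\<exists>n::int. (A * bc x + B * gc x) / 3 = (A' * bc y + B' * gc y) / 3 + n)"
proof -
  have "cis u = cis v \<longleftrightarrow> (\<exists>n::int. u = v + 2 * pi * n)" for u v :: real
    using sin_cos_eq_iff[of u v] by (auto simp: cis.ctr complex_eq_iff)
  moreover have "2 * pi / 3 * u = 2 * pi / 3 * v + 2 * pi * n \<longleftrightarrow> u / 3 = v / 3 + n" for u v n :: real
  proof -
    have E: "2 * pi / 3 * v + 2 * pi * n = 2 * pi * (v / 3 + n)" "2 * pi / 3 * u = 2 * pi * (u / 3)"
      by (simp_all add: algebra_simps)
    have ne: "2 * pi \<noteq> 0" by simp
    show ?thesis unfolding E mult_left_cancel[OF ne] by (rule refl)
  qed
  ultimately show ?thesis unfolding wave_def by (simp only:)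
qed

lemma wave_prods:
  "wave 1 2 x * wave 1 (- 1) x * wave (- 2) (- 1) x = 1"
  "wave 1 2 x * wave 1 (- 1) x + wave 1 (- 1) x * wave (- 2) (- 1) x + wave 1 2 x * wave (- 2) (- 1) x = cnj (e1 x)"
  unfolding e1_cnj by (simp_all add: wave_add wave_0)

text \<open>Three unit numbers with product 1 have the conjugate of their sum as second symmetric
  function, so \<open>e1\<close> alone fixes the cubic. Its roots give the phases up to order and
  integers, which the alcove resolves.\<close>

lemma e1_inj:
  assumes "x \<in> closure tri" "y \<in> closure tri" "e1 x = e1 y"
  shows "x = y"
proof -
  have "bc x = bc y \<and> gc x = gc y"
  proof -
    let ?z1 = "wave 1 2 x" and ?z2 = "wave 1 (- 1) x" and ?z3 = "wave (- 2) (- 1) x"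
    let ?w1 = "wave 1 2 y" and ?w2 = "wave 1 (- 1) y" and ?w3 = "wave (- 2) (- 1) y"
    have perm: "(?w1 = ?z1 \<and> ?w2 = ?z2 \<and> ?w3 = ?z3) \<or> (?w1 = ?z1 \<and> ?w2 = ?z3 \<and> ?w3 = ?z2) \<or>
      (?w1 = ?z2 \<and> ?w2 = ?z1 \<and> ?w3 = ?z3) \<or> (?w1 = ?z2 \<and> ?w2 = ?z3 \<and> ?w3 = ?z1) \<or>
      (?w1 = ?z3 \<and> ?w2 = ?z1 \<and> ?w3 = ?z2) \<or> (?w1 = ?z3 \<and> ?w2 = ?z2 \<and> ?w3 = ?z1)"
      by (rule triple_eq_perm) (use assms(3) wave_prods[of x] wave_prods[of y] in \<open>simp_all add: e1_def[symmetric]\<close>)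
    define t1 t2 t3 where t: "t1 = (bc x + 2 * gc x) / 3" "t2 = (bc x - gc x) / 3" "t3 = (- 2 * bc x - gc x) / 3"
    have cl: "0 \<le> bc x" "0 \<le> gc x" "bc x + gc x \<le> 1" "0 \<le> bc y" "0 \<le> gc y" "bc y + gc y \<le> 1"
      using closure_tri[OF assms(1)] closure_tri[OF assms(2)] by auto
    have X: "(of_int 1 * bc x + of_int 2 * gc x) / 3 = t1" "(of_int 1 * bc x + of_int (- 1) * gc x) / 3 = t2"
      "(of_int (- 2) * bc x + of_int (- 1) * gc x) / 3 = t3"
      "(of_int 1 * bc y + of_int 2 * gc y) / 3 = (bc y + 2 * gc y) / 3"
      "(of_int 1 * bc y + of_int (- 1) * gc y) / 3 = (bc y - gc y) / 3"
      by (simp_all add: t)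
    note fin = alcove_fundamental_domain[OF cl t]
    from perm show ?thesis
      unfolding wave_eq_iff X by - (elim disjE conjE exE; (rule fin, assumption, assumption, simp))
  qed
  then show ?thesis using coords_eqI by blast
qed

lemma alternant_eq_e1: "alternant 2 1 x = e1 x * alternant 1 1 x"
  using e1_alternant[of x 1 1] by (simp add: alternant_zero)

text \<open>The Vandermonde determinant, in the role of the first eigenfunction.\<close>

lemma alternant11: "alternant 1 1 x = (wave 1 2 x - wave 1 (- 1) x) * ((wave 1 (- 1) x - wave (- 2) (- 1) x) * (wave 1 2 x - wave (- 2) (- 1) x))"
  unfolding alternant_def by (simp add: left_diff_distrib right_diff_distrib wave_add)

lemma alternant11_nonzero:
  assumes "x \<in> tri"
  shows "alternant 1 1 x \<noteq> 0"
proof -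
  have b: "0 < bc x" "0 < gc x" "bc x + gc x < 1" using assms by (auto simp: tri_def)
  \<comment> \<open>The phase differences of the three waves are \<open>gc\<close>,
    \<open>bc\<close> and \<open>bc + gc\<close>, all strictly between 0 and 1 inside the
    triangle.\<close>
  have no: "u \<noteq> v + of_int n" if "0 < u - v" "u - v < 1" for u v :: real and n :: int
  proof
    assume "u = v + of_int n"
    then have "0 < real_of_int n" "real_of_int n < 1" using that by auto
    then show False by simp
  qed
  have "wave 1 2 x \<noteq> wave 1 (- 1) x" unfolding wave_eq_iff using b by (intro notI, elim exE) (erule no[THEN notE, rotated 2]; simp add: field_simps)
  moreover have "wave 1 (- 1) x \<noteq> wave (- 2) (- 1) x" unfolding wave_eq_iff using b by (intro notI, elim exE) (erule no[THEN notE, rotated 2]; simp add: field_simps)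
  moreover have "wave 1 2 x \<noteq> wave (- 2) (- 1) x" unfolding wave_eq_iff using b by (intro notI, elim exE) (erule no[THEN notE, rotated 2]; simp add: field_simps)
  ultimately show ?thesis unfolding alternant11 by simp
qed

lemma alternant_frontier: "x \<in> frontier tri \<Longrightarrow> alternant m n x = 0"
proof -
  assume "x \<in> frontier tri"
  then consider "bc x = 0" | "gc x = 0" | "gc x = 1 - bc x" using frontier_tri[of x] by fastforce
  then show ?thesis
  proof cases
    case 3
    \<comment> \<open>On the side \<open>bc + gc = 1\<close> the phase is a third of
      \<open>(A - B) * bc + B\<close>, so a wave depends only on \<open>A - B\<close> and on
      \<open>B\<close> modulo 3; the six terms then cancel in pairs.\<close>
    have *: "wave A B x = wave A' B' x" if "A - B = A' - B'" "B = B' + 3 * k" for A B A' B' k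
      unfolding wave_eq_iff 3
    proof (intro exI[of _ k])
      have "real_of_int A = A' - B' + B" using that(1) by linarith
      then show "(A * bc x + B * (1 - bc x)) / 3 = (A' * bc x + B' * (1 - bc x)) / 3 + k"
        using that(2) by (simp add: field_simps)
    qed
    have "wave (m + 2 * n) (2 * m + n) x = wave (- 2 * m - n) (- m - 2 * n) x" by (rule *[where k = "m + n"]) simp_all
    moreover have "wave (m + 2 * n) (n - m) x = wave (m - n) (- m - 2 * n) x" by (rule *[where k = n]) simp_all
    moreover have "wave (- 2 * m - n) (n - m) x = wave (m - n) (2 * m + n) x" by (rule *[where k = "- m"]) simp_all
    ultimately show ?thesis by (simp add: alternant_def)
  qed (simp_all add: alternant_def wave_def)
qed

lemma continuous_on_alternant: "continuous_on S (alternant m n)"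
  using helmholtz_on_imp_continuous_on[OF helmholtz_alternant] continuous_on_subset by blast

lemma continuous_on_e1: "continuous_on S e1"
proof -
  have "continuous_on S (wave A B)" for A B
    using helmholtz_on_imp_continuous_on[OF helmholtz_wave] continuous_on_subset by blast
  then show ?thesis unfolding e1_def[abs_def] by (intro continuous_intros)
qed

lemma completeness:
  assumes "continuous_on (closure tri) u"
    "\<And>k. k \<in> idx \<Longrightarrow> (LINT x|lborel. indicator tri x *\<^sub>R (u x * ff k x)) = 0" "x \<in> tri"
  shows "u x = 0"
proof (rule stone_weierstrass_completeness[OF open_tri bounded_tri, where F = ff and K = idx and
    S = "{\<lambda>x. Re (e1 x), \<lambda>x. Im (e1 x)}" and w = "alternant 1 1"])
  show "continuous_on (closure tri) (ff k)" for k
    unfolding ff_def[abs_def] by (rule continuous_on_alternant)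
  show "continuous_on (closure tri) r" if "r \<in> {\<lambda>x. Re (e1 x), \<lambda>x. Im (e1 x)}" for r
    using that by (auto intro!: continuous_intros continuous_on_e1)
  show "\<exists>r\<in>{\<lambda>x. Re (e1 x), \<lambda>x. Im (e1 x)}. r x \<noteq> r y" if "x \<in> closure tri" "y \<in> closure tri" "x \<noteq> y" for x y
    using e1_inj[OF that(1,2)] that(3) by (auto simp: complex_eq_iff)
qed (use assms alternant_in_cspan[of 1 1] alternant11_nonzero multipliers in \<open>auto\<close>)

section \<open>Symmetries of the equilateral triangle\<close>

definition rot :: "real^2 \<Rightarrow> real^2" where "rot x = pt (1 - bc x - gc x) (bc x)"
definition refl :: "real^2 \<Rightarrow> real^2" where "refl x = pt (gc x) (bc x)"

lemma rot_tri: "rot x \<in> tri \<longleftrightarrow> x \<in> tri" and refl_tri: "refl x \<in> tri \<longleftrightarrow> x \<in> tri"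
  by (auto simp: rot_def refl_def tri_def)

lemma rot_dist: "dist (rot x) (rot y) = dist x y" and refl_dist: "dist (refl x) (refl y) = dist x y"
proof -
  have "(dist (rot x) (rot y))\<^sup>2 = (dist x y)\<^sup>2" "(dist (refl x) (refl y))\<^sup>2 = (dist x y)\<^sup>2"
    unfolding dist_eq_coords l(2-4) rot_def refl_def bc_pt gc_pt by (simp_all add: power2_eq_square field_simps)
  then show "dist (rot x) (rot y) = dist x y" "dist (refl x) (refl y) = dist x y" by simp_all
qed

lemma rot_isometry: "is_isometry_of tri rot" and refl_isometry: "is_isometry_of tri refl"
proof -
  have "bij_betw rot tri tri"
    \<comment> \<open>\<open>rot\<close> permutes the three barycentric weights cyclically, so its
      inverse is \<open>rot\<close> applied twice.\<close>
    by (rule bij_betw_byWitness[where f' = "\<lambda>x. rot (rot x)"]) (auto simp: rot_tri, auto simp: rot_def pt_bc_gc)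
  then show "is_isometry_of tri rot" by (simp add: is_isometry_of_def rot_dist)
  have "bij_betw refl tri tri"
    by (rule bij_betw_byWitness[where f' = refl]) (auto simp: refl_tri, auto simp: refl_def pt_bc_gc)
  then show "is_isometry_of tri refl" by (simp add: is_isometry_of_def refl_dist)
qed

lemma wave_rot: "wave A B (rot x) = cis (2 * pi / 3 * A) * wave (B - A) (- A) x"
  by (simp add: wave_def rot_def cis_mult algebra_simps)

lemma cis_third: "cis (2 * pi / 3 * real_of_int (A + 3 * k)) = cis (2 * pi / 3 * real_of_int A)"
proof -
  have "2 * pi / 3 * real_of_int (A + 3 * k) = 2 * pi / 3 * real_of_int A + 2 * pi * real_of_int k"
    by (simp add: algebra_simps)
  then have "cis (2 * pi / 3 * real_of_int (A + 3 * k)) = cis (2 * pi / 3 * real_of_int A) * cis (2 * pi * real_of_int k)"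
    by (simp only: cis_mult)
  then show ?thesis by (simp add: cis_multiple_2pi)
qed

text \<open>The eigenfunctions transform by a character of the rotation group of order 3, given by
  \<open>m - n\<close> modulo 3.\<close>

lemma alternant_rot: "alternant m n (rot x) = cis (2 * pi / 3 * real_of_int (m - n)) * alternant m n x"
proof -
  have "cis (2 * pi / 3 * real_of_int (m + 2 * n)) = cis (2 * pi / 3 * real_of_int (m - n))"
  proof -
    have "m + 2 * n = (m - n) + 3 * n" by simp
    then show ?thesis by (simp only: cis_third)
  qed
  moreover have "cis (2 * pi / 3 * real_of_int (- 2 * m - n)) = cis (2 * pi / 3 * real_of_int (m - n))"
  proof -
    have "- 2 * m - n = (m - n) + 3 * (- m)" by simp
    then show ?thesis by (simp only: cis_third)
  qed
  moreover have "2 * m + n - (m + 2 * n) = m - n" "n - m - (m + 2 * n) = - 2 * m - n"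
    "- m - 2 * n - (m - n) = - 2 * m - n" "- m - 2 * n - (- 2 * m - n) = m - n"
    "n - m - (- 2 * m - n) = m + 2 * n" "2 * m + n - (m - n) = m + 2 * n"
    "- (m + 2 * n) = - m - 2 * n" "- (m - n) = n - m" "- (- 2 * m - n) = 2 * m + n" by simp_all
  ultimately show ?thesis
    unfolding alternant_def wave_rot by (simp only: right_diff_distrib distrib_left) simp
qed

lemma e1_rot: "e1 (rot x) = cis (2 * pi / 3) * e1 x"
proof -
  have "cis (2 * pi / 3 * real_of_int (- 2)) = cis (2 * pi / 3)"
    using cis_third[of 1 "-1"] by simp
  then show ?thesis unfolding e1_def wave_rot by (simp add: algebra_simps)
qed

lemma e1_refl: "e1 (refl x) = cnj (e1 x)"
  unfolding e1_cnj unfolding e1_def wave_def refl_def by (simp add: algebra_simps)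

lemma omega: "cis (2 * pi / 3) \<noteq> 1" "(cis (2 * pi / 3))\<^sup>2 + cis (2 * pi / 3) + 1 = 0"
proof -
  have c: "cos (2 * pi / 3) = - 1/2"
    using cos_double_cos[of "pi / 3"] by (simp add: cos_60 power2_eq_square)
  then show ne: "cis (2 * pi / 3) \<noteq> 1" by (simp add: complex_eq_iff)
  have "(cis (2 * pi / 3))^3 = 1" by (simp add: power3_eq_cube cis_mult)
  then have "(cis (2 * pi / 3) - 1) * ((cis (2 * pi / 3))\<^sup>2 + cis (2 * pi / 3) + 1) = 0"
    by (simp add: power2_eq_square power3_eq_cube algebra_simps)
  then show "(cis (2 * pi / 3))\<^sup>2 + cis (2 * pi / 3) + 1 = 0" using ne by simp
qed

text \<open>\<open>alternant 1 2\<close> and \<open>alternant 2 1\<close> belong to different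
  characters of the rotation: up to sign the integrand is \<open>(alternant 1 2 x)\<^sup>2\<close>,
  which the rotation multiplies by a primitive cube root of unity, while the integral is
  invariant.\<close>

lemma alternant12_orthogonal: "(LINT x|lborel. indicator tri x *\<^sub>R (alternant 1 2 x * cnj (alternant 2 1 x))) = 0"
proof -
  define h where "h x = indicator tri x *\<^sub>R (alternant 1 2 x * alternant 1 2 x)" for x
  have m: "h \<in> borel_measurable borel"
    unfolding h_def[abs_def]
    by (rule borel_measurable_continuous_on_indicator) (auto simp: open_tri intro!: continuous_intros continuous_on_alternant)
  have "cis (2 * pi / 3 * real_of_int (1 - 2)) * cis (2 * pi / 3 * real_of_int (1 - 2)) = cis (2 * pi / 3)"
    using cis_third[of 1 "-1"] by (simp add: cis_mult)
  then have "h (rot x) = cis (2 * pi / 3) * h x" for x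
    unfolding h_def alternant_rot by (simp add: indicator_def rot_tri mult_ac)
  then have "(LINT x|lborel. h x) = (LINT x|lborel. cis (2 * pi / 3) * h x)"
    using integral_lborel_isometry[OF rot_dist m] by simp
  also have "\<dots> = cis (2 * pi / 3) * (LINT x|lborel. h x)" by (rule integral_mult_right_zero)
  finally have "(1 - cis (2 * pi / 3)) * (LINT x|lborel. h x) = 0" by (simp add: algebra_simps)
  then have "(LINT x|lborel. h x) = 0" using omega(1) by simp
  moreover have "indicator tri x *\<^sub>R (alternant 1 2 x * cnj (alternant 2 1 x)) = - h x" for x
    unfolding h_def alternant_cnj by simp
  ultimately show ?thesis by simp
qed

text \<open>The square of the Vandermonde determinant is the discriminant of the cubic with
  symmetric functions \<open>e1\<close>, its conjugate and 1, and it is minus the squared norm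
  because conjugation changes the sign. Both norms together thus yield
  \<open>Re ((e1 x)^3)\<close>.\<close>

lemma norm_alternant_discriminant:
  "(norm (alternant 1 1 x))\<^sup>2 = 27 - 18 * (norm (e1 x))\<^sup>2 - ((norm (e1 x))\<^sup>2)\<^sup>2 + 8 * Re ((e1 x)^3)"
proof -
  let ?z = "wave 1 2 x" and ?w = "wave 1 (- 1) x" and ?v = "wave (- 2) (- 1) x"
  define s t where d: "s = e1 x" "t = cnj (e1 x)"
  have st: "s = ?z + ?w + ?v" "t = ?z * ?w + ?w * ?v + ?z * ?v" "?z * ?w * ?v = 1"
    using wave_prods[of x] by (simp_all add: d e1_def)
  \<comment> \<open>Discriminant of \<open>T^3 - s * T\<^sup>2 + t * T - 1\<close>, with the product
    of the roots kept as a factor so that it is a polynomial identity.\<close>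
  have "(alternant 1 1 x)\<^sup>2 = s\<^sup>2 * t\<^sup>2 - 4 * t^3 * 1 - 4 * s^3 * (?z * ?w * ?v) + 18 * s * t * (?z * ?w * ?v) - 27 * (?z * ?w * ?v)\<^sup>2"
    unfolding alternant11 st(1,2) by algebra
  then have A: "(alternant 1 1 x)\<^sup>2 = (s * t)\<^sup>2 - 4 * (s^3 + t^3) + 18 * (s * t) - 27"
    unfolding st(3) by (simp add: algebra_simps power_mult_distrib)
  have n: "s * t = of_real ((norm (e1 x))\<^sup>2)" by (simp add: d complex_norm_square del: of_real_power)
  have c: "s^3 + t^3 = of_real (2 * Re ((e1 x)^3))" unfolding d complex_cnj_power[symmetric] by (rule complex_add_cnj)
  have "complex_of_real ((norm (alternant 1 1 x))\<^sup>2) = alternant 1 1 x * cnj (alternant 1 1 x)"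
    by (simp add: complex_norm_square del: of_real_power)
  also have "\<dots> = - (alternant 1 1 x)\<^sup>2" unfolding alternant_cnj by (simp add: power2_eq_square)
  also have "\<dots> = of_real (27 - 18 * (norm (e1 x))\<^sup>2 - ((norm (e1 x))\<^sup>2)\<^sup>2 + 8 * Re ((e1 x)^3))"
    unfolding A n c by simp
  finally show ?thesis unfolding of_real_eq_iff .
qed

text \<open>\<open>I\<close> is closed under exchange of \<open>m\<close> and \<open>n\<close>
  because the conjugate of \<open>ff (m, n)\<close> is \<open>- ff (n, m)\<close>; this provides the
  expansion in conjugates that \<open>eigenspace_kernel\<close> asks for.\<close>

lemma eigenspace_kernel_alternant:
  assumes basis: "dirichlet_eigenbasis tri lam e"
    and eq: "\<forall>\<mu>\<ge>0. local_weyl_counting lam e x \<mu> = local_weyl_counting lam e y \<mu>"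
    and xy: "x \<in> tri" "y \<in> tri"
    and mn: "1 \<le> m0" "1 \<le> n0"
    and I: "finite I" "I \<subseteq> idx" "\<And>k. k \<in> I \<Longrightarrow> eigval (fst k) (snd k) = eigval m0 n0" "\<And>m n. (m, n) \<in> I \<Longrightarrow> (n, m) \<in> I"
    and orth: "\<And>i j. i \<in> I \<Longrightarrow> j \<in> I \<Longrightarrow> i \<noteq> j \<Longrightarrow> (LINT x|lborel. indicator tri x *\<^sub>R (ff i x * cnj (ff j x))) = 0"
    and nz: "\<And>k. k \<in> I \<Longrightarrow> \<exists>x\<in>tri. ff k x \<noteq> 0"
    and all: "\<And>k. k \<in> idx \<Longrightarrow> eigval (fst k) (snd k) = eigval m0 n0 \<Longrightarrow> k \<in> I"
  obtains N where "\<And>i. i \<in> I \<Longrightarrow> 0 < N i"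
    "(\<Sum>i\<in>I. (norm (ff i x))\<^sup>2 / N i) = (\<Sum>i\<in>I. (norm (ff i y))\<^sup>2 / N i)"
proof -
  have pos: "eigval m0 n0 > 0"
  proof -
    have "0 < m0\<^sup>2 + m0 * n0 + n0\<^sup>2" using mn by (intro add_pos_pos) auto
    then have "0 < real_of_int (m0\<^sup>2 + m0 * n0 + n0\<^sup>2)" by (simp only: of_int_0_less_iff)
    then show ?thesis unfolding eigval_def using l(1) by (intro mult_pos_pos) auto
  qed
  have span: "\<exists>d. \<forall>x\<in>tri. ff k x = (\<Sum>i\<in>I. d i * cnj (ff i x))" if k: "k \<in> idx" "eigval (fst k) (snd k) = eigval m0 n0" for k
  proof -
    obtain m n where mn: "k = (m, n)" by (cases k)
    have "(n, m) \<in> I" using all[OF k] I(4) mn by blast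
    have "(\<Sum>i\<in>I. (if i = (n, m) then - 1 else 0) * cnj (ff i x)) = ff k x" for x
    proof -
      have "(\<Sum>i\<in>I. (if i = (n, m) then - 1 else 0) * cnj (ff i x)) = (\<Sum>i\<in>I. if i = (n, m) then - cnj (ff (n, m) x) else 0)"
        by (rule sum.cong) auto
      then show ?thesis using I(1) \<open>(n, m) \<in> I\<close> by (simp add: ff_def alternant_cnj mn)
    qed
    then show ?thesis by (intro exI[of _ "\<lambda>i. if i = (n, m) then - 1 else 0"]) simp
  qed
  obtain N where N: "\<And>i. i \<in> I \<Longrightarrow> 0 < N i"
    "\<And>x. x \<in> tri \<Longrightarrow> (\<Sum>j | lam j = sqrt (eigval m0 n0). (norm (e j x))\<^sup>2) = (\<Sum>i\<in>I. (norm (ff i x))\<^sup>2 / N i)"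
  proof (rule eigenspace_kernel[OF open_tri convex_tri bounded_tri basis, where
        K = idx and F = ff and I = I and v = ff and \<kappa> = "\<lambda>k. eigval (fst k) (snd k)" and \<mu> = "eigval m0 n0"])
    show "u x = 0" if "continuous_on (closure tri) u" "x \<in> tri"
      "\<And>k. k \<in> idx \<Longrightarrow> (LINT x|lborel. indicator tri x *\<^sub>R (u x * ff k x)) = 0" for u x
      by (rule completeness) (fact that)+
    show "helmholtz_on UNIV (eigval (fst k) (snd k)) (ff k)" for k
      unfolding ff_def[abs_def] by (rule helmholtz_alternant)
    then show "helmholtz_on UNIV (eigval m0 n0) (ff k)" if "k \<in> I" for k using I(3)[OF that] by metis
  qed (use span pos I orth nz in \<open>auto simp: ff_def alternant_frontier\<close>)
  have "(\<Sum>j | lam j = sqrt (eigval m0 n0). (norm (e j x))\<^sup>2) = (\<Sum>j | lam j = sqrt (eigval m0 n0). (norm (e j y))\<^sup>2)"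
    by (rule weyl_jump_eq_of_weyl_eq) (use basis eq pos in \<open>auto simp: dirichlet_eigenbasis_def\<close>)
  then show ?thesis using that[OF N(1)] by (simp add: N(2)[OF xy(1)] N(2)[OF xy(2)])
qed

text \<open>The two lowest values of the form on positive pairs are 3, at (1, 1), and 7, at (1, 2)
  and (2, 1).\<close>

lemma norm_form_small:
  fixes m n :: int
  assumes "1 \<le> m" "1 \<le> n" "m\<^sup>2 + m * n + n\<^sup>2 \<le> 7"
  shows "m \<in> {1, 2} \<and> n \<in> {1, 2}"
proof -
  have *: "k \<le> 2" if "k\<^sup>2 \<le> 7" for k :: int
  proof (rule ccontr)
    assume "\<not> k \<le> 2"
    then have "3\<^sup>2 \<le> k\<^sup>2" by (intro power_mono) auto
    then show False using that by simp
  qed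
  have "0 \<le> m * n" "0 \<le> m\<^sup>2" "0 \<le> n\<^sup>2" using assms by auto
  then have "m\<^sup>2 \<le> 7" "n\<^sup>2 \<le> 7" using assms(3) by linarith+
  then have "m \<le> 2" "n \<le> 2" using * by auto
  then show ?thesis using assms by auto
qed

text \<open>The lowest eigenvalue gives the norm of \<open>alternant 1 1\<close>, the next one that
  of \<open>e1\<close>, and the discriminant then \<open>Re ((e1 x)^3)\<close>. Hence the cube of
  \<open>e1\<close> is known up to conjugation and \<open>e1\<close> up to conjugation and cube
  roots of unity, which is how the six symmetries act on it.\<close>

theorem isometry_exists:
  assumes basis: "dirichlet_eigenbasis tri lam e" and xy: "x \<in> tri" "y \<in> tri"
    and eq: "\<forall>\<mu>\<ge>0. local_weyl_counting lam e x \<mu> = local_weyl_counting lam e y \<mu>"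
  shows "\<exists>\<phi>. is_isometry_of tri \<phi> \<and> \<phi> x = y"
proof -
  have eigval_eq: "eigval m n = eigval m' n' \<longleftrightarrow> m\<^sup>2 + m * n + n\<^sup>2 = m'\<^sup>2 + m' * n' + n'\<^sup>2" for m n m' n'
  proof -
    have ne: "16 * pi\<^sup>2 / (9 * l) \<noteq> 0" using l(1) by simp
    show ?thesis unfolding eigval_def mult_left_cancel[OF ne] of_int_eq_iff by (rule refl)
  qed
  have e21: "norm (alternant 2 1 z) = norm (e1 z) * norm (alternant 1 1 z)" for z by (simp add: alternant_eq_e1 norm_mult)
  have e12: "norm (alternant 1 2 z) = norm (alternant 2 1 z)" for z
    by (metis alternant_cnj complex_mod_cnj norm_minus_cancel)
  have n1: "norm (alternant 1 1 x) = norm (alternant 1 1 y)"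
  proof -
    obtain N where "\<And>i. i \<in> {(1, 1)} \<Longrightarrow> 0 < N i"
      "(\<Sum>i\<in>{(1, 1)}. (norm (ff i x))\<^sup>2 / N i) = (\<Sum>i\<in>{(1, 1)}. (norm (ff i y))\<^sup>2 / N i)"
    proof (rule eigenspace_kernel_alternant[OF basis eq xy, of 1 1 "{(1, 1)}"])
      show "k \<in> {(1, 1)}" if "k \<in> idx" "eigval (fst k) (snd k) = eigval 1 1" for k
        using that norm_form_small[of "fst k" "snd k"] unfolding eigval_eq by (cases k) (auto simp: idx_def)
      show "\<exists>x\<in>tri. ff k x \<noteq> 0" if "k \<in> {(1, 1)}" for k
        using that xy(1) alternant11_nonzero by (auto simp: ff_def)
    qed (auto simp: idx_def)
    then have "0 < N (1, 1)" "(norm (alternant 1 1 x))\<^sup>2 / N (1, 1) = (norm (alternant 1 1 y))\<^sup>2 / N (1, 1)"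
      by (auto simp: ff_def)
    then show ?thesis by simp
  qed
  have n2: "norm (e1 x) = norm (e1 y)"
  \<comment> \<open>The eigenspace lemma asks for nonzero functions; if \<open>alternant 2 1\<close>
    vanishes throughout, then so does \<open>e1\<close> at both points.\<close>
  proof (cases "\<exists>z\<in>tri. alternant 2 1 z \<noteq> 0")
    case False
    then have "alternant 2 1 x = 0" "alternant 2 1 y = 0" using xy by auto
    then show ?thesis using alternant11_nonzero xy by (simp add: alternant_eq_e1)
  next
    case True
    then obtain z where z: "z \<in> tri" "alternant 2 1 z \<noteq> 0" by blast
    then have z': "alternant 1 2 z \<noteq> 0" using e12[of z] by auto
    let ?I = "{(1, 2), (2, 1)} :: (int \<times> int) set"
    have o2: "(LINT x|lborel. indicator tri x *\<^sub>R (alternant 2 1 x * cnj (alternant 1 2 x))) = 0"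
  proof -
      have "(LINT x|lborel. indicator tri x *\<^sub>R (alternant 2 1 x * cnj (alternant 1 2 x))) =
          (LINT x|lborel. cnj (indicator tri x *\<^sub>R (alternant 1 2 x * cnj (alternant 2 1 x))))"
        by (simp only: complex_cnj_scaleR complex_cnj_mult complex_cnj_cnj mult.commute)
      then show ?thesis
        unfolding Bochner_Integration.integral_cnj alternant12_orthogonal by simp
    qed
    obtain N where N: "\<And>i. i \<in> ?I \<Longrightarrow> 0 < N i"
      "(\<Sum>i\<in>?I. (norm (ff i x))\<^sup>2 / N i) = (\<Sum>i\<in>?I. (norm (ff i y))\<^sup>2 / N i)"
    proof (rule eigenspace_kernel_alternant[OF basis eq xy, of 1 2 ?I])
      show "k \<in> ?I" if "k \<in> idx" "eigval (fst k) (snd k) = eigval 1 2" for k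
        using that norm_form_small[of "fst k" "snd k"] unfolding eigval_eq by (cases k) (auto simp: idx_def)
      show "\<exists>x\<in>tri. ff k x \<noteq> 0" if "k \<in> ?I" for k
        using that z z' by (auto simp: ff_def)
      show "eigval (fst k) (snd k) = eigval 1 2" if "k \<in> ?I" for k
        using that unfolding eigval_eq by auto
      show "(LINT x|lborel. indicator tri x *\<^sub>R (ff i x * cnj (ff j x))) = 0" if "i \<in> ?I" "j \<in> ?I" "i \<noteq> j" for i j
        using that alternant12_orthogonal o2 by (auto simp: ff_def)
    qed (auto simp: idx_def)
    \<comment> \<open>Both members of the pair have the same modulus, so the unknown norms merge
      into one positive factor.\<close>
    define C where "C = 1 / N (1, 2) + 1 / N (2, 1)"
    have "C > 0" unfolding C_def using N(1)[of "(1, 2)"] N(1)[of "(2, 1)"] by (intro add_pos_pos) auto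
    have "(\<Sum>i\<in>?I. (norm (ff i w))\<^sup>2 / N i) = (norm (alternant 2 1 w))\<^sup>2 * C" for w
      by (simp add: ff_def e12 C_def algebra_simps)
    then have "(norm (alternant 2 1 x))\<^sup>2 = (norm (alternant 2 1 y))\<^sup>2" using N(2) \<open>C > 0\<close> by simp
    then have "norm (alternant 2 1 x) = norm (alternant 2 1 y)" by simp
    then show ?thesis using n1 alternant11_nonzero[OF xy(1)] alternant11_nonzero[OF xy(2)] unfolding e21 by simp
  qed
  have re: "Re ((e1 x)^3) = Re ((e1 y)^3)"
    using norm_alternant_discriminant[of x] norm_alternant_discriminant[of y] n1 n2 by simp
  have "(Im ((e1 x)^3))\<^sup>2 = (Im ((e1 y)^3))\<^sup>2"
  proof -
    have "(norm ((e1 x)^3))\<^sup>2 = (norm ((e1 y)^3))\<^sup>2" using n2 by (simp add: norm_power)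
    then show ?thesis unfolding cmod_power2 using re by simp
  qed
  then have "Im ((e1 y)^3) = Im ((e1 x)^3) \<or> Im ((e1 y)^3) = - Im ((e1 x)^3)" by (auto simp: power2_eq_iff)
  then have "(e1 y)^3 = (e1 x)^3 \<or> (e1 y)^3 = cnj ((e1 x)^3)" using re by (auto simp: complex_eq_iff simp del: complex_cnj_power)
  \<comment> \<open>The reflection conjugates \<open>e1\<close>; \<open>\<psi>\<close> absorbs it,
    and only a cube root of unity is left.\<close>
  then obtain \<psi> where \<psi>: "is_isometry_of tri \<psi>" "\<psi> x \<in> tri" "(e1 y)^3 = (e1 (\<psi> x))^3"
  proof
    assume "(e1 y)^3 = (e1 x)^3"
    then show ?thesis using that[of "\<lambda>x. x"] is_isometry_of_id xy by simp
  next
    assume "(e1 y)^3 = cnj ((e1 x)^3)"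
    then show ?thesis using that[of refl] refl_isometry xy by (simp add: refl_tri e1_refl)
  qed
  let ?o = "cis (2 * pi / 3)" and ?w = "\<psi> x"
  \<comment> \<open>A difference of cubes factors over the cube roots of unity; each factor
    corresponds to a power of \<open>rot\<close>.\<close>
  have "(e1 y - e1 ?w) * ((e1 y - ?o * e1 ?w) * (e1 y - ?o * (?o * e1 ?w))) = 0"
    using \<psi>(3) omega(2) by algebra
  then consider "e1 y = e1 ?w" | "e1 y = e1 (rot ?w)" | "e1 y = e1 (rot (rot ?w))"
    by (auto simp: e1_rot)
  moreover have "z = y" if "z \<in> tri" "e1 y = e1 z" for z
    by (rule e1_inj) (use that xy closure_subset[of tri] in auto)
  moreover have "rot ?w \<in> tri" "rot (rot ?w) \<in> tri" using \<psi>(2) by (auto simp: rot_tri)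
  ultimately consider "y = ?w" | "y = rot ?w" | "y = rot (rot ?w)" using \<psi>(2) by metis
  then show ?thesis
  proof cases
    case 1 then show ?thesis using \<psi>(1) by blast
  next
    case 2 then show ?thesis using is_isometry_of_comp[OF \<psi>(1) rot_isometry] by blast
  next
    case 3 then show ?thesis
      using is_isometry_of_comp[OF is_isometry_of_comp[OF \<psi>(1) rot_isometry] rot_isometry] by blast
  qed
qed

end

section \<open>Placing a given triangle in coordinates\<close>

theorem theorem1p2:
  fixes \<Omega> :: "(real^2) set" and lam :: "nat \<Rightarrow> real"
    and e :: "nat \<Rightarrow> real^2 \<Rightarrow> complex" and x y :: "real^2"
  assumes "is_open_equilateral_triangle \<Omega> \<or> is_open_isosceles_right_triangle \<Omega>"
    and "dirichlet_eigenbasis \<Omega> lam e"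
    and "x \<in> \<Omega>" and "y \<in> \<Omega>"
    and "\<forall>\<mu>\<ge>0. local_weyl_counting lam e x \<mu> = local_weyl_counting lam e y \<mu>"
  shows "\<exists>\<phi>. is_isometry_of \<Omega> \<phi> \<and> \<phi> x = y"
  using assms(1)
proof
  assume "is_open_equilateral_triangle \<Omega>"
  then obtain a b c where abc: "a \<noteq> b" "dist a b = dist b c" "dist b c = dist c a"
    "\<Omega> = interior (convex hull {a, b, c})"
    unfolding is_open_equilateral_triangle_def by blast
  define p q where pq: "p = b - a" "q = c - a"
  define l where "l = p \<bullet> p"
  have l: "l > 0" using abc(1) by (simp add: l_def pq)
  have "norm p = norm q" "norm (p - q) = norm p"
    using abc(2,3) by (simp_all add: pq dist_norm norm_minus_commute)
  then have "p \<bullet> p = q \<bullet> q" "(p - q) \<bullet> (p - q) = p \<bullet> p"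
    by (simp_all only: norm_eq)
  \<comment> \<open>The third side determines the angle: expanding
    \<open>(p - q) \<bullet> (p - q) = l\<close> leaves
    \<open>2 * (p \<bullet> q) = l\<close>.\<close>
  then have qq: "q \<bullet> q = l" and pq': "p \<bullet> q = l / 2"
    by (simp_all add: l_def inner_diff_left inner_diff_right inner_commute[of q p])
  have qp: "q \<bullet> p = l / 2" using pq' by (simp add: inner_commute)
  interpret equilateral_triangle a p q "(4 / (3 * l)) *\<^sub>R (p - (1/2) *\<^sub>R q)" "(4 / (3 * l)) *\<^sub>R (q - (1/2) *\<^sub>R p)" l
    by unfold_locales (use l l_def[symmetric] qq pq' qp in \<open>simp_all add: inner_diff_left field_simps\<close>)
  have "\<Omega> = tri" using interior_hull_eq abc(4) by (simp add: pq)
  then show ?thesis using isometry_exists assms(2-5) by simp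
next
  assume "is_open_isosceles_right_triangle \<Omega>"
  then obtain a b c where abc: "a \<noteq> b" "dist a b = dist a c" "(b - a) \<bullet> (c - a) = 0"
    "\<Omega> = interior (convex hull {a, b, c})"
    unfolding is_open_isosceles_right_triangle_def by blast
  define p q where pq: "p = b - a" "q = c - a"
  define l where "l = p \<bullet> p"
  have l: "l > 0" using abc(1) by (simp add: l_def pq)
  have "norm p = norm q"
    using abc(2) by (simp add: pq dist_norm norm_minus_commute)
  then have qq: "q \<bullet> q = l" by (simp only: norm_eq l_def)
  have pq': "p \<bullet> q = 0" "q \<bullet> p = 0" using abc(3) by (simp_all add: pq inner_commute)
  interpret right_triangle a p q "(1 / l) *\<^sub>R p" "(1 / l) *\<^sub>R q" l
    by unfold_locales (use l l_def[symmetric] qq pq' in simp_all)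
  have "\<Omega> = tri" using interior_hull_eq abc(4) by (simp add: pq)
  then show ?thesis using isometry_exists assms(2-5) by simp
qed

end
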